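(* Let $F=\mathbb{F}_q((z))$ and let $K$ be a field over $\mathbb{F}_q$ complete with respect to a discrete valuation $v$, with ring of integers $R$. Then the functor $M\mapsto\mathcal{C}_K\otimes_{\mathcal{B}_R}M$ from pure $\mathcal{B}_R$-isocrystals to $\sigma$-bundles over $\mathcal{C}_K$ is fully faithful.
   Context: Here $\mathcal{B}_R=R((z))$ (Laurent series with finite principal parts, coefficients in $R$), $\mathcal{A}_R=R[[z]]$, and $\sigma(\sum\alpha_nz^n)=\sum\alpha_n^qz^n$. A $\mathcal{B}_R$-isocrystal is a left $\mathcal{B}_R\{\tau\}$-module ($\tau x=\sigma(x)\tau$), locally free of finite type over $\mathcal{B}_R$, whose linearization $\sigma^*M\to M$ is an isomorphism; morphisms are $\mathcal{B}_R$-linear maps commuting with $\tau$. A lattice in $M$ is a locally free $R[[z]]$-submodule $T$ of finite type with $T[z^{-1}]=M$; $M$ is pure if there are integers $s,r$, $r>0$, and a lattice $T$ such that the $R[[z]]$-span of $\tau^{r}T$ is $z^sT$. With $|x|=q^{-v(x)}$, $\mathcal{C}_K$ is the ring of series $\sum_{n\in\mathbb{Z}}\alpha_nz^n$, $\alpha_n\in K$, with $|\alpha_n|\varepsilon^n\to0$ as $n\to\pm\infty$ for every $\varepsilon\in(0,1)$, with $\sigma(\sum\alpha_nz^n)=\sum\alpha_n^qz^n$; it contains $R((z))$ compatibly with $\sigma$. A $\sigma$-bundle is a left $\mathcal{C}_K\{\tau\}$-module locally free of finite type over $\mathcal{C}_K$ with linearized structure map an isomorphism. *)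

theory Defs
  imports
    "HOL-Analysis.Analysis"
    "HOL-Algebra.Free_Abelian_Groups"
    "HOL-Algebra.Module"
    "HOL-Algebra.Ideal"
    "HOL-Computational_Algebra.Formal_Laurent_Series"
begin

section \<open>Discretely valued fields\<close>

text \<open>The value of \<open>v\<close> at \<open>0\<close> is never used.  The value group may be any nonzero subgroup of the
  integers.\<close>

definition discrete_valuation :: "('k::field \<Rightarrow> int) \<Rightarrow> bool" where
  "discrete_valuation v \<longleftrightarrow>
     (\<forall>x y. x \<noteq> 0 \<longrightarrow> y \<noteq> 0 \<longrightarrow> v (x * y) = v x + v y) \<and>
     (\<forall>x y. x \<noteq> 0 \<longrightarrow> y \<noteq> 0 \<longrightarrow> x + y \<noteq> 0 \<longrightarrow> v (x + y) \<ge> min (v x) (v y)) \<and>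
     (\<exists>x. x \<noteq> 0 \<and> v x \<noteq> 0)"

definition vabs :: "nat \<Rightarrow> ('k::field \<Rightarrow> int) \<Rightarrow> 'k \<Rightarrow> real" where
  "vabs q v x = (if x = 0 then 0 else real q powi (- v x))"

definition vdist :: "nat \<Rightarrow> ('k::field \<Rightarrow> int) \<Rightarrow> 'k \<Rightarrow> 'k \<Rightarrow> real" where
  "vdist q v x y = vabs q v (x - y)"

definition valuation_complete :: "nat \<Rightarrow> ('k::field \<Rightarrow> int) \<Rightarrow> bool" where
  "valuation_complete q v \<longleftrightarrow> Metric_space.mcomplete UNIV (vdist q v)"

definition valuation_integers :: "('k::field \<Rightarrow> int) \<Rightarrow> 'k set" where
  "valuation_integers v = {x. x = 0 \<or> v x \<ge> 0}"

text \<open>The unconditional sum of a family in \<open>K\<close> (unspecified if it does not converge).\<close>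

definition vsum :: "nat \<Rightarrow> ('k::field \<Rightarrow> int) \<Rightarrow> (int \<Rightarrow> 'k) \<Rightarrow> 'k" where
  "vsum q v f =
     (THE s. limitin (Metric_space.mtopology UNIV (vdist q v)) (sum f) s
               (finite_subsets_at_top UNIV))"


section \<open>The rings $R[[z]]$, $R((z))$ and $\mathcal{C}_K$\<close>

text \<open>\<open>R((z))\<close> and \<open>R[[z]]\<close> are subrings of the ring \<open>K((z))\<close> of formal Laurent series.\<close>

definition laurent_ring :: "('k::field \<Rightarrow> int) \<Rightarrow> 'k fls ring" where
  "laurent_ring v =
     \<lparr>carrier = {f. \<forall>n. fls_nth f n \<in> valuation_integers v},
      monoid.mult = (*), one = 1, zero = 0, add = (+)\<rparr>"

definition power_series_ring :: "('k::field \<Rightarrow> int) \<Rightarrow> 'k fls ring" where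
  "power_series_ring v =
     (laurent_ring v)\<lparr>carrier := {f \<in> carrier (laurent_ring v). \<forall>n<0. fls_nth f n = 0}\<rparr>"

definition laurent_frob :: "nat \<Rightarrow> 'k::field fls \<Rightarrow> 'k fls" where
  "laurent_frob q f = Abs_fls (\<lambda>n. (fls_nth f n) ^ q)"

text \<open>\<open>\<C>\<^sub>K\<close>: a series is given by its family of coefficients, indexed by the integers.\<close>

definition disc_ring :: "nat \<Rightarrow> ('k::field \<Rightarrow> int) \<Rightarrow> (int \<Rightarrow> 'k) ring" where
  "disc_ring q v =
     \<lparr>carrier = {\<alpha>. \<forall>\<epsilon>::real. 0 < \<epsilon> \<and> \<epsilon> < 1 \<longrightarrow>
                  ((\<lambda>n. vabs q v (\<alpha> n) * \<epsilon> powi n) \<longlongrightarrow> 0) at_top \<and>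
                  ((\<lambda>n. vabs q v (\<alpha> n) * \<epsilon> powi n) \<longlongrightarrow> 0) at_bot},
      monoid.mult = (\<lambda>\<alpha> \<beta> n. vsum q v (\<lambda>i. \<alpha> i * \<beta> (n - i))),
      one = (\<lambda>n. if n = 0 then 1 else 0),
      zero = (\<lambda>n. 0),
      add = (\<lambda>\<alpha> \<beta> n. \<alpha> n + \<beta> n)\<rparr>"

definition disc_frob :: "nat \<Rightarrow> (int \<Rightarrow> 'k::field) \<Rightarrow> (int \<Rightarrow> 'k)" where
  "disc_frob q \<alpha> = (\<lambda>n. \<alpha> n ^ q)"

text \<open>The inclusion of \<open>R((z))\<close> into \<open>\<C>\<^sub>K\<close> is \<^const>\<open>fls_nth\<close>.\<close>


section \<open>Base change of modules\<close>

text \<open>For a ring homomorphism \<open>\<phi>: B \<rightarrow> C\<close> and a \<open>B\<close>-module \<open>M\<close>, the \<open>C\<close>-module \<open>C \<otimes>\<^bsub>\<phi>, B\<^esub> M\<close> is the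
  free abelian group on \<open>C \<times> M\<close> modulo the subgroup \<open>tensor_rel\<close>; its elements are cosets.\<close>

definition tensor_rel ::
  "('b, 'x) ring_scheme \<Rightarrow> ('c, 'y) ring_scheme \<Rightarrow> ('b \<Rightarrow> 'c) \<Rightarrow> ('b, 'm, 'z) module_scheme
     \<Rightarrow> ('c \<times> 'm \<Rightarrow>\<^sub>0 int) set" where
  "tensor_rel B C \<phi> M = generate (free_Abelian_group (carrier C \<times> carrier M))
     ({frag_of (c \<oplus>\<^bsub>C\<^esub> c', m) - frag_of (c, m) - frag_of (c', m) | c c' m.
         c \<in> carrier C \<and> c' \<in> carrier C \<and> m \<in> carrier M} \<union>
      {frag_of (c, m \<oplus>\<^bsub>M\<^esub> m') - frag_of (c, m) - frag_of (c, m') | c m m'.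
         c \<in> carrier C \<and> m \<in> carrier M \<and> m' \<in> carrier M} \<union>
      {frag_of (c \<otimes>\<^bsub>C\<^esub> \<phi> b, m) - frag_of (c, b \<odot>\<^bsub>M\<^esub> m) | c b m.
         c \<in> carrier C \<and> b \<in> carrier B \<and> m \<in> carrier M})"

definition tensor_coset ::
  "('b, 'x) ring_scheme \<Rightarrow> ('c, 'y) ring_scheme \<Rightarrow> ('b \<Rightarrow> 'c) \<Rightarrow> ('b, 'm, 'z) module_scheme
     \<Rightarrow> ('c \<times> 'm \<Rightarrow>\<^sub>0 int) \<Rightarrow> ('c \<times> 'm \<Rightarrow>\<^sub>0 int) set" where
  "tensor_coset B C \<phi> M x =
     tensor_rel B C \<phi> M #>\<^bsub>free_Abelian_group (carrier C \<times> carrier M)\<^esub> x"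

abbreviation pure_tensor ::
  "('b, 'x) ring_scheme \<Rightarrow> ('c, 'y) ring_scheme \<Rightarrow> ('b \<Rightarrow> 'c) \<Rightarrow> ('b, 'm, 'z) module_scheme
     \<Rightarrow> 'c \<Rightarrow> 'm \<Rightarrow> ('c \<times> 'm \<Rightarrow>\<^sub>0 int) set" where
  "pure_tensor B C \<phi> M c m \<equiv> tensor_coset B C \<phi> M (frag_of (c, m))"

text \<open>The fields \<open>mult\<close> and \<open>one\<close> inherited from the ring record have no meaning for modules.
  The scalar \<open>a\<close> multiplies the first component of every generator of a representative.\<close>

definition base_change ::
  "('b, 'x) ring_scheme \<Rightarrow> ('c, 'y) ring_scheme \<Rightarrow> ('b \<Rightarrow> 'c) \<Rightarrow> ('b, 'm, 'z) module_scheme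
     \<Rightarrow> ('c, ('c \<times> 'm \<Rightarrow>\<^sub>0 int) set) module" where
  "base_change B C \<phi> M =
     (let G = free_Abelian_group (carrier C \<times> carrier M) Mod tensor_rel B C \<phi> M in
      \<lparr>carrier = carrier G,
       monoid.mult = undefined, one = undefined,
       zero = \<one>\<^bsub>G\<^esub>, add = (\<otimes>\<^bsub>G\<^esub>),
       smult = (\<lambda>a X. tensor_coset B C \<phi> M
                        (frag_extend (\<lambda>(c, m). frag_of (a \<otimes>\<^bsub>C\<^esub> c, m)) (SOME x. x \<in> X)))\<rparr>)"

text \<open>The additive map on a tensor product with \<open>c \<otimes> m \<mapsto> h (c, m)\<close>, meaningful when \<open>h\<close> is
  biadditive and balanced.\<close>

definition tensor_lift ::
  "('a, 'n, 'z) module_scheme \<Rightarrow> ('c \<times> 'm \<Rightarrow> 'n) \<Rightarrow> ('c \<times> 'm \<Rightarrow>\<^sub>0 int) set \<Rightarrow> 'n" where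
  "tensor_lift N h X =
     (let x = (SOME x. x \<in> X)
      in \<Oplus>\<^bsub>N\<^esub>p\<in>Poly_Mapping.keys x. [Poly_Mapping.lookup x p] \<cdot>\<^bsub>N\<^esub> h p)"

definition linear_maps ::
  "('b, 'x) ring_scheme \<Rightarrow> ('b, 'm, 'y) module_scheme \<Rightarrow> ('b, 'n, 'z) module_scheme
     \<Rightarrow> ('m \<Rightarrow> 'n) set" where
  "linear_maps B M N =
     {f \<in> carrier M \<rightarrow> carrier N.
        (\<forall>x\<in>carrier M. \<forall>y\<in>carrier M. f (x \<oplus>\<^bsub>M\<^esub> y) = f x \<oplus>\<^bsub>N\<^esub> f y) \<and>
        (\<forall>b\<in>carrier B. \<forall>x\<in>carrier M. f (b \<odot>\<^bsub>M\<^esub> x) = b \<odot>\<^bsub>N\<^esub> f x)}"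


section \<open>Locally free modules of finite type\<close>

text \<open>The fraction \<open>a / f\<^sup>i\<close> in \<open>B\<^sub>f\<close>, as an equivalence class of pairs \<open>(b, j)\<close>.\<close>

definition frac :: "('b, 'x) ring_scheme \<Rightarrow> 'b \<Rightarrow> 'b \<Rightarrow> nat \<Rightarrow> ('b \<times> nat) set" where
  "frac B f a i =
     {(b, j). b \<in> carrier B \<and>
        (\<exists>k::nat. f [^]\<^bsub>B\<^esub> k \<otimes>\<^bsub>B\<^esub> (f [^]\<^bsub>B\<^esub> j \<otimes>\<^bsub>B\<^esub> a) = f [^]\<^bsub>B\<^esub> k \<otimes>\<^bsub>B\<^esub> (f [^]\<^bsub>B\<^esub> i \<otimes>\<^bsub>B\<^esub> b))}"

definition localization :: "('b, 'x) ring_scheme \<Rightarrow> 'b \<Rightarrow> ('b \<times> nat) set ring" where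
  "localization B f =
     \<lparr>carrier = {frac B f a i | a i. a \<in> carrier B},
      monoid.mult = (\<lambda>X Y. \<Union>(a, i)\<in>X. \<Union>(b, j)\<in>Y. frac B f (a \<otimes>\<^bsub>B\<^esub> b) (i + j)),
      one = frac B f \<one>\<^bsub>B\<^esub> 0,
      zero = frac B f \<zero>\<^bsub>B\<^esub> 0,
      add = (\<lambda>X Y. \<Union>(a, i)\<in>X. \<Union>(b, j)\<in>Y.
               frac B f (f [^]\<^bsub>B\<^esub> j \<otimes>\<^bsub>B\<^esub> a \<oplus>\<^bsub>B\<^esub> f [^]\<^bsub>B\<^esub> i \<otimes>\<^bsub>B\<^esub> b) (i + j))\<rparr>"

definition free_finite_rank :: "('b, 'x) ring_scheme \<Rightarrow> ('b, 'm, 'y) module_scheme \<Rightarrow> bool" where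
  "free_finite_rank B M \<longleftrightarrow>
     (\<exists>(n::nat) e. e \<in> {..<n} \<rightarrow> carrier M \<and>
        bij_betw (\<lambda>c. \<Oplus>\<^bsub>M\<^esub>i\<in>{..<n}. c i \<odot>\<^bsub>M\<^esub> e i) ({..<n} \<rightarrow>\<^sub>E carrier B) (carrier M))"

text \<open>Zariski-locally free: \<open>Spec B\<close> is covered by the \<open>D(f)\<close>, \<open>f \<in> S\<close>, and each \<open>M\<^sub>f = B\<^sub>f \<otimes>\<^sub>B M\<close> is
  free of finite rank over \<open>B\<^sub>f\<close>.\<close>

definition locally_free_finite_type ::
  "('b, 'x) ring_scheme \<Rightarrow> ('b, 'm, 'y) module_scheme \<Rightarrow> bool" where
  "locally_free_finite_type B M \<longleftrightarrow> module B M \<and>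
     (\<exists>S. finite S \<and> S \<subseteq> carrier B \<and> Idl\<^bsub>B\<^esub> S = carrier B \<and>
        (\<forall>f\<in>S. free_finite_rank (localization B f)
                 (base_change B (localization B f) (\<lambda>b. frac B f b 0) M)))"


section \<open>Modules with a semilinear operator\<close>

text \<open>A left module over the twisted polynomial ring \<open>B{\<tau>}\<close>, \<open>\<tau> x = \<sigma>(x) \<tau>\<close>, is a \<open>B\<close>-module with a
  \<open>\<sigma>\<close>-semilinear endomorphism, stored in the field \<open>tau\<close>.\<close>

record ('a, 'b) tau_module = "('a, 'b) module" +
  tau :: "'b \<Rightarrow> 'b"

definition semilinear ::
  "('b, 'x) ring_scheme \<Rightarrow> ('b \<Rightarrow> 'b) \<Rightarrow> ('b, 'm, 'y) tau_module_scheme \<Rightarrow> bool" where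
  "semilinear B \<sigma> M \<longleftrightarrow> tau M \<in> carrier M \<rightarrow> carrier M \<and>
     (\<forall>x\<in>carrier M. \<forall>y\<in>carrier M. tau M (x \<oplus>\<^bsub>M\<^esub> y) = tau M x \<oplus>\<^bsub>M\<^esub> tau M y) \<and>
     (\<forall>b\<in>carrier B. \<forall>x\<in>carrier M. tau M (b \<odot>\<^bsub>M\<^esub> x) = \<sigma> b \<odot>\<^bsub>M\<^esub> tau M x)"

text \<open>The map \<open>\<sigma>\<^sup>*M = B \<otimes>\<^bsub>\<sigma>, B\<^esub> M \<rightarrow> M\<close>, \<open>b \<otimes> m \<mapsto> b \<tau>(m)\<close>.\<close>

definition linearization ::
  "('b, 'm, 'y) tau_module_scheme \<Rightarrow> ('b \<times> 'm \<Rightarrow>\<^sub>0 int) set \<Rightarrow> 'm" where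
  "linearization M = tensor_lift M (\<lambda>(b, m). b \<odot>\<^bsub>M\<^esub> tau M m)"

definition etale_tau_module ::
  "('b, 'x) ring_scheme \<Rightarrow> ('b \<Rightarrow> 'b) \<Rightarrow> ('b, 'm, 'y) tau_module_scheme \<Rightarrow> bool" where
  "etale_tau_module B \<sigma> M \<longleftrightarrow>
     locally_free_finite_type B M \<and> semilinear B \<sigma> M \<and>
     linearization M \<in> linear_maps B (base_change B B \<sigma> M) M \<and>
     bij_betw (linearization M) (carrier (base_change B B \<sigma> M)) (carrier M)"

text \<open>Morphisms are made extensional so that they are determined by their values on the carrier.\<close>

definition tau_hom ::
  "('b, 'x) ring_scheme \<Rightarrow> ('b, 'm, 'y) tau_module_scheme \<Rightarrow> ('b, 'n, 'z) tau_module_scheme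
     \<Rightarrow> ('m \<Rightarrow> 'n) set" where
  "tau_hom B M N =
     {f \<in> linear_maps B M N. f \<in> extensional (carrier M) \<and>
        (\<forall>x\<in>carrier M. f (tau M x) = tau N (f x))}"

definition tau_base_change ::
  "('b, 'x) ring_scheme \<Rightarrow> ('c, 'y) ring_scheme \<Rightarrow> ('b \<Rightarrow> 'c) \<Rightarrow> ('c \<Rightarrow> 'c)
     \<Rightarrow> ('b, 'm, 'z) tau_module_scheme \<Rightarrow> ('c, ('c \<times> 'm \<Rightarrow>\<^sub>0 int) set) tau_module" where
  "tau_base_change B C \<phi> \<sigma> M =
     module.extend (base_change B C \<phi> M)
       (tau_module.fields
          (tensor_lift (base_change B C \<phi> M)
             (\<lambda>(c, m). pure_tensor B C \<phi> M (\<sigma> c) (tau M m))))"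

text \<open>\<open>id \<otimes> f\<close>\<close>

definition base_change_map ::
  "('b, 'x) ring_scheme \<Rightarrow> ('c, 'y) ring_scheme \<Rightarrow> ('b \<Rightarrow> 'c)
     \<Rightarrow> ('b, 'm, 'z) module_scheme \<Rightarrow> ('b, 'n, 'w) module_scheme
     \<Rightarrow> ('m \<Rightarrow> 'n) \<Rightarrow> ('c \<times> 'm \<Rightarrow>\<^sub>0 int) set \<Rightarrow> ('c \<times> 'n \<Rightarrow>\<^sub>0 int) set" where
  "base_change_map B C \<phi> M N f =
     restrict
       (tensor_lift (base_change B C \<phi> N) (\<lambda>(c, m). pure_tensor B C \<phi> N c (f m)))
       (carrier (base_change B C \<phi> M))"


section \<open>Isocrystals and $\sigma$-bundles\<close>

definition isocrystal :: "nat \<Rightarrow> ('k::field \<Rightarrow> int) \<Rightarrow> ('k fls, 'm) tau_module \<Rightarrow> bool" where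
  "isocrystal q v M \<longleftrightarrow> etale_tau_module (laurent_ring v) (laurent_frob q) M"

definition lattice_in ::
  "('k::field \<Rightarrow> int) \<Rightarrow> ('k fls, 'm) tau_module \<Rightarrow> 'm set \<Rightarrow> bool" where
  "lattice_in v M T \<longleftrightarrow>
     submodule T (power_series_ring v) M \<and>
     locally_free_finite_type (power_series_ring v) (M\<lparr>carrier := T\<rparr>) \<and>
     {fls_X_intpow (- int n) \<odot>\<^bsub>M\<^esub> t | n t. t \<in> T} = carrier M"

definition power_series_span ::
  "('k::field \<Rightarrow> int) \<Rightarrow> ('k fls, 'm) tau_module \<Rightarrow> 'm set \<Rightarrow> 'm set" where
  "power_series_span v M X = \<Inter>{H. submodule H (power_series_ring v) M \<and> X \<subseteq> H}"

definition pure_isocrystal :: "nat \<Rightarrow> ('k::field \<Rightarrow> int) \<Rightarrow> ('k fls, 'm) tau_module \<Rightarrow> bool" where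
  "pure_isocrystal q v M \<longleftrightarrow> isocrystal q v M \<and>
     (\<exists>(s::int) (r::nat) T. r > 0 \<and> lattice_in v M T \<and>
        power_series_span v M ((tau M ^^ r) ` T) = (\<lambda>t. fls_X_intpow s \<odot>\<^bsub>M\<^esub> t) ` T)"

definition isocrystal_hom ::
  "('k::field \<Rightarrow> int) \<Rightarrow> ('k fls, 'm) tau_module \<Rightarrow> ('k fls, 'n) tau_module \<Rightarrow> ('m \<Rightarrow> 'n) set" where
  "isocrystal_hom v M N = tau_hom (laurent_ring v) M N"

definition sigma_bundle ::
  "nat \<Rightarrow> ('k::field \<Rightarrow> int) \<Rightarrow> (int \<Rightarrow> 'k, 'm) tau_module \<Rightarrow> bool" where
  "sigma_bundle q v E \<longleftrightarrow> etale_tau_module (disc_ring q v) (disc_frob q) E"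

definition sigma_bundle_hom ::
  "nat \<Rightarrow> ('k::field \<Rightarrow> int) \<Rightarrow> (int \<Rightarrow> 'k, 'm) tau_module \<Rightarrow> (int \<Rightarrow> 'k, 'n) tau_module
     \<Rightarrow> ('m \<Rightarrow> 'n) set" where
  "sigma_bundle_hom q v E E' = tau_hom (disc_ring q v) E E'"

text \<open>The functor \<open>M \<mapsto> \<C>\<^sub>K \<otimes> M\<close>, with \<open>\<tau>(c \<otimes> m) = \<sigma>(c) \<otimes> \<tau>(m)\<close>, on objects and on morphisms.\<close>

definition bundle_of ::
  "nat \<Rightarrow> ('k::field \<Rightarrow> int) \<Rightarrow> ('k fls, 'm) tau_module
     \<Rightarrow> (int \<Rightarrow> 'k, ((int \<Rightarrow> 'k) \<times> 'm \<Rightarrow>\<^sub>0 int) set) tau_module" where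
  "bundle_of q v M = tau_base_change (laurent_ring v) (disc_ring q v) fls_nth (disc_frob q) M"

definition bundle_map ::
  "nat \<Rightarrow> ('k::field \<Rightarrow> int) \<Rightarrow> ('k fls, 'm) tau_module \<Rightarrow> ('k fls, 'n) tau_module
     \<Rightarrow> ('m \<Rightarrow> 'n) \<Rightarrow> ((int \<Rightarrow> 'k) \<times> 'm \<Rightarrow>\<^sub>0 int) set \<Rightarrow> ((int \<Rightarrow> 'k) \<times> 'n \<Rightarrow>\<^sub>0 int) set" where
  "bundle_map q v M N f = base_change_map (laurent_ring v) (disc_ring q v) fls_nth M N f"

end

theory Submission
  imports Defs "HOL-Algebra.QuotRing" "HOL-Algebra.Sylow" "HOL-Algebra.Multiplicative_Group"
    "HOL-Computational_Algebra.Primes"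
begin

text \<open>
  Since \<open>R[[z]]\<close> is local, a lattice \<open>T\<close> in a pure isocrystal has a basis \<open>e\<close>, which is also a basis of \<open>M\<close> over
  \<open>R((z))\<close> and of \<open>\<C>\<^sub>K \<otimes> M\<close> over \<open>\<C>\<^sub>K\<close>.  Replacing the exponents by multiples, two pure
  isocrystals \<open>M\<close> and \<open>N\<close> have the same \<open>r\<close>, and slopes \<open>s\<^sub>M / r\<close> and \<open>s\<^sub>N / r\<close>.  Let \<open>X\<close> be the matrix of a
  morphism \<open>\<C>\<^sub>K \<otimes> M \<rightarrow> \<C>\<^sub>K \<otimes> N\<close> and let \<open>P n a\<close> say that the coefficients of the entries of \<open>X\<close> at
  \<open>z\<^sup>j\<close>, \<open>j \<le> n\<close>, have valuation at least \<open>a\<close>.  Compatibility with \<open>\<tau>\<^sup>r\<close> reads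
  \<open>X = z\<^sup>s U \<sigma>\<^sup>r(X) V\<close> with \<open>s = s\<^sub>N - s\<^sub>M\<close> and \<open>U\<close>, \<open>V\<close> invertible over \<open>R[[z]]\<close>, so with \<open>Q = q\<^sup>r\<close> the
  statements \<open>P n a\<close> and \<open>P (n + s) (Q a)\<close> are equivalent.  As valuations are integers and the
  coefficients of \<open>X\<close> tend to \<open>0\<close> at \<open>-\<infinity>\<close>, this forces \<open>X\<close> to have entries in \<open>R((z))\<close> (and
  \<open>X = 0\<close> if \<open>s \<noteq> 0\<close>).
\<close>


section \<open>Base change of modules\<close>

text \<open>Bounds are imposed on whole initial segments \<open>j <= n\<close> because
  multiplication by a series in R[[z]] mixes the coefficient at z^j only with lower ones: such
  bounds survive multiplication by U, V and their inverses, whereas bounds on single coefficients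
  would not. In one direction the bound is multiplied by Q, in the other it is divided by Q and
  rounded up. The rounding is what discreteness buys: an integer w with Q w >= 1 is again >= 1, so a
  positive bound is never lost. This decides the case s < 0, where over a densely valued field the
  bound would shrink to 0 and nonzero morphisms can occur. Membership in R((z)) is a real condition
  on both sides, as coefficients of elements of C_K may grow in norm at +infinity and need not
  vanish far to the left. U and V never occur as matrices: what is used are the inclusions of tau^r
  T in z^s T and of z^s T in the span of tau^r T, the latter by testing against
  R[[z]]-submodules.\<close>

lemma keys_diff_subset:
  "\<lbrakk>Poly_Mapping.keys a \<subseteq> S; Poly_Mapping.keys b \<subseteq> S\<rbrakk> \<Longrightarrow> Poly_Mapping.keys (a - b :: 'a \<Rightarrow>\<^sub>0 int) \<subseteq> S"
  using keys_diff[of a b] by blast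

section \<open>The tensor product by generators and relations\<close>

locale tensor_base = B: cring B + C: cring C + M: module B M
  for B :: "('b, 'x) ring_scheme" and C :: "('c, 'y) ring_scheme" and \<phi> :: "'b \<Rightarrow> 'c"
    and M :: "('b, 'm, 'z) module_scheme" +
  assumes phi: "\<phi> \<in> ring_hom B C"
begin

abbreviation G where "G \<equiv> free_Abelian_group (carrier C \<times> carrier M)"
abbreviation rel where "rel \<equiv> tensor_rel B C \<phi> M"
abbreviation tc where "tc \<equiv> tensor_coset B C \<phi> M"
abbreviation T where "T \<equiv> base_change B C \<phi> M"
abbreviation pt where "pt c m \<equiv> pure_tensor B C \<phi> M c m"

lemma phi_closed [simp]: "b \<in> carrier B \<Longrightarrow> \<phi> b \<in> carrier C"
  using phi by (rule ring_hom_closed)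

text \<open>The generating set inside \<open>tensor_rel\<close>, named so that induction over the
  relations can refer to it.\<close>

definition gens where "gens =
     {frag_of (c \<oplus>\<^bsub>C\<^esub> c', m) - frag_of (c, m) - frag_of (c', m) | c c' m.
         c \<in> carrier C \<and> c' \<in> carrier C \<and> m \<in> carrier M} \<union>
      {frag_of (c, m \<oplus>\<^bsub>M\<^esub> m') - frag_of (c, m) - frag_of (c, m') | c m m'.
         c \<in> carrier C \<and> m \<in> carrier M \<and> m' \<in> carrier M} \<union>
      {frag_of (c \<otimes>\<^bsub>C\<^esub> \<phi> b, m) - frag_of (c, b \<odot>\<^bsub>M\<^esub> m) | c b m.
         c \<in> carrier C \<and> b \<in> carrier B \<and> m \<in> carrier M}"

lemma rel_gens: "rel = generate G gens"
  unfolding tensor_rel_def gens_def ..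

sublocale G: comm_group G
  by (rule abelian_free_Abelian_group)

lemma gens_subset: "gens \<subseteq> carrier G"
  unfolding gens_def
  by (intro subsetI, elim UnE CollectE exE conjE; hypsubst; unfold carrier_free_Abelian_group_iff; intro keys_diff_subset; simp)

lemma rel_subgroup: "subgroup rel G"
  unfolding rel_gens by (rule G.generate_is_subgroup) (rule gens_subset)

lemma gens_rel: "x \<in> gens \<Longrightarrow> x \<in> rel"
  unfolding rel_gens by (rule generate.incl)

lemma rel_diff: "x \<in> rel \<Longrightarrow> y \<in> rel \<Longrightarrow> x - y \<in> rel"
  using subgroup.m_closed[OF rel_subgroup, of x "- y"] subgroup.m_inv_closed[OF rel_subgroup, of y]
     subgroup.mem_carrier[OF rel_subgroup, of y] by simp

lemma rel_normal: "rel \<lhd> G"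
  using G.normal_iff_subgroup rel_subgroup by blast

lemma tc_eq_iff:
  assumes "x \<in> carrier G" "y \<in> carrier G"
  shows "tc x = tc y \<longleftrightarrow> x - y \<in> rel"
proof -
  have "tc x = tc y \<longleftrightarrow> x \<in> rel #>\<^bsub>G\<^esub> y"
  proof
    assume "tc x = tc y"
    then show "x \<in> rel #>\<^bsub>G\<^esub> y"
      using G.rcos_self[OF assms(1) rel_subgroup] by (simp only: tensor_coset_def)
  next
    assume "x \<in> rel #>\<^bsub>G\<^esub> y"
    from G.repr_independence[OF this assms(2) rel_subgroup]
    show "tc x = tc y" by (simp only: tensor_coset_def)
  qed
  also have "\<dots> \<longleftrightarrow> x - y \<in> rel"
    by (auto simp: r_coset_def intro!: bexI[of _ "x - y"])
  finally show ?thesis .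
qed

lemma carrier_T: "carrier T = tc ` carrier G"
  by (simp add: base_change_def carrier_FactGroup tensor_coset_def[abs_def] Let_def)

lemma zero_T: "\<zero>\<^bsub>T\<^esub> = tc 0"
  using G.coset_mult_one[OF subgroup.subset[OF rel_subgroup]]
  by (simp add: base_change_def Let_def tensor_coset_def)

lemma add_T: "x \<in> carrier G \<Longrightarrow> y \<in> carrier G \<Longrightarrow> tc x \<oplus>\<^bsub>T\<^esub> tc y = tc (x + y)"
  using normal.rcos_sum[OF rel_normal, of x y]
  by (simp add: base_change_def Let_def tensor_coset_def)

lemma tc_closed: "x \<in> carrier G \<Longrightarrow> tc x \<in> carrier T"
  by (simp add: carrier_T)

text \<open>Both the scalar action of \<open>base_change\<close> and \<open>tensor_lift\<close>
  evaluate a representative picked by \<open>SOME\<close>. Their properties rest on this fact, which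
  confines the choice to an error in \<open>rel\<close>.\<close>

lemma some_representative:
  assumes "x \<in> carrier G"
  shows "(SOME y. y \<in> tc x) \<in> carrier G \<and> (SOME y. y \<in> tc x) - x \<in> rel"
proof (rule someI2)
  show "x \<in> tc x"
    unfolding tensor_coset_def by (rule G.rcos_self[OF assms rel_subgroup])
next
  fix y assume "y \<in> tc x"
  then obtain h where h: "h \<in> rel" "y = h \<otimes>\<^bsub>G\<^esub> x"
    unfolding tensor_coset_def r_coset_def by blast
  have "h \<in> carrier G" using h(1) subgroup.mem_carrier[OF rel_subgroup] by blast
  then have "y \<in> carrier G" unfolding h(2) by (rule G.m_closed[OF _ assms])
  moreover have "y - x = h" unfolding h(2) by simp
  ultimately show "y \<in> carrier G \<and> y - x \<in> rel" using h(1) by blast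
qed

text \<open>Closure under differences is the only step case, because \<open>0 - h\<close> yields
  inverses and \<open>h1 - (0 - h2)\<close> yields sums; additive maps satisfy it at once.\<close>

lemma rel_induct [consumes 1, case_names zero gen diff]:
  assumes "x \<in> rel" "P 0" "\<And>x. x \<in> gens \<Longrightarrow> P x"
    "\<And>x y. x \<in> rel \<Longrightarrow> y \<in> rel \<Longrightarrow> P x \<Longrightarrow> P y \<Longrightarrow> P (x - y)"
  shows "P x"
proof -
  have z: "0 \<in> rel" using subgroup.one_closed[OF rel_subgroup] by simp
  have "x \<in> generate G gens \<and> P x" using assms(1) unfolding rel_gens
  proof (induction rule: generate.induct)
    case one
    show ?case using z assms(2) by (simp add: rel_gens)
  next
    case (incl h)
    then show ?case using assms(3) gens_rel rel_gens by blast
  next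
    case (inv h)
    then have k: "Poly_Mapping.keys h \<subseteq> carrier C \<times> carrier M"
      using subsetD[OF gens_subset] by simp
    have "0 - h \<in> rel" "P (0 - h)" using inv z assms(2,3) by (blast intro: rel_diff gens_rel assms(4))+
    then show ?case using k by (simp add: rel_gens)
  next
    case (eng h1 h2)
    then have h: "h1 \<in> rel" "h2 \<in> rel" "P h1" "P h2" by (simp_all add: rel_gens)
    have "h1 - (0 - h2) \<in> rel" "P (h1 - (0 - h2))"
      by (intro rel_diff assms(4) h z assms(2))+
    then show ?case by (simp add: rel_gens)
  qed
  then show ?thesis ..
qed

definition act where "act a = frag_extend (\<lambda>(c, m). frag_of (a \<otimes>\<^bsub>C\<^esub> c, m :: 'm))"

lemma act_simps [simp]:
  "act a 0 = 0" "act a (x - y) = act a x - act a y" "act a (x + y) = act a x + act a y"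
  "act a (frag_of (c, m)) = frag_of (a \<otimes>\<^bsub>C\<^esub> c, m)"
  by (simp_all add: act_def frag_extend_diff frag_extend_add)

lemma act_closed:
  assumes "a \<in> carrier C" "x \<in> carrier G"
  shows "act a x \<in> carrier G"
proof -
  have "Poly_Mapping.keys x \<subseteq> carrier C \<times> carrier M" using assms by simp
  then have "Poly_Mapping.keys (act a x) \<subseteq> carrier C \<times> carrier M"
  proof (rule free_Abelian_group_induct)
    fix p assume "p \<in> carrier C \<times> carrier M"
    then show "Poly_Mapping.keys (act a (frag_of p)) \<subseteq> carrier C \<times> carrier M"
      using assms(1) by (cases p) simp
  qed (simp_all add: keys_diff_subset)
  then show ?thesis by simp
qed

text \<open>Multiplying the first slot by \<open>a\<close> takes each of the three kinds of
  generators to one of the same kind; hence the action descends to cosets.\<close>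

lemma act_rel:
  assumes "a \<in> carrier C" "x \<in> rel"
  shows "act a x \<in> rel"
  using assms(2)
proof (induction rule: rel_induct)
  case zero
  show ?case using subgroup.one_closed[OF rel_subgroup] by simp
next
  case (gen x)
  then consider c c' m where "x = frag_of (c \<oplus>\<^bsub>C\<^esub> c', m) - frag_of (c, m) - frag_of (c', m)"
      "c \<in> carrier C" "c' \<in> carrier C" "m \<in> carrier M"
    | c m m' where "x = frag_of (c, m \<oplus>\<^bsub>M\<^esub> m') - frag_of (c, m) - frag_of (c, m')"
      "c \<in> carrier C" "m \<in> carrier M" "m' \<in> carrier M"
    | c b m where "x = frag_of (c \<otimes>\<^bsub>C\<^esub> \<phi> b, m) - frag_of (c, b \<odot>\<^bsub>M\<^esub> m)"
      "c \<in> carrier C" "b \<in> carrier B" "m \<in> carrier M"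
    unfolding gens_def by blast
  then have "act a x \<in> gens"
  proof cases
    case (1 c c' m)
    then have "act a x = frag_of ((a \<otimes>\<^bsub>C\<^esub> c) \<oplus>\<^bsub>C\<^esub> (a \<otimes>\<^bsub>C\<^esub> c'), m)
        - frag_of (a \<otimes>\<^bsub>C\<^esub> c, m) - frag_of (a \<otimes>\<^bsub>C\<^esub> c', m)"
      using assms(1) by (simp add: C.r_distr)
    then show ?thesis unfolding gens_def using assms(1) 1 C.m_closed by blast
  next
    case (2 c m m')
    then have "act a x = frag_of (a \<otimes>\<^bsub>C\<^esub> c, m \<oplus>\<^bsub>M\<^esub> m') - frag_of (a \<otimes>\<^bsub>C\<^esub> c, m) - frag_of (a \<otimes>\<^bsub>C\<^esub> c, m')"
      by simp
    then show ?thesis unfolding gens_def using assms(1) 2 C.m_closed by blast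
  next
    case (3 c b m)
    then have "act a x = frag_of ((a \<otimes>\<^bsub>C\<^esub> c) \<otimes>\<^bsub>C\<^esub> \<phi> b, m) - frag_of (a \<otimes>\<^bsub>C\<^esub> c, b \<odot>\<^bsub>M\<^esub> m)"
      using assms(1) by (simp add: C.m_assoc)
    then show ?thesis unfolding gens_def using assms(1) 3 C.m_closed by blast
  qed
  then show ?case by (rule gens_rel)
qed (simp add: rel_diff)

lemma smult_T:
  assumes "a \<in> carrier C" "x \<in> carrier G"
  shows "a \<odot>\<^bsub>T\<^esub> tc x = tc (act a x)"
proof -
  have "a \<odot>\<^bsub>T\<^esub> tc x = tc (act a (SOME y. y \<in> tc x))"
    by (simp add: base_change_def Let_def act_def)
  also have "\<dots> = tc (act a x)"
    using some_representative[OF assms(2)] act_rel[OF assms(1)] act_closed[OF assms(1)] assms(2)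
    by (metis act_simps(2) tc_eq_iff)
  finally show ?thesis .
qed

lemma pt_closed [simp, intro]: "c \<in> carrier C \<Longrightarrow> m \<in> carrier M \<Longrightarrow> pt c m \<in> carrier T"
  by (intro tc_closed) simp

lemma pt_smult [simp]:
  "\<lbrakk>a \<in> carrier C; c \<in> carrier C; m \<in> carrier M\<rbrakk> \<Longrightarrow> a \<odot>\<^bsub>T\<^esub> pt c m = pt (a \<otimes>\<^bsub>C\<^esub> c) m"
  by (subst smult_T) auto

lemma pt_add_left:
  assumes "c \<in> carrier C" "c' \<in> carrier C" "m \<in> carrier M"
  shows "pt (c \<oplus>\<^bsub>C\<^esub> c') m = pt c m \<oplus>\<^bsub>T\<^esub> pt c' m"
proof -
  have "frag_of (c \<oplus>\<^bsub>C\<^esub> c', m) - (frag_of (c, m) + frag_of (c', m)) \<in> rel"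
    unfolding diff_diff_eq[symmetric] by (rule gens_rel) (use assms in \<open>unfold gens_def, blast\<close>)
  moreover have "x + y \<in> carrier G" if "x \<in> carrier G" "y \<in> carrier G" for x y
    using G.m_closed[OF that] by simp
  ultimately show ?thesis using assms
    by (subst add_T) (simp_all add: tc_eq_iff del: carrier_free_Abelian_group_iff)
qed

lemma pt_add_right:
  assumes "c \<in> carrier C" "m' \<in> carrier M" "m \<in> carrier M"
  shows "pt c (m \<oplus>\<^bsub>M\<^esub> m') = pt c m \<oplus>\<^bsub>T\<^esub> pt c m'"
proof -
  have "frag_of (c, m \<oplus>\<^bsub>M\<^esub> m') - (frag_of (c, m) + frag_of (c, m')) \<in> rel"
    unfolding diff_diff_eq[symmetric] by (rule gens_rel) (use assms in \<open>unfold gens_def, blast\<close>)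
  moreover have "x + y \<in> carrier G" if "x \<in> carrier G" "y \<in> carrier G" for x y
    using G.m_closed[OF that] by simp
  ultimately show ?thesis using assms
    by (subst add_T) (simp_all add: tc_eq_iff del: carrier_free_Abelian_group_iff)
qed

lemma pt_balanced:
  assumes "c \<in> carrier C" "b \<in> carrier B" "m \<in> carrier M"
  shows "pt c (b \<odot>\<^bsub>M\<^esub> m) = pt (c \<otimes>\<^bsub>C\<^esub> \<phi> b) m"
proof -
  have "frag_of (c \<otimes>\<^bsub>C\<^esub> \<phi> b, m) - frag_of (c, b \<odot>\<^bsub>M\<^esub> m) \<in> rel"
    by (rule gens_rel) (use assms in \<open>unfold gens_def, blast\<close>)
  then have "pt (c \<otimes>\<^bsub>C\<^esub> \<phi> b) m = pt c (b \<odot>\<^bsub>M\<^esub> m)"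
    using assms by (subst tc_eq_iff) simp_all
  then show ?thesis ..
qed

lemma G_add: "x \<in> carrier G \<Longrightarrow> y \<in> carrier G \<Longrightarrow> x + y \<in> carrier G"
  using G.m_closed[of x y] by simp

lemma G_minus: "x \<in> carrier G \<Longrightarrow> - x \<in> carrier G"
  by simp

lemma G_zero: "0 \<in> carrier G"
  by simp

sublocale T: abelian_group T
proof (rule abelian_groupI, unfold carrier_T zero_T)
  note [simp del] = carrier_free_Abelian_group_iff
  fix X assume "X \<in> tc ` carrier G"
  then obtain x where x: "x \<in> carrier G" "X = tc x" by blast
  have "tc (- x) \<oplus>\<^bsub>T\<^esub> X = tc 0" using x by (simp add: add_T G_minus)
  then show "\<exists>Y\<in>tc ` carrier G. Y \<oplus>\<^bsub>T\<^esub> X = tc 0" using x G_minus by blast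
qed (auto simp: add_T G_add G_zero add_ac simp del: carrier_free_Abelian_group_iff)

sublocale T: module C T
proof (rule moduleI, fact C.is_cring, rule T.abelian_group_axioms, unfold carrier_T)
  note [simp del] = carrier_free_Abelian_group_iff
  note [simp] = act_closed G_add
  fix a X assume a: "a \<in> carrier C" and "X \<in> tc ` carrier G"
  then obtain x where x: "x \<in> carrier G" and X: "X = tc x" by blast
  then show "a \<odot>\<^bsub>T\<^esub> X \<in> tc ` carrier G" using a by (simp add: smult_T)
  { fix Y assume "Y \<in> tc ` carrier G"
    then obtain y where "y \<in> carrier G" "Y = tc y" by blast
    then show "a \<odot>\<^bsub>T\<^esub> (X \<oplus>\<^bsub>T\<^esub> Y) = a \<odot>\<^bsub>T\<^esub> X \<oplus>\<^bsub>T\<^esub> a \<odot>\<^bsub>T\<^esub> Y"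
      using a x X by (simp add: smult_T add_T) }
  fix b assume b: "b \<in> carrier C"
  have ab: "a \<otimes>\<^bsub>C\<^esub> b \<in> carrier C" "a \<oplus>\<^bsub>C\<^esub> b \<in> carrier C" using a b by auto
  have "Poly_Mapping.keys x \<subseteq> carrier C \<times> carrier M"
    using x by (simp add: carrier_free_Abelian_group_iff)
  then have *: "act (a \<otimes>\<^bsub>C\<^esub> b) x = act a (act b x)"
  proof (rule free_Abelian_group_induct)
    fix p assume "p \<in> carrier C \<times> carrier M"
    then show "act (a \<otimes>\<^bsub>C\<^esub> b) (frag_of p) = act a (act b (frag_of p))"
      using a b by (cases p) (simp add: C.m_assoc)
  qed simp_all
  then show "(a \<otimes>\<^bsub>C\<^esub> b) \<odot>\<^bsub>T\<^esub> X = a \<odot>\<^bsub>T\<^esub> (b \<odot>\<^bsub>T\<^esub> X)"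
    using a b ab x X by (simp add: smult_T)
  have "Poly_Mapping.keys x \<subseteq> carrier C \<times> carrier M"
    using x by (simp add: carrier_free_Abelian_group_iff)
  \<comment> \<open>Additivity in the scalar holds only modulo \<open>rel\<close>, unlike
    associativity above, which is an equality in the free group.\<close>
  then have "act (a \<oplus>\<^bsub>C\<^esub> b) x - (act a x + act b x) \<in> rel"
  proof (rule free_Abelian_group_induct)
    fix p assume "p \<in> carrier C \<times> carrier M"
    then obtain c m where p: "p = (c, m)" "c \<in> carrier C" "m \<in> carrier M" by blast
    have "frag_of ((a \<otimes>\<^bsub>C\<^esub> c) \<oplus>\<^bsub>C\<^esub> (b \<otimes>\<^bsub>C\<^esub> c), m) - frag_of (a \<otimes>\<^bsub>C\<^esub> c, m) - frag_of (b \<otimes>\<^bsub>C\<^esub> c, m) \<in> gens"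
      unfolding gens_def using a b p C.m_closed by blast
    then show "act (a \<oplus>\<^bsub>C\<^esub> b) (frag_of p) - (act a (frag_of p) + act b (frag_of p)) \<in> rel"
      using a b p by (simp add: C.l_distr gens_rel diff_diff_eq)
  next
    fix y z assume "act (a \<oplus>\<^bsub>C\<^esub> b) y - (act a y + act b y) \<in> rel" "act (a \<oplus>\<^bsub>C\<^esub> b) z - (act a z + act b z) \<in> rel"
    from rel_diff[OF this] show "act (a \<oplus>\<^bsub>C\<^esub> b) (y - z) - (act a (y - z) + act b (y - z)) \<in> rel"
      by (simp add: algebra_simps)
  qed (use subgroup.one_closed[OF rel_subgroup] in simp)
  then show "(a \<oplus>\<^bsub>C\<^esub> b) \<odot>\<^bsub>T\<^esub> X = a \<odot>\<^bsub>T\<^esub> X \<oplus>\<^bsub>T\<^esub> b \<odot>\<^bsub>T\<^esub> X"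
    using a b ab x X by (simp add: smult_T add_T tc_eq_iff)
next
  fix X assume "X \<in> tc ` carrier G"
  then obtain x where x: "x \<in> carrier G" and X: "X = tc x" by blast
  then have "Poly_Mapping.keys x \<subseteq> carrier C \<times> carrier M" by simp
  then have "act \<one>\<^bsub>C\<^esub> x = x"
  proof (rule free_Abelian_group_induct)
    fix p assume "p \<in> carrier C \<times> carrier M"
    then show "act \<one>\<^bsub>C\<^esub> (frag_of p) = frag_of p" by (cases p) simp
  qed simp_all
  then show "\<one>\<^bsub>C\<^esub> \<odot>\<^bsub>T\<^esub> X = X" using x X by (simp add: smult_T del: carrier_free_Abelian_group_iff)
qed

text \<open>A sign moves into the first factor, so negatives of pure tensors are pure tensors and
  sums suffice. The proof treats a representative together with its negative, since induction on the
  free abelian group runs over differences.\<close>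

lemma T_induct [consumes 1, case_names pure add]:
  assumes "X \<in> carrier T"
    and pure: "\<And>c m. c \<in> carrier C \<Longrightarrow> m \<in> carrier M \<Longrightarrow> P (pt c m)"
    and add: "\<And>X Y. X \<in> carrier T \<Longrightarrow> Y \<in> carrier T \<Longrightarrow> P X \<Longrightarrow> P Y \<Longrightarrow> P (X \<oplus>\<^bsub>T\<^esub> Y)"
  shows "P X"
proof -
  note [simp del] = carrier_free_Abelian_group_iff
  obtain x where x: "x \<in> carrier G" "X = tc x" using assms(1) carrier_T by blast
  have neg: "tc (- y) = (\<ominus>\<^bsub>C\<^esub> \<one>\<^bsub>C\<^esub>) \<odot>\<^bsub>T\<^esub> tc y" if "y \<in> carrier G" for y
  proof -
    have "tc y \<oplus>\<^bsub>T\<^esub> tc (- y) = \<zero>\<^bsub>T\<^esub>" using that by (simp add: add_T zero_T G_minus)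
    then have "tc (- y) = \<ominus>\<^bsub>T\<^esub> tc y"
      using T.minus_equality[of "tc (- y)" "tc y"] that by (simp add: T.a_comm tc_closed G_minus)
    also have "\<dots> = (\<ominus>\<^bsub>C\<^esub> \<one>\<^bsub>C\<^esub>) \<odot>\<^bsub>T\<^esub> tc y" using that by (simp add: T.smult_l_minus tc_closed)
    finally show ?thesis .
  qed
  have "Poly_Mapping.keys x \<subseteq> carrier C \<times> carrier M"
    using x(1) by (simp add: carrier_free_Abelian_group_iff)
  then have "x \<in> carrier G \<and> P (tc x) \<and> P (tc (- x))"
  proof (rule free_Abelian_group_induct)
    have "P (pt \<zero>\<^bsub>C\<^esub> \<zero>\<^bsub>M\<^esub>)" by (rule pure) auto
    moreover have "pt \<zero>\<^bsub>C\<^esub> \<zero>\<^bsub>M\<^esub> = \<zero>\<^bsub>T\<^esub>"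
      using pt_smult[of "\<zero>\<^bsub>C\<^esub>" "\<zero>\<^bsub>C\<^esub>" "\<zero>\<^bsub>M\<^esub>"] T.smult_l_null[OF pt_closed[of "\<zero>\<^bsub>C\<^esub>" "\<zero>\<^bsub>M\<^esub>"]] by simp
    ultimately show "0 \<in> carrier G \<and> P (tc 0) \<and> P (tc (- 0))" by (simp add: zero_T G_zero)
  next
    fix y z assume "y \<in> carrier G \<and> P (tc y) \<and> P (tc (- y))" "z \<in> carrier G \<and> P (tc z) \<and> P (tc (- z))"
    then show "y - z \<in> carrier G \<and> P (tc (y - z)) \<and> P (tc (- (y - z)))"
      using add[of "tc y" "tc (- z)"] add[of "tc (- y)" "tc z"] G_add[of y "- z"]
      by (simp add: add_T tc_closed G_minus)
  next
    fix p assume "p \<in> carrier C \<times> carrier M"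
    then obtain c m where p: "p = (c, m)" "c \<in> carrier C" "m \<in> carrier M" by blast
    then show "frag_of p \<in> carrier G \<and> P (tc (frag_of p)) \<and> P (tc (- frag_of p))"
      using neg[of "frag_of p"] pure[of c m] pure[of "(\<ominus>\<^bsub>C\<^esub> \<one>\<^bsub>C\<^esub>) \<otimes>\<^bsub>C\<^esub> c" m] by (simp add: carrier_free_Abelian_group_iff)
  qed
  then show ?thesis using x(2) by simp
qed

end

section \<open>The universal property of the tensor product\<close>

locale tensor_universal = tensor_base B C \<phi> M + N: abelian_group N
  for B :: "('b, 'x) ring_scheme" and C :: "('c, 'y) ring_scheme" and \<phi> :: "'b \<Rightarrow> 'c"
    and M :: "('b, 'm, 'z) module_scheme" and N :: "('a, 'n, 'w) module_scheme" +
  fixes h :: "'c \<times> 'm \<Rightarrow> 'n"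
  assumes h_closed: "\<And>c m. c \<in> carrier C \<Longrightarrow> m \<in> carrier M \<Longrightarrow> h (c, m) \<in> carrier N"
    and h_add_left: "\<And>c c' m. c \<in> carrier C \<Longrightarrow> c' \<in> carrier C \<Longrightarrow> m \<in> carrier M
          \<Longrightarrow> h (c \<oplus>\<^bsub>C\<^esub> c', m) = h (c, m) \<oplus>\<^bsub>N\<^esub> h (c', m)"
    and h_add_right: "\<And>c m m'. c \<in> carrier C \<Longrightarrow> m \<in> carrier M \<Longrightarrow> m' \<in> carrier M
          \<Longrightarrow> h (c, m \<oplus>\<^bsub>M\<^esub> m') = h (c, m) \<oplus>\<^bsub>N\<^esub> h (c, m')"
    and h_balanced: "\<And>c b m. c \<in> carrier C \<Longrightarrow> b \<in> carrier B \<Longrightarrow> m \<in> carrier M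
          \<Longrightarrow> h (c \<otimes>\<^bsub>C\<^esub> \<phi> b, m) = h (c, b \<odot>\<^bsub>M\<^esub> m)"
begin

definition ev :: "('c \<times> 'm \<Rightarrow>\<^sub>0 int) \<Rightarrow> 'n" where
  "ev x = (\<Oplus>\<^bsub>N\<^esub>p\<in>Poly_Mapping.keys x. [Poly_Mapping.lookup x p] \<cdot>\<^bsub>N\<^esub> h p)"

text \<open>The explicit formula is compared with the homomorphism given by the universal property
  of the free abelian group: both agree on the expansion of an element into generators. This avoids
  proving additivity of a sum over varying supports.\<close>

lemma ev_hom: "ev \<in> hom G (add_monoid N)" and ev_frag_of: "p \<in> carrier C \<times> carrier M \<Longrightarrow> ev (frag_of p) = h p"
proof -
  interpret A: comm_group "add_monoid N" by (rule N.a_comm_group)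
  obtain g where g: "g \<in> hom G (add_monoid N)" and gf: "\<And>p. p \<in> carrier C \<times> carrier M \<Longrightarrow> g (frag_of p) = h p"
  proof (rule comm_group.free_Abelian_group_universal[OF N.a_comm_group, of h "carrier C \<times> carrier M"])
    show "h ` (carrier C \<times> carrier M) \<subseteq> carrier (add_monoid N)" using h_closed by auto
  qed blast
  interpret g: group_hom G "add_monoid N" g
    using g by unfold_locales
  have sum: "finite I \<Longrightarrow> u \<in> I \<rightarrow> carrier G \<Longrightarrow> sum u I \<in> carrier G \<and> g (sum u I) = (\<Oplus>\<^bsub>N\<^esub>i\<in>I. g (u i))" for u I
  proof (induction I rule: finite_induct)
    case empty
    then show ?case using g.hom_one by (simp add: G_zero)
  next
    case (insert i I)
    then have u: "u i \<in> carrier G" "sum u I \<in> carrier G" "g (sum u I) = (\<Oplus>\<^bsub>N\<^esub>i\<in>I. g (u i))" by auto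
    have gu: "(\<lambda>i. g (u i)) \<in> I \<rightarrow> carrier N" "g (u i) \<in> carrier N"
      using insert.prems g.hom_closed by (auto simp: Pi_iff simp del: carrier_free_Abelian_group_iff)
    have "g (u i + sum u I) = g (u i) \<oplus>\<^bsub>N\<^esub> g (sum u I)"
      using g.hom_mult[OF u(1,2)] by simp
    then show ?case using insert.hyps u gu G_add[OF u(1,2)] by (simp del: carrier_free_Abelian_group_iff)
  qed
  have "ev x = g x" if x: "x \<in> carrier G" for x
  proof -
    have k: "Poly_Mapping.keys x \<subseteq> carrier C \<times> carrier M" using x by simp
    have "x = (\<Sum>p\<in>Poly_Mapping.keys x. frag_cmul (Poly_Mapping.lookup x p) (frag_of p))"
      using frag_expansion[of x] by (simp add: frag_extend_def)
    then have "g x = (\<Oplus>\<^bsub>N\<^esub>p\<in>Poly_Mapping.keys x. g (frag_cmul (Poly_Mapping.lookup x p) (frag_of p)))"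
      using sum[of "Poly_Mapping.keys x" "\<lambda>p. frag_cmul (Poly_Mapping.lookup x p) (frag_of p)"] k
        keys_cmul by fastforce
    also have "\<dots> = ev x"
      unfolding ev_def
    proof (rule N.finsum_cong')
      show "(\<lambda>p. [Poly_Mapping.lookup x p] \<cdot>\<^bsub>N\<^esub> h p) \<in> Poly_Mapping.keys x \<rightarrow> carrier N"
        using k h_closed by (auto intro!: N.add.int_pow_closed)
      fix p assume "p \<in> Poly_Mapping.keys x"
      then have p: "p \<in> carrier C \<times> carrier M" using k by blast
      then have f: "frag_of p \<in> carrier G" by simp
      have "g (frag_of p [^]\<^bsub>G\<^esub> Poly_Mapping.lookup x p) = g (frag_of p) [^]\<^bsub>add_monoid N\<^esub> Poly_Mapping.lookup x p"
        by (rule g.hom_int_pow[OF f])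
      then show "g (frag_cmul (Poly_Mapping.lookup x p) (frag_of p)) = [Poly_Mapping.lookup x p] \<cdot>\<^bsub>N\<^esub> h p"
        using p gf[OF p] by (simp add: add_pow_def)
    qed simp
    finally show ?thesis ..
  qed
  then have *: "x \<in> carrier G \<Longrightarrow> ev x = g x" for x .
  show "ev \<in> hom G (add_monoid N)"
    using g unfolding hom_def by (auto simp: * G_add Pi_iff simp del: carrier_free_Abelian_group_iff)
  show "p \<in> carrier C \<times> carrier M \<Longrightarrow> ev (frag_of p) = h p"
    by (subst *) (auto simp: gf)
qed

lemma ev_add: "x \<in> carrier G \<Longrightarrow> y \<in> carrier G \<Longrightarrow> ev (x + y) = ev x \<oplus>\<^bsub>N\<^esub> ev y"
  using hom_mult[OF ev_hom, of x y] by simp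

lemma ev_closed: "x \<in> carrier G \<Longrightarrow> ev x \<in> carrier N"
  using hom_in_carrier[OF ev_hom, of x] by simp

lemma ev_diff_eq:
  assumes "x \<in> carrier G" "y \<in> carrier G"
  shows "ev (x - y) = \<zero>\<^bsub>N\<^esub> \<longleftrightarrow> ev x = ev y"
proof -
  have c: "x - y \<in> carrier G" using G_add[OF assms(1) G_minus[OF assms(2)]] by simp
  have "ev x = ev (x - y) \<oplus>\<^bsub>N\<^esub> ev y"
    using ev_add[OF c assms(2)] by simp
  then show ?thesis using ev_closed[OF c] ev_closed[OF assms(2)] ev_closed[OF assms(1)]
    by (metis N.l_zero N.add.right_cancel N.zero_closed)
qed

text \<open>Each of the hypotheses \<open>h_add_left\<close>, \<open>h_add_right\<close> and
  \<open>h_balanced\<close> kills one kind of generator.\<close>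

lemma ev_rel:
  assumes "x \<in> rel" shows "ev x = \<zero>\<^bsub>N\<^esub>"
  using assms
proof (induction rule: rel_induct)
  case zero
  show ?case by (simp add: ev_def)
next
  case (diff x y)
  then show ?case using ev_diff_eq[of x y] subgroup.mem_carrier[OF rel_subgroup] by metis
next
  case (gen x)
  then consider c c' m where "x = frag_of (c \<oplus>\<^bsub>C\<^esub> c', m) - (frag_of (c, m) + frag_of (c', m))"
      "c \<in> carrier C" "c' \<in> carrier C" "m \<in> carrier M"
    | c m m' where "x = frag_of (c, m \<oplus>\<^bsub>M\<^esub> m') - (frag_of (c, m) + frag_of (c, m'))"
      "c \<in> carrier C" "m \<in> carrier M" "m' \<in> carrier M"
    | c b m where "x = frag_of (c \<otimes>\<^bsub>C\<^esub> \<phi> b, m) - frag_of (c, b \<odot>\<^bsub>M\<^esub> m)"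
         "c \<in> carrier C" "b \<in> carrier B" "m \<in> carrier M"
    unfolding gens_def diff_diff_eq by blast
  then show ?case
  proof cases
    case 1
    then show ?thesis
      by (simp only:) (subst ev_diff_eq, simp, rule G_add, simp, simp, simp add: ev_add ev_frag_of h_add_left)
  next
    case 2
    then show ?thesis
      by (simp only:) (subst ev_diff_eq, simp, rule G_add, simp, simp, simp add: ev_add ev_frag_of h_add_right)
  next
    case 3
    then show ?thesis
      by (simp only:) (subst ev_diff_eq, simp, simp, simp add: ev_frag_of h_balanced)
  qed
qed

lemma lift_tc:
  assumes "x \<in> carrier G" shows "tensor_lift N h (tc x) = ev x"
proof -
  have "tensor_lift N h (tc x) = ev (SOME y. y \<in> tc x)"
    by (simp add: tensor_lift_def ev_def Let_def)
  also have "\<dots> = ev x" using ev_rel some_representative[OF assms] ev_diff_eq[OF _ assms] by blast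
  finally show ?thesis .
qed

lemma lift_closed [simp, intro]: "X \<in> carrier T \<Longrightarrow> tensor_lift N h X \<in> carrier N"
  unfolding carrier_T by (auto simp: lift_tc ev_closed simp del: carrier_free_Abelian_group_iff)

lemma lift_add: "X \<in> carrier T \<Longrightarrow> Y \<in> carrier T \<Longrightarrow>
   tensor_lift N h (X \<oplus>\<^bsub>T\<^esub> Y) = tensor_lift N h X \<oplus>\<^bsub>N\<^esub> tensor_lift N h Y"
  unfolding carrier_T by (auto simp: lift_tc add_T ev_add G_add simp del: carrier_free_Abelian_group_iff)

lemma lift_pt [simp]: "c \<in> carrier C \<Longrightarrow> m \<in> carrier M \<Longrightarrow> tensor_lift N h (pt c m) = h (c, m)"
  by (simp add: lift_tc ev_frag_of)

end


section \<open>Bases of modules\<close>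

text \<open>A recursion instead of \<open>finsum\<close>: it unfolds without closure side
  conditions, and it does not look at the carrier, so the same expression serves for a module and
  for a lattice in it (\<open>lincomb_update_carrier\<close>).\<close>

primrec lincomb :: "('b, 'm, 'z) module_scheme \<Rightarrow> nat \<Rightarrow> (nat \<Rightarrow> 'b) \<Rightarrow> (nat \<Rightarrow> 'm) \<Rightarrow> 'm" where
  "lincomb M 0 c e = \<zero>\<^bsub>M\<^esub>"
| "lincomb M (Suc n) c e = lincomb M n c e \<oplus>\<^bsub>M\<^esub> c n \<odot>\<^bsub>M\<^esub> e n"

definition is_basis ::
  "('b, 'x) ring_scheme \<Rightarrow> ('b, 'm, 'z) module_scheme \<Rightarrow> nat \<Rightarrow> (nat \<Rightarrow> 'm) \<Rightarrow> bool" where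
  "is_basis B M n e \<longleftrightarrow> (\<forall>i<n. e i \<in> carrier M) \<and>
     (\<forall>x\<in>carrier M. \<exists>c. (\<forall>i<n. c i \<in> carrier B) \<and> x = lincomb M n c e) \<and>
     (\<forall>c. (\<forall>i<n. c i \<in> carrier B) \<longrightarrow> lincomb M n c e = \<zero>\<^bsub>M\<^esub> \<longrightarrow> (\<forall>i<n. c i = \<zero>\<^bsub>B\<^esub>))"

lemma is_basisD:
  assumes "is_basis B M n e"
  shows "i < n \<Longrightarrow> e i \<in> carrier M"
    and "x \<in> carrier M \<Longrightarrow> \<exists>c. (\<forall>i<n. c i \<in> carrier B) \<and> x = lincomb M n c e"
    and "(\<And>i. i < n \<Longrightarrow> c i \<in> carrier B) \<Longrightarrow> lincomb M n c e = \<zero>\<^bsub>M\<^esub> \<Longrightarrow> i < n \<Longrightarrow> c i = \<zero>\<^bsub>B\<^esub>"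
  using assms unfolding is_basis_def by blast+

lemma lincomb_cong:
  "(\<And>i. i < n \<Longrightarrow> c i = d i) \<Longrightarrow> (\<And>i. i < n \<Longrightarrow> e i = f i) \<Longrightarrow> lincomb M n c e = lincomb M n d f"
  by (induction n) simp_all

lemma is_basis_cong: "(\<And>i. i < n \<Longrightarrow> e i = f i) \<Longrightarrow> is_basis B M n e = is_basis B M n f"
  unfolding is_basis_def by (simp cong: lincomb_cong)

lemma lincomb_update_carrier: "lincomb (M\<lparr>carrier := T\<rparr>) n c e = lincomb M n c e"
  by (induction n) simp_all

lemma lincomb_mem:
  assumes "\<zero>\<^bsub>M\<^esub> \<in> S" "\<And>x y. x \<in> S \<Longrightarrow> y \<in> S \<Longrightarrow> x \<oplus>\<^bsub>M\<^esub> y \<in> S"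
    "\<And>i. i < n \<Longrightarrow> c i \<odot>\<^bsub>M\<^esub> e i \<in> S"
  shows "lincomb M n c e \<in> S"
  using assms(3) by (induction n) (auto intro: assms(1,2))

context module
begin

lemma lincomb_closed [simp, intro]:
  "(\<And>i. i < n \<Longrightarrow> c i \<in> carrier R) \<Longrightarrow> (\<And>i. i < n \<Longrightarrow> e i \<in> carrier M) \<Longrightarrow> lincomb M n c e \<in> carrier M"
  by (rule lincomb_mem) auto

lemma lincomb_eq_finsum:
  assumes "\<And>i. i < n \<Longrightarrow> c i \<in> carrier R" "\<And>i. i < n \<Longrightarrow> e i \<in> carrier M"
  shows "(\<Oplus>\<^bsub>M\<^esub>i\<in>{..<n}. c i \<odot>\<^bsub>M\<^esub> e i) = lincomb M n c e"
  using assms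
proof (induction n)
  case (Suc n)
  have "(\<Oplus>\<^bsub>M\<^esub>i\<in>insert n {..<n}. c i \<odot>\<^bsub>M\<^esub> e i) = c n \<odot>\<^bsub>M\<^esub> e n \<oplus>\<^bsub>M\<^esub> (\<Oplus>\<^bsub>M\<^esub>i\<in>{..<n}. c i \<odot>\<^bsub>M\<^esub> e i)"
    using Suc.prems by (intro M.finsum_insert) auto
  then show ?case using Suc by (simp add: lessThan_Suc M.a_comm)
qed simp

lemma lincomb_add:
  assumes "\<And>i. i < n \<Longrightarrow> c i \<in> carrier R" "\<And>i. i < n \<Longrightarrow> d i \<in> carrier R" "\<And>i. i < n \<Longrightarrow> e i \<in> carrier M"
  shows "lincomb M n c e \<oplus>\<^bsub>M\<^esub> lincomb M n d e = lincomb M n (\<lambda>i. c i \<oplus> d i) e"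
  using assms
proof (induction n)
  case (Suc n)
  have IH: "lincomb M n (\<lambda>i. c i \<oplus> d i) e = lincomb M n c e \<oplus>\<^bsub>M\<^esub> lincomb M n d e"
    using Suc by simp
  have "lincomb M n c e \<in> carrier M" "lincomb M n d e \<in> carrier M" "c n \<in> carrier R" "d n \<in> carrier R"
    "e n \<in> carrier M"
    using Suc.prems by auto
  then show ?case
    by (simp add: IH smult_l_distr M.a_ac)
qed simp

lemma lincomb_smult:
  assumes "a \<in> carrier R" "\<And>i. i < n \<Longrightarrow> c i \<in> carrier R" "\<And>i. i < n \<Longrightarrow> e i \<in> carrier M"
  shows "a \<odot>\<^bsub>M\<^esub> lincomb M n c e = lincomb M n (\<lambda>i. a \<otimes> c i) e"
  using assms by (induction n) (simp_all add: smult_r_distr smult_assoc1)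

lemma lincomb_zero: "(\<And>i. i < n \<Longrightarrow> e i \<in> carrier M) \<Longrightarrow> lincomb M n (\<lambda>i. \<zero>) e = \<zero>\<^bsub>M\<^esub>"
  by (induction n) simp_all

lemma lincomb_delta:
  assumes "k < n" "\<And>i. i < n \<Longrightarrow> e i \<in> carrier M"
  shows "lincomb M n (\<lambda>i. if i = k then \<one> else \<zero>) e = e k"
  using assms
proof (induction n)
  case (Suc n)
  show ?case
  proof (cases "k = n")
    case True
    have "lincomb M n (\<lambda>i. if i = k then \<one> else \<zero>) e = lincomb M n (\<lambda>i. \<zero>) e"
      using True by (intro lincomb_cong) auto
    then show ?thesis using True Suc.prems by (simp add: lincomb_zero)
  next
    case False
    then show ?thesis using Suc by (simp add: less_Suc_eq)
  qed
qed simp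

lemma is_basis_unique:
  assumes "is_basis R M n e" "\<And>i. i < n \<Longrightarrow> c i \<in> carrier R" "\<And>i. i < n \<Longrightarrow> d i \<in> carrier R"
    "lincomb M n c e = lincomb M n d e" "i < n"
  shows "c i = d i"
proof -
  note e = is_basisD(1)[OF assms(1)]
  define m where "m = (\<lambda>i. (\<ominus> \<one>) \<otimes> d i)"
  have m: "m i \<in> carrier R" if "i < n" for i using assms(3) that by (simp add: m_def)
  have "lincomb M n (\<lambda>i. c i \<oplus> m i) e = lincomb M n c e \<oplus>\<^bsub>M\<^esub> (\<ominus> \<one>) \<odot>\<^bsub>M\<^esub> lincomb M n d e"
    using assms(2,3) e m by (simp add: lincomb_add lincomb_smult m_def)
  also have "\<dots> = \<zero>\<^bsub>M\<^esub>"
    unfolding assms(4) using assms(3) e by (simp add: smult_l_minus M.r_neg)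
  finally have "c i \<oplus> m i = \<zero>"
    using is_basisD(3)[OF assms(1), of "\<lambda>i. c i \<oplus> m i" i] assms(2) m assms(5) by simp
  moreover have "m i = \<ominus> d i" using assms(3,5) by (simp add: m_def R.l_minus)
  ultimately have "\<ominus> (\<ominus> d i) = c i" using assms(2,3,5) by (intro R.minus_equality) auto
  then show ?thesis using assms(3,5) by simp
qed

text \<open>The link to \<open>free_finite_rank\<close>: there coefficient families are extensional
  functions, here arbitrary ones compared below \<open>n\<close>, so both directions truncate with
  \<open>restrict\<close>.\<close>

lemma is_basis_iff_bij_betw:
  "is_basis R M n e \<longleftrightarrow> e \<in> {..<n} \<rightarrow> carrier M \<and>
     bij_betw (\<lambda>c. \<Oplus>\<^bsub>M\<^esub>i\<in>{..<n}. c i \<odot>\<^bsub>M\<^esub> e i) ({..<n} \<rightarrow>\<^sub>E carrier R) (carrier M)"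
  (is "_ \<longleftrightarrow> _ \<and> bij_betw ?S ?C _")
proof (cases "e \<in> {..<n} \<rightarrow> carrier M")
  case True
  then have e: "e i \<in> carrier M" if "i < n" for i using that by blast
  have eq: "?S c = lincomb M n c e" if "c \<in> ?C" for c
    by (rule lincomb_eq_finsum) (use that e in \<open>auto simp: PiE_iff\<close>)
  have "bij_betw ?S ?C (carrier M) \<longleftrightarrow> bij_betw (\<lambda>c. lincomb M n c e) ?C (carrier M)"
    using eq by (rule bij_betw_cong)
  also have "\<dots> \<longleftrightarrow> is_basis R M n e"
  proof
    assume bij: "bij_betw (\<lambda>c. lincomb M n c e) ?C (carrier M)"
    show "is_basis R M n e"
      unfolding is_basis_def
    proof (intro conjI allI impI ballI)
      fix x assume "x \<in> carrier M"
      then have "x \<in> (\<lambda>c. lincomb M n c e) ` ?C" using bij_betw_imp_surj_on[OF bij] by simp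
      then obtain c where "c \<in> ?C" "x = lincomb M n c e" by blast
      then show "\<exists>c. (\<forall>i<n. c i \<in> carrier R) \<and> x = lincomb M n c e"
        by (intro exI[of _ c]) (simp add: PiE_iff)
    next
      fix c i assume c: "\<forall>i<n. c i \<in> carrier R" "lincomb M n c e = \<zero>\<^bsub>M\<^esub>" and i: "i < n"
      let ?c = "restrict c {..<n}" and ?z = "restrict (\<lambda>i. \<zero>) {..<n}"
      have r: "?c \<in> ?C" "?z \<in> ?C" using c(1) by (simp_all add: PiE_iff)
      have 1: "lincomb M n ?c e = lincomb M n c e" by (rule lincomb_cong) simp_all
      have 2: "lincomb M n ?z e = lincomb M n (\<lambda>i. \<zero>) e" by (rule lincomb_cong) simp_all
      have "lincomb M n ?c e = lincomb M n ?z e" unfolding 1 2 c(2) using lincomb_zero[OF e] by simp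
      then have "?c = ?z" using inj_onD[OF bij_betw_imp_inj_on[OF bij] _ r] by blast
      then have "?c i = ?z i" by (rule fun_cong)
      then show "c i = \<zero>" using i by simp
    qed (rule e)
  next
    assume b: "is_basis R M n e"
    show "bij_betw (\<lambda>c. lincomb M n c e) ?C (carrier M)"
    proof (rule bij_betw_imageI)
      show "inj_on (\<lambda>c. lincomb M n c e) ?C"
      proof (rule inj_onI, rule PiE_ext)
        fix c d i assume cd: "c \<in> ?C" "d \<in> ?C" "lincomb M n c e = lincomb M n d e" "i \<in> {..<n}"
        show "c i = d i"
          by (rule is_basis_unique[OF b _ _ cd(3)]) (use cd in \<open>auto simp: PiE_iff\<close>)
      qed
      show "(\<lambda>c. lincomb M n c e) ` ?C = carrier M"
      proof (intro equalityI image_subsetI subsetI)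
        fix c assume "c \<in> ?C"
        then show "lincomb M n c e \<in> carrier M" using e by (intro lincomb_closed) (simp_all add: PiE_iff)
      next
        fix x assume "x \<in> carrier M"
        then obtain c where c: "\<forall>i<n. c i \<in> carrier R" "x = lincomb M n c e" using is_basisD(2)[OF b] by blast
        let ?c = "restrict c {..<n}"
        have "?c \<in> ?C" using c(1) by (simp add: PiE_iff)
        moreover have "x = lincomb M n ?c e"
          unfolding c(2) by (rule lincomb_cong) simp_all
        ultimately show "x \<in> (\<lambda>c. lincomb M n c e) ` ?C" by blast
      qed
    qed
  qed
  finally show ?thesis using True by blast
qed (auto simp: is_basis_def)

lemma free_finite_rank_iff: "free_finite_rank R M \<longleftrightarrow> (\<exists>n e. is_basis R M n e)"
  unfolding free_finite_rank_def is_basis_iff_bij_betw ..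

end

text \<open>One notion covers linear maps (\<open>\<sigma>\<close> the identity), the operator tau
  (\<open>\<sigma>\<close> the Frobenius) and m |-> 1 tensor m (\<open>\<sigma>\<close> the map of
  base rings), so that \<open>semilin_lincomb\<close> moves linear combinations through all of
  them.\<close>

definition semilin ::
  "('b, 'x) ring_scheme \<Rightarrow> ('b \<Rightarrow> 'c) \<Rightarrow> ('b, 'm, 'y) module_scheme \<Rightarrow> ('c, 'n, 'z) module_scheme
     \<Rightarrow> ('m \<Rightarrow> 'n) \<Rightarrow> bool" where
  "semilin B \<sigma> M N f \<longleftrightarrow> f \<in> carrier M \<rightarrow> carrier N \<and>
     (\<forall>x\<in>carrier M. \<forall>y\<in>carrier M. f (x \<oplus>\<^bsub>M\<^esub> y) = f x \<oplus>\<^bsub>N\<^esub> f y) \<and>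
     (\<forall>b\<in>carrier B. \<forall>x\<in>carrier M. f (b \<odot>\<^bsub>M\<^esub> x) = \<sigma> b \<odot>\<^bsub>N\<^esub> f x)"

lemma linear_maps_iff: "f \<in> linear_maps B M N \<longleftrightarrow> semilin B (\<lambda>b. b) M N f"
  unfolding linear_maps_def semilin_def by blast

lemma semilinear_iff: "semilinear B \<sigma> M \<longleftrightarrow> semilin B \<sigma> M M (tau M)"
  unfolding semilinear_def semilin_def ..

lemma semilinD:
  assumes "semilin B \<sigma> M N f"
  shows "x \<in> carrier M \<Longrightarrow> f x \<in> carrier N"
    "x \<in> carrier M \<Longrightarrow> y \<in> carrier M \<Longrightarrow> f (x \<oplus>\<^bsub>M\<^esub> y) = f x \<oplus>\<^bsub>N\<^esub> f y"
    "b \<in> carrier B \<Longrightarrow> x \<in> carrier M \<Longrightarrow> f (b \<odot>\<^bsub>M\<^esub> x) = \<sigma> b \<odot>\<^bsub>N\<^esub> f x"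
  using assms unfolding semilin_def by blast+

lemma semilin_comp:
  assumes "semilin B \<sigma> M N f" "semilin C \<rho> N P g" "\<sigma> \<in> carrier B \<rightarrow> carrier C"
  shows "semilin B (\<rho> \<circ> \<sigma>) M P (g \<circ> f)"
  using assms unfolding semilin_def by (simp add: Pi_iff)

lemma semilin_funpow:
  assumes "semilin B \<sigma> M M f" "\<sigma> \<in> carrier B \<rightarrow> carrier B"
  shows "semilin B (\<sigma> ^^ k) M M (f ^^ k)"
proof (induction k)
  case 0
  show ?case by (simp add: semilin_def)
next
  case (Suc k)
  have "(\<sigma> ^^ k) \<in> carrier B \<rightarrow> carrier B" using assms(2) by (induction k) (auto simp: Pi_iff)
  from semilin_comp[OF Suc assms(1) this] show ?case by (simp add: comp_def)
qed

lemma semilin_zero: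
  assumes "abelian_group M" "abelian_group N" "semilin B \<sigma> M N f"
  shows "f \<zero>\<^bsub>M\<^esub> = \<zero>\<^bsub>N\<^esub>"
proof -
  interpret M: abelian_group M by fact
  interpret N: abelian_group N by fact
  have "f \<zero>\<^bsub>M\<^esub> \<oplus>\<^bsub>N\<^esub> f \<zero>\<^bsub>M\<^esub> = f \<zero>\<^bsub>M\<^esub>"
    using semilinD(2)[OF assms(3) M.zero_closed M.zero_closed] by simp
  then show ?thesis using semilinD(1)[OF assms(3) M.zero_closed]
    by (metis N.add.r_cancel_one)
qed

lemma semilin_lincomb:
  assumes "module B M" "module C N" "semilin B \<sigma> M N f"
    "\<And>i. i < n \<Longrightarrow> c i \<in> carrier B" "\<And>i. i < n \<Longrightarrow> e i \<in> carrier M"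
  shows "f (lincomb M n c e) = lincomb N n (\<lambda>i. \<sigma> (c i)) (\<lambda>i. f (e i))"
proof -
  interpret M: module B M by fact
  interpret N: module C N by fact
  show ?thesis using assms(4,5)
  proof (induction n)
    case 0
    show ?case using semilin_zero[OF M.abelian_group_axioms N.abelian_group_axioms assms(3)] by simp
  next
    case (Suc n)
    then show ?case
      by (simp add: semilinD[OF assms(3)])
  qed
qed

lemma is_basis_image:
  assumes "module B M" "module B N" "semilin B (\<lambda>b. b) M N f" "bij_betw f (carrier M) (carrier N)"
    and b: "is_basis B M n e"
  shows "is_basis B N n (\<lambda>i. f (e i))"
proof -
  interpret M: module B M by fact
  interpret N: module B N by fact
  note e = is_basisD(1)[OF b]
  have eq: "f (lincomb M n c e) = lincomb N n c (\<lambda>i. f (e i))" if "\<And>i. i < n \<Longrightarrow> c i \<in> carrier B" for c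
    using semilin_lincomb[OF assms(1-3) that e] .
  show ?thesis
    unfolding is_basis_def
  proof (intro conjI allI impI ballI)
    fix x assume "x \<in> carrier N"
    then obtain y where y: "y \<in> carrier M" "x = f y" using assms(4) unfolding bij_betw_def by blast
    then obtain c where "\<forall>i<n. c i \<in> carrier B" "y = lincomb M n c e" using is_basisD(2)[OF b] by blast
    then show "\<exists>c. (\<forall>i<n. c i \<in> carrier B) \<and> x = lincomb N n c (\<lambda>i. f (e i))"
      using y eq by (intro exI[of _ c]) auto
  next
    fix c i assume c: "\<forall>i<n. c i \<in> carrier B" "lincomb N n c (\<lambda>i. f (e i)) = \<zero>\<^bsub>N\<^esub>" and i: "i < n"
    then have "f (lincomb M n c e) = f \<zero>\<^bsub>M\<^esub>"
      using eq semilin_zero[OF M.abelian_group_axioms N.abelian_group_axioms assms(3)] by simp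
    then have "lincomb M n c e = \<zero>\<^bsub>M\<^esub>"
      using inj_onD[OF bij_betw_imp_inj_on[OF assms(4)], of "lincomb M n c e" "\<zero>\<^bsub>M\<^esub>"] c e by blast
    then show "c i = \<zero>\<^bsub>B\<^esub>" using is_basisD(3)[OF b] c i by blast
  qed (use e semilinD(1)[OF assms(3)] in auto)
qed

lemma bij_betw_of_basis:
  assumes "module B M" "module B N" "semilin B (\<lambda>b. b) M N f"
    and b: "is_basis B M n e" and b': "is_basis B N n (\<lambda>i. f (e i))"
  shows "bij_betw f (carrier M) (carrier N)"
proof -
  interpret M: module B M by fact
  interpret N: module B N by fact
  note e = is_basisD(1)[OF b]
  have eq: "f (lincomb M n c e) = lincomb N n c (\<lambda>i. f (e i))" if "\<And>i. i < n \<Longrightarrow> c i \<in> carrier B" for c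
    using semilin_lincomb[OF assms(1-3) that e] .
  show ?thesis
    unfolding bij_betw_def
  proof
    show "inj_on f (carrier M)"
    proof (rule inj_onI)
      fix x y assume xy: "x \<in> carrier M" "y \<in> carrier M" "f x = f y"
      then obtain c d where c: "\<forall>i<n. c i \<in> carrier B" "x = lincomb M n c e"
        and d: "\<forall>i<n. d i \<in> carrier B" "y = lincomb M n d e" using is_basisD(2)[OF b] by metis
      have "c i = d i" if "i < n" for i
        by (rule N.is_basis_unique[OF b' _ _ _ that]) (use xy c d eq in auto)
      then show "x = y" using c d by (auto intro: lincomb_cong)
    qed
    show "f ` carrier M = carrier N"
    proof
      show "f ` carrier M \<subseteq> carrier N" using semilinD(1)[OF assms(3)] by auto
      show "carrier N \<subseteq> f ` carrier M"
      proof
        fix x assume "x \<in> carrier N"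
        then obtain c where c: "\<forall>i<n. c i \<in> carrier B" "x = lincomb N n c (\<lambda>i. f (e i))"
          using is_basisD(2)[OF b'] by blast
        then have "x = f (lincomb M n c e)" using eq by auto
        then show "x \<in> f ` carrier M" using c e by blast
      qed
    qed
  qed
qed

text \<open>Here the rings differ as well: coordinates are pulled back through the inverse of
  \<open>\<sigma>\<close>. This brings a basis over the localization at a unit back to the ring
  itself.\<close>

lemma is_basis_preimage:
  assumes "module B M" "module C N" "\<sigma> \<in> ring_iso B C" "semilin B \<sigma> M N f"
    "bij_betw f (carrier M) (carrier N)" and b: "is_basis C N n e'"
  shows "\<exists>e. is_basis B M n e"
proof -
  interpret M: module B M by fact
  interpret N: module C N by fact
  have sig: "bij_betw \<sigma> (carrier B) (carrier C)" "\<sigma> \<in> ring_hom B C" using assms(3) by (auto simp: ring_iso_def)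
  define e where "e = (\<lambda>i. inv_into (carrier M) f (e' i))"
  have e: "e i \<in> carrier M" "f (e i) = e' i" if "i < n" for i
    using is_basisD(1)[OF b that] assms(5) unfolding e_def bij_betw_def
    by (auto intro: inv_into_into f_inv_into_f)
  have eq: "f (lincomb M n c e) = lincomb N n (\<lambda>i. \<sigma> (c i)) e'" if "\<And>i. i < n \<Longrightarrow> c i \<in> carrier B" for c
  proof -
    have "f (lincomb M n c e) = lincomb N n (\<lambda>i. \<sigma> (c i)) (\<lambda>i. f (e i))"
      by (rule semilin_lincomb[OF assms(1,2,4) that e(1)])
    also have "\<dots> = lincomb N n (\<lambda>i. \<sigma> (c i)) e'" by (rule lincomb_cong) (simp_all add: e)
    finally show ?thesis .
  qed
  have "is_basis B M n e"
    unfolding is_basis_def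
  proof (intro conjI allI impI ballI)
    fix x assume x: "x \<in> carrier M"
    obtain c where c: "\<forall>i<n. c i \<in> carrier C" "f x = lincomb N n c e'"
      using is_basisD(2)[OF b semilinD(1)[OF assms(4) x]] by blast
    define d where "d = (\<lambda>i. inv_into (carrier B) \<sigma> (c i))"
    have d: "d i \<in> carrier B" "\<sigma> (d i) = c i" if "i < n" for i
      using c that sig(1) unfolding d_def bij_betw_def by (auto intro: inv_into_into f_inv_into_f)
    have "lincomb N n (\<lambda>i. \<sigma> (d i)) e' = lincomb N n c e'" by (rule lincomb_cong) (simp_all add: d)
    then have "f x = f (lincomb M n d e)" using eq[of d] d(1) c(2) by simp
    then have "x = lincomb M n d e" using inj_onD[OF bij_betw_imp_inj_on[OF assms(5)], of x "lincomb M n d e"] x d(1) e(1) by blast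
    then show "\<exists>c. (\<forall>i<n. c i \<in> carrier B) \<and> x = lincomb M n c e" using d(1) by blast
  next
    fix c i assume c: "\<forall>i<n. c i \<in> carrier B" "lincomb M n c e = \<zero>\<^bsub>M\<^esub>" and i: "i < n"
    have "lincomb N n (\<lambda>i. \<sigma> (c i)) e' = \<zero>\<^bsub>N\<^esub>"
      using eq[of c] c semilin_zero[OF M.abelian_group_axioms N.abelian_group_axioms assms(4)] by simp
    then have "\<sigma> (c i) = \<zero>\<^bsub>C\<^esub>"
      using is_basisD(3)[OF b, of "\<lambda>i. \<sigma> (c i)" i] i c ring_hom_closed[OF sig(2)] by simp
    also have "\<zero>\<^bsub>C\<^esub> = \<sigma> \<zero>\<^bsub>B\<^esub>"
      using ring_hom_zero[OF sig(2) M.R.ring_axioms N.R.ring_axioms] by simp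
    finally show "c i = \<zero>\<^bsub>B\<^esub>" using inj_onD[OF bij_betw_imp_inj_on[OF sig(1)], of "c i" "\<zero>\<^bsub>B\<^esub>"] c i by blast
  qed (use e in auto)
  then show ?thesis by blast
qed

text \<open>The type of \<^const>\<open>tensor_lift\<close> requires its target to be a module record.\<close>

definition self_module :: "('b, 'x) ring_scheme \<Rightarrow> ('b, 'b) module" where
  "self_module B = \<lparr>carrier = carrier B, monoid.mult = undefined, one = undefined,
     zero = \<zero>\<^bsub>B\<^esub>, add = (\<oplus>\<^bsub>B\<^esub>), smult = (\<otimes>\<^bsub>B\<^esub>)\<rparr>"

lemma self_module_simps [simp]:
  "carrier (self_module B) = carrier B" "\<zero>\<^bsub>self_module B\<^esub> = \<zero>\<^bsub>B\<^esub>"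
  "x \<oplus>\<^bsub>self_module B\<^esub> y = x \<oplus>\<^bsub>B\<^esub> y" "x \<odot>\<^bsub>self_module B\<^esub> y = x \<otimes>\<^bsub>B\<^esub> y"
  by (simp_all add: self_module_def)

lemma module_self_module:
  assumes "cring B" shows "module B (self_module B)"
proof -
  interpret B: cring B by fact
  have "abelian_group (self_module B)"
  proof (rule abelian_groupI, unfold self_module_simps)
    fix x assume "x \<in> carrier B"
    then show "\<exists>y\<in>carrier B. y \<oplus>\<^bsub>B\<^esub> x = \<zero>\<^bsub>B\<^esub>" using B.l_neg by blast
  qed (simp_all add: B.a_ac)
  then show ?thesis
    by (intro moduleI) (simp_all add: assms B.l_distr B.r_distr B.m_assoc)
qed

text \<open>\<open>tensor_universal\<close> asks for a biadditive balanced map, so how the lift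
  treats scalars is a separate matter: the identity twist gives linear lifts, the Frobenius twist
  gives tau on the base change.\<close>

lemma lift_semilin:
  assumes "tensor_universal B C \<phi> M N h" "module C N" "\<And>a c m. a \<in> carrier C \<Longrightarrow> c \<in> carrier C \<Longrightarrow> m \<in> carrier M \<Longrightarrow>
     h (a \<otimes>\<^bsub>C\<^esub> c, m) = \<sigma> a \<odot>\<^bsub>N\<^esub> h (c, m)" "\<sigma> \<in> carrier C \<rightarrow> carrier C"
  shows "semilin C \<sigma> (base_change B C \<phi> M) N (tensor_lift N h)"
proof -
  interpret tensor_universal B C \<phi> M N h by fact
  interpret NM: module C N by fact
  have "tensor_lift N h (a \<odot>\<^bsub>T\<^esub> X) = \<sigma> a \<odot>\<^bsub>N\<^esub> tensor_lift N h X" if "a \<in> carrier C" "X \<in> carrier T" for a X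
    using that(2)
  proof (induction rule: T_induct)
    case (pure c m)
    then show ?case using that(1) assms(3) by simp
  next
    case (add X Y)
    have "\<sigma> a \<in> carrier C" using that(1) assms(4) by blast
    then show ?case using that(1) add by (simp add: T.smult_r_distr lift_add NM.smult_r_distr)
  qed
  then show ?thesis unfolding semilin_def by (auto simp: lift_add)
qed

section \<open>Bases under base change\<close>

context tensor_base
begin

lemma unit_semilin: "semilin B \<phi> M T (\<lambda>m. pt \<one>\<^bsub>C\<^esub> m)"
  unfolding semilin_def by (auto simp: pt_add_right pt_balanced)

lemma pt_eq_smult: "c \<in> carrier C \<Longrightarrow> m \<in> carrier M \<Longrightarrow> pt c m = c \<odot>\<^bsub>T\<^esub> pt \<one>\<^bsub>C\<^esub> m"
  by simp

text \<open>Generation is checked on pure tensors. For independence, the \<open>k\<close>-th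
  coordinate on \<open>M\<close> induces a linear functional on the tensor product, which takes 1
  tensor e_i to 1 or 0 and so reads off the \<open>k\<close>-th coefficient of a vanishing
  combination.\<close>

lemma basis_base_change:
  assumes b: "is_basis B M n e"
  shows "is_basis C T n (\<lambda>i. pt \<one>\<^bsub>C\<^esub> (e i))"
proof -
  note e = is_basisD(1)[OF b]
  interpret S: module C "self_module C" by (rule module_self_module) (rule C.is_cring)
  define coord where "coord = (\<lambda>m. SOME c. (\<forall>i<n. c i \<in> carrier B) \<and> m = lincomb M n c e)"
  have coord: "(\<forall>i<n. coord m i \<in> carrier B) \<and> m = lincomb M n (coord m) e" if "m \<in> carrier M" for m
    unfolding coord_def using is_basisD(2)[OF b that] by (rule someI_ex)
  have coord_eq: "coord (lincomb M n c e) i = c i" if "\<And>i. i < n \<Longrightarrow> c i \<in> carrier B" "i < n" for c i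
  proof -
    have "lincomb M n c e \<in> carrier M" using that e by blast
    from coord[OF this] show ?thesis by (intro M.is_basis_unique[OF b _ _ _ that(2)]) (use that in auto)
  qed
  have coord_add: "coord (x \<oplus>\<^bsub>M\<^esub> y) i = coord x i \<oplus>\<^bsub>B\<^esub> coord y i" if "x \<in> carrier M" "y \<in> carrier M" "i < n" for x y i
  proof -
    have "x \<oplus>\<^bsub>M\<^esub> y = lincomb M n (\<lambda>i. coord x i \<oplus>\<^bsub>B\<^esub> coord y i) e"
      using coord[OF that(1)] coord[OF that(2)] e
        M.lincomb_add[of n "coord x" "coord y" e] by simp
    then show ?thesis using coord_eq[of "\<lambda>i. coord x i \<oplus>\<^bsub>B\<^esub> coord y i" i]
      coord[OF that(1)] coord[OF that(2)] that(3) by simp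
  qed
  have coord_smult: "coord (a \<odot>\<^bsub>M\<^esub> x) i = a \<otimes>\<^bsub>B\<^esub> coord x i" if "x \<in> carrier M" "a \<in> carrier B" "i < n" for x a i
  proof -
    have "a \<odot>\<^bsub>M\<^esub> x = lincomb M n (\<lambda>i. a \<otimes>\<^bsub>B\<^esub> coord x i) e"
      using coord[OF that(1)] e that(2) M.lincomb_smult[of a n "coord x" e] by simp
    then show ?thesis using coord_eq[of "\<lambda>i. a \<otimes>\<^bsub>B\<^esub> coord x i" i]
      coord[OF that(1)] that by simp
  qed
  show ?thesis
    unfolding is_basis_def
  proof (intro conjI allI impI ballI)
    fix X assume "X \<in> carrier T"
    then show "\<exists>c. (\<forall>i<n. c i \<in> carrier C) \<and> X = lincomb T n c (\<lambda>i. pt \<one>\<^bsub>C\<^esub> (e i))"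
    proof (induction rule: T_induct)
      case (pure a m)
      have "pt \<one>\<^bsub>C\<^esub> m = lincomb T n (\<lambda>i. \<phi> (coord m i)) (\<lambda>i. pt \<one>\<^bsub>C\<^esub> (e i))"
        using semilin_lincomb[OF M.module_axioms T.module_axioms unit_semilin, of n "coord m" e]
          coord[OF pure(2)] e by auto
      then have "pt a m = lincomb T n (\<lambda>i. a \<otimes>\<^bsub>C\<^esub> \<phi> (coord m i)) (\<lambda>i. pt \<one>\<^bsub>C\<^esub> (e i))"
        using pure coord[OF pure(2)] e
        by (subst pt_eq_smult) (auto simp: T.lincomb_smult simp del: pt_smult)
      then show ?case using pure coord[OF pure(2)] by (intro exI[of _ "\<lambda>i. a \<otimes>\<^bsub>C\<^esub> \<phi> (coord m i)"]) auto
    next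
      case (add X Y)
      then obtain c d where c: "\<forall>i<n. c i \<in> carrier C" "X = lincomb T n c (\<lambda>i. pt \<one>\<^bsub>C\<^esub> (e i))"
        and d: "\<forall>i<n. d i \<in> carrier C" "Y = lincomb T n d (\<lambda>i. pt \<one>\<^bsub>C\<^esub> (e i))" by blast
      then show ?case using e
        by (intro exI[of _ "\<lambda>i. c i \<oplus>\<^bsub>C\<^esub> d i"]) (auto simp: T.lincomb_add)
    qed
  next
    fix c k assume c: "\<forall>i<n. c i \<in> carrier C" "lincomb T n c (\<lambda>i. pt \<one>\<^bsub>C\<^esub> (e i)) = \<zero>\<^bsub>T\<^esub>" and k: "k < n"
    define h where "h = (\<lambda>(c, m). c \<otimes>\<^bsub>C\<^esub> \<phi> (coord m k))"
    have cl: "coord m k \<in> carrier B" if "m \<in> carrier M" for m using coord[OF that] k by blast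
    have delta: "lincomb (self_module C) n' c (\<lambda>i. if i = k then \<one>\<^bsub>C\<^esub> else \<zero>\<^bsub>C\<^esub>) = (if k < n' then c k else \<zero>\<^bsub>C\<^esub>)"
      if "n' \<le> n" for n'
      using that
    proof (induction n')
      case (Suc j)
      then show ?case using c(1) k by (cases "j = k") (auto simp: less_Suc_eq)
    qed simp
    interpret U: tensor_universal B C \<phi> M "self_module C" h
      by unfold_locales
        (simp_all add: h_def cl k C.l_distr C.r_distr coord_add coord_smult C.m_assoc
             ring_hom_add[OF phi] ring_hom_mult[OF phi])
    have "semilin C (\<lambda>a. a) T (self_module C) (tensor_lift (self_module C) h)"
      by (rule lift_semilin[OF U.tensor_universal_axioms S.module_axioms]) (auto simp: h_def C.m_assoc cl)
    from semilin_lincomb[OF T.module_axioms S.module_axioms this, of n c "\<lambda>i. pt \<one>\<^bsub>C\<^esub> (e i)"]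
    have "tensor_lift (self_module C) h \<zero>\<^bsub>T\<^esub> =
        lincomb (self_module C) n c (\<lambda>i. tensor_lift (self_module C) h (pt \<one>\<^bsub>C\<^esub> (e i)))"
      using c e by auto
    also have "\<dots> = lincomb (self_module C) n c (\<lambda>i. if i = k then \<one>\<^bsub>C\<^esub> else \<zero>\<^bsub>C\<^esub>)"
    proof (rule lincomb_cong, rule refl)
      fix i assume i: "i < n"
      have "coord (e i) k = (if k = i then \<one>\<^bsub>B\<^esub> else \<zero>\<^bsub>B\<^esub>)"
        using coord_eq[of "\<lambda>k. if k = i then \<one>\<^bsub>B\<^esub> else \<zero>\<^bsub>B\<^esub>" k] M.lincomb_delta[OF i e] k by simp
      moreover have "\<phi> \<one>\<^bsub>B\<^esub> = \<one>\<^bsub>C\<^esub>" "\<phi> \<zero>\<^bsub>B\<^esub> = \<zero>\<^bsub>C\<^esub>"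
        using ring_hom_one[OF phi] ring_hom_zero[OF phi B.ring_axioms C.ring_axioms] by auto
      ultimately show "tensor_lift (self_module C) h (pt \<one>\<^bsub>C\<^esub> (e i)) = (if i = k then \<one>\<^bsub>C\<^esub> else \<zero>\<^bsub>C\<^esub>)"
        using U.lift_pt[of "\<one>\<^bsub>C\<^esub>" "e i"] e[OF i] by (auto simp: h_def)
    qed
    also have "\<dots> = c k" using delta[of n] k by simp
    also have "tensor_lift (self_module C) h \<zero>\<^bsub>T\<^esub> = \<zero>\<^bsub>C\<^esub>"
      using semilin_zero[OF T.abelian_group_axioms S.abelian_group_axioms
        \<open>semilin C (\<lambda>a. a) T (self_module C) (tensor_lift (self_module C) h)\<close>] by simp
    finally show "c k = \<zero>\<^bsub>C\<^esub>" ..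
  qed (use e in auto)
qed

text \<open>Coordinates in the basis 1 tensor e_i are the images under \<open>\<phi>\<close> of the
  old coordinates, so freeness turns injectivity of \<open>\<phi>\<close> into that of m |-> 1
  tensor m. This is the source of faithfulness.\<close>

lemma unit_inj:
  assumes b: "is_basis B M n e" and inj: "inj_on \<phi> (carrier B)"
  shows "inj_on (\<lambda>m. pt \<one>\<^bsub>C\<^esub> m) (carrier M)"
proof (rule inj_onI)
  note e = is_basisD(1)[OF b]
  fix x y assume xy: "x \<in> carrier M" "y \<in> carrier M" "pt \<one>\<^bsub>C\<^esub> x = pt \<one>\<^bsub>C\<^esub> y"
  then obtain c d where c: "\<forall>i<n. c i \<in> carrier B" "x = lincomb M n c e"
    and d: "\<forall>i<n. d i \<in> carrier B" "y = lincomb M n d e" using is_basisD(2)[OF b] by metis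
  have eq: "pt \<one>\<^bsub>C\<^esub> (lincomb M n c e) = lincomb T n (\<lambda>i. \<phi> (c i)) (\<lambda>i. pt \<one>\<^bsub>C\<^esub> (e i))"
    if "\<forall>i<n. c i \<in> carrier B" for c
    using semilin_lincomb[OF M.module_axioms T.module_axioms unit_semilin, of n c e] that e by blast
  have "\<phi> (c i) = \<phi> (d i)" if "i < n" for i
    by (rule T.is_basis_unique[OF basis_base_change[OF b] _ _ _ that, of "\<lambda>i. \<phi> (c i)" "\<lambda>i. \<phi> (d i)"])
      (use xy c d eq[OF c(1)] eq[OF d(1)] in auto)
  then have "c i = d i" if "i < n" for i using inj c(1) d(1) that by (blast dest: inj_onD)
  then show "x = y" using c d by (auto intro: lincomb_cong)
qed

text \<open>The inverse is the lift of (c, m) |-> \<psi>(c) m, with \<open>\<psi>\<close> inverse to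
  \<open>\<phi>\<close>.\<close>

lemma unit_bij:
  assumes "\<phi> \<in> ring_iso B C"
  shows "bij_betw (\<lambda>m. pt \<one>\<^bsub>C\<^esub> m) (carrier M) (carrier T)"
proof -
  have bij: "bij_betw \<phi> (carrier B) (carrier C)" using assms by (auto simp: ring_iso_def)
  define \<psi> where "\<psi> = inv_into (carrier B) \<phi>"
  have psi: "\<psi> \<in> ring_iso C B" unfolding \<psi>_def by (rule ring_iso_set_sym[OF B.ring_axioms assms])
  then have psih: "\<psi> \<in> ring_hom C B" by (auto simp: ring_iso_def)
  have pp: "\<psi> (\<phi> b) = b" if "b \<in> carrier B" for b using that bij by (simp add: \<psi>_def bij_betw_def)
  have ppc: "\<phi> (\<psi> b) = b" if "b \<in> carrier C" for b
    using that bij by (simp add: \<psi>_def bij_betw_def f_inv_into_f)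
  have pc: "\<psi> c \<in> carrier B" if "c \<in> carrier C" for c using ring_hom_closed[OF psih that] .
  define h where "h = (\<lambda>(c, m). \<psi> c \<odot>\<^bsub>M\<^esub> m)"
  interpret U: tensor_universal B C \<phi> M M h
    by unfold_locales
      (auto simp: h_def pc M.smult_l_distr M.smult_r_distr M.smult_assoc1 pp
         ring_hom_add[OF psih] ring_hom_mult[OF psih])
  show ?thesis
  proof (rule bij_betwI[where g = "tensor_lift M h"])
    fix x assume "x \<in> carrier M"
    then show "tensor_lift M h (pt \<one>\<^bsub>C\<^esub> x) = x"
      using U.lift_pt[of "\<one>\<^bsub>C\<^esub>" x] by (simp add: h_def ring_hom_one[OF psih])
  next
    fix X assume "X \<in> carrier T"
    then show "pt \<one>\<^bsub>C\<^esub> (tensor_lift M h X) = X"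
    proof (induction rule: T_induct)
      case (pure c m)
      then show ?case using U.lift_pt[of c m] by (simp add: h_def pt_balanced pc ppc)
    next
      case (add X Y)
      then show ?case by (simp add: U.lift_add pt_add_right)
    qed
  qed auto
qed

end

section \<open>Localization at a unit; locally free modules over local rings\<close>

context cring
begin

context
  fixes f assumes f: "f \<in> Units R"
begin

text \<open>Powers of the unit \<open>f\<close> cancel, so the class contains exactly one numerator
  for each exponent \<open>j\<close>.\<close>

lemma frac_zero_eq:
  assumes "b \<in> carrier R"
  shows "frac R f b 0 = range (\<lambda>j::nat. (f [^] j \<otimes> b, j))"
proof -
  have pow: "f [^] k \<in> Units R" for k :: nat using f by (induction k) auto
  show ?thesis
  proof (intro equalityI subrelI)
    fix c j assume "(c, j) \<in> frac R f b 0"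
    then obtain k :: nat where c: "c \<in> carrier R"
      and eq: "f [^] k \<otimes> (f [^] j \<otimes> b) = f [^] k \<otimes> (f [^] (0::nat) \<otimes> c)"
      unfolding frac_def by blast
    then have "f [^] j \<otimes> b = c"
      using Units_l_cancel[OF pow[of k], of "f [^] j \<otimes> b" c] Units_closed[OF f] assms by simp
    then show "(c, j) \<in> range (\<lambda>j. (f [^] j \<otimes> b, j))" by blast
  next
    fix c and j :: nat assume "(c, j) \<in> range (\<lambda>j. (f [^] j \<otimes> b, j))"
    then have c: "c = f [^] j \<otimes> b" by blast
    show "(c, j) \<in> frac R f b 0"
      unfolding frac_def c using Units_closed[OF f] assms by auto
  qed
qed

lemma frac_pow_eq:
  assumes "b \<in> carrier R"
  shows "frac R f (f [^] i \<otimes> b) i = frac R f b 0"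
proof -
  have pow: "f [^] k \<in> Units R" for k :: nat using f by (induction k) auto
  have pc: "f [^] k \<in> carrier R" for k :: nat using Units_closed[OF f] by simp
  show ?thesis
    unfolding frac_zero_eq[OF assms]
  proof (intro equalityI subrelI)
    fix c j assume "(c, j) \<in> frac R f (f [^] i \<otimes> b) i"
    then obtain k :: nat where c: "c \<in> carrier R"
      and eq: "f [^] k \<otimes> (f [^] j \<otimes> (f [^] i \<otimes> b)) = f [^] k \<otimes> (f [^] i \<otimes> c)"
      unfolding frac_def by blast
    then have "f [^] i \<otimes> (f [^] j \<otimes> b) = f [^] i \<otimes> c"
      using Units_l_cancel[OF pow[of k], of "f [^] j \<otimes> (f [^] i \<otimes> b)" "f [^] i \<otimes> c"] pc assms
      by (simp add: m_lcomm)
    then have "f [^] j \<otimes> b = c"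
      using Units_l_cancel[OF pow[of i], of "f [^] j \<otimes> b" c] pc assms c by simp
    then show "(c, j) \<in> range (\<lambda>j. (f [^] j \<otimes> b, j))" by blast
  next
    fix c and j :: nat assume "(c, j) \<in> range (\<lambda>j. (f [^] j \<otimes> b, j))"
    then have c: "c = f [^] j \<otimes> b" by blast
    show "(c, j) \<in> frac R f (f [^] i \<otimes> b) i"
      unfolding frac_def c using pc assms by (auto simp: m_lcomm)
  qed
qed

text \<open>Sum and product in \<open>localization\<close> are unions over all pairs of
  representatives. By \<open>frac_pow_eq\<close> all these pairs give the same fraction when
  \<open>f\<close> is a unit, so the unions collapse.\<close>

lemma localization_ring_iso: "(\<lambda>b. frac R f b 0) \<in> ring_iso R (localization R f)"
  and localization_cring: "cring (localization R f)"
proof -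
  have pow: "f [^] k \<in> Units R" for k :: nat using f by (induction k) auto
  have pc: "f [^] k \<in> carrier R" for k :: nat using Units_closed[OF f] by simp
  have "frac R f (f [^] i \<otimes> a \<otimes> (f [^] j \<otimes> b)) (i + j) = frac R f (a \<otimes> b) 0"
    if "a \<in> carrier R" "b \<in> carrier R" for a b and i j :: nat
  proof -
    have "f [^] i \<otimes> a \<otimes> (f [^] j \<otimes> b) = f [^] (i + j) \<otimes> (a \<otimes> b)"
      using that Units_closed[OF f] by (simp add: nat_pow_mult[symmetric] m_ac)
    then show ?thesis using frac_pow_eq[of "a \<otimes> b" "i + j"] that by simp
  qed
  then have mult: "frac R f a 0 \<otimes>\<^bsub>localization R f\<^esub> frac R f b 0 = frac R f (a \<otimes> b) 0"
    if "a \<in> carrier R" "b \<in> carrier R" for a b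
    using that by (simp add: localization_def frac_zero_eq)
  have "frac R f (f [^] j \<otimes> (f [^] i \<otimes> a) \<oplus> f [^] i \<otimes> (f [^] j \<otimes> b)) (i + j) = frac R f (a \<oplus> b) 0"
    if "a \<in> carrier R" "b \<in> carrier R" for a b and i j :: nat
  proof -
    have "f [^] j \<otimes> (f [^] i \<otimes> a) \<oplus> f [^] i \<otimes> (f [^] j \<otimes> b) = f [^] (i + j) \<otimes> (a \<oplus> b)"
      using that Units_closed[OF f] by (simp add: nat_pow_mult[symmetric] r_distr m_ac)
    then show ?thesis using frac_pow_eq[of "a \<oplus> b" "i + j"] that by simp
  qed
  then have add: "frac R f a 0 \<oplus>\<^bsub>localization R f\<^esub> frac R f b 0 = frac R f (a \<oplus> b) 0"
    if "a \<in> carrier R" "b \<in> carrier R" for a b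
    using that by (simp add: localization_def frac_zero_eq)
  show iso: "(\<lambda>b. frac R f b 0) \<in> ring_iso R (localization R f)"
  proof (rule ring_iso_memI)
    fix a assume "a \<in> carrier R" then show "frac R f a 0 \<in> carrier (localization R f)"
      by (auto simp: localization_def)
  next
    show "frac R f \<one> 0 = \<one>\<^bsub>localization R f\<^esub>" by (simp add: localization_def)
  next
    show "bij_betw (\<lambda>b. frac R f b 0) (carrier R) (carrier (localization R f))"
      unfolding bij_betw_def
    proof
      show "inj_on (\<lambda>b. frac R f b 0) (carrier R)"
      proof (rule inj_onI)
        fix a b assume ab: "a \<in> carrier R" "b \<in> carrier R" "frac R f a 0 = frac R f b 0"
        have "(a, 0) \<in> range (\<lambda>j::nat. (f [^] j \<otimes> a, j))"
          using ab(1) by (intro image_eqI[of _ _ 0]) simp_all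
        then have "(a, 0) \<in> range (\<lambda>j::nat. (f [^] j \<otimes> b, j))"
          using ab(3) unfolding frac_zero_eq[OF ab(1)] frac_zero_eq[OF ab(2)] by simp
        then have "a = f [^] (0::nat) \<otimes> b" by blast
        then show "a = b" using ab(2) by simp
      qed
      have "\<exists>b. b \<in> carrier R \<and> frac R f a i = frac R f b 0" if "a \<in> carrier R" for a i
      proof -
        have "f [^] i \<otimes> (inv (f [^] i) \<otimes> a) = a"
          using that pow[of i] by (simp add: m_assoc[symmetric] pc)
        then show ?thesis
          using frac_pow_eq[of "inv (f [^] i) \<otimes> a" i] that pow[of i] by (intro exI[of _ "inv (f [^] i) \<otimes> a"]) simp
      qed
      then show "(\<lambda>b. frac R f b 0) ` carrier R = carrier (localization R f)"
        by (auto simp: localization_def image_iff) metis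
    qed
  qed (simp_all add: mult add)
  \<comment> \<open>The transport of ring axioms speaks of the record whose zero is the image of
    zero; for \<open>localization\<close> that is already its zero.\<close>
  have "cring (localization R f \<lparr>zero := frac R f \<zero> 0\<rparr>)"
    by (rule ring_iso_imp_img_cring[OF iso])
  moreover have "localization R f \<lparr>zero := frac R f \<zero> 0\<rparr> = localization R f"
    by (simp add: localization_def)
  ultimately show "cring (localization R f)" by simp
qed

lemma free_localization_iff:
  assumes "module R M"
  shows "free_finite_rank (localization R f) (base_change R (localization R f) (\<lambda>b. frac R f b 0) M)
     \<longleftrightarrow> free_finite_rank R M"
proof -
  interpret L: cring "localization R f" by (rule localization_cring)
  interpret M: module R M by fact
  interpret tb: tensor_base R "localization R f" "\<lambda>b. frac R f b 0" M
    using localization_ring_iso by unfold_locales (auto simp: ring_iso_def)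
  show ?thesis
    unfolding M.free_finite_rank_iff tb.T.free_finite_rank_iff
    using tb.basis_base_change is_basis_preimage[OF assms tb.T.module_axioms localization_ring_iso
        tb.unit_semilin tb.unit_bij[OF localization_ring_iso]] by blast
qed

end

text \<open>The cover of the spectrum by the single open set D(1) suffices.\<close>

lemma locally_free_of_free:
  assumes "module R M" "free_finite_rank R M"
  shows "locally_free_finite_type R M"
  unfolding locally_free_finite_type_def
  by (intro conjI assms(1) exI[of _ "{\<one>}"])
    (simp_all add: genideal_one free_localization_iff assms)

text \<open>\<open>loc\<close> is the local ring condition: any cover of the spectrum contains some
  D(f) with \<open>f\<close> a unit, and freeness over the localization at a unit is freeness over
  the ring.\<close>

lemma free_of_locally_free:
  assumes "locally_free_finite_type R M"
    and loc: "\<And>S. finite S \<Longrightarrow> S \<subseteq> carrier R \<Longrightarrow> Idl S = carrier R \<Longrightarrow> S \<inter> Units R \<noteq> {}"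
  shows "free_finite_rank R M"
  using assms(1) free_localization_iff unfolding locally_free_finite_type_def
  by (metis disjoint_iff loc)

end


section \<open>Complete discretely valued fields and the ring $\mathcal{C}_K$\<close>

text \<open>\<open>power_q_add\<close> records what the field of q elements contributes: the q-th
  power map is additive, so that Frobenius is a ring endomorphism. It will come from
  \<open>finite_field_power_add\<close>.\<close>

locale complete_valued_field =
  fixes q :: nat and v :: "'k::field \<Rightarrow> int"
  assumes q_ge_2: "q \<ge> 2"
    and valuation: "discrete_valuation v"
    and complete: "valuation_complete q v"
    and power_q_add: "\<And>x y :: 'k. (x + y) ^ q = x ^ q + y ^ q"
begin

abbreviation nrm :: "'k \<Rightarrow> real" where "nrm \<equiv> vabs q v"

lemma v_mult: "x \<noteq> 0 \<Longrightarrow> y \<noteq> 0 \<Longrightarrow> v (x * y) = v x + v y"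
  and v_add: "x \<noteq> 0 \<Longrightarrow> y \<noteq> 0 \<Longrightarrow> x + y \<noteq> 0 \<Longrightarrow> v (x + y) \<ge> min (v x) (v y)"
  using valuation unfolding discrete_valuation_def by blast+

lemma v_one [simp]: "v 1 = 0"
  using v_mult[of 1 1] by simp

lemma q_pos: "q > 0" "real q > 1" using q_ge_2 by auto

lemma nrm_zero [simp]: "nrm 0 = 0"
  by (simp add: vabs_def)

lemma nrm_one [simp]: "nrm 1 = 1"
  by (simp add: vabs_def)

lemma nrm_nonneg [simp]: "nrm x \<ge> 0"
  by (simp add: vabs_def)

lemma nrm_eq_0 [simp]: "nrm x = 0 \<longleftrightarrow> x = 0"
  using q_pos by (simp add: vabs_def)

lemma nrm_mult: "nrm (x * y) = nrm x * nrm y"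
proof (cases "x = 0 \<or> y = 0")
  case False
  have "real q powi (- v x + - v y) = real q powi (- v x) * real q powi (- v y)"
    by (rule power_int_add) (use q_pos in auto)
  then show ?thesis using False by (simp add: vabs_def v_mult)
qed auto

lemma nrm_power: "nrm (x ^ n) = nrm x ^ n"
  by (induction n) (simp_all add: nrm_mult)

lemma nrm_minus [simp]: "nrm (- x) = nrm x"
proof -
  have "nrm (- 1) ^ 2 = 1" using nrm_mult[of "-1" "-1"] by (simp add: power2_eq_square)
  then have "nrm (- 1) = 1" using nrm_nonneg[of "-1"] by (simp add: power2_eq_1_iff)
  then show ?thesis using nrm_mult[of "-1" x] by simp
qed

lemma nrm_diff_commute: "nrm (x - y) = nrm (y - x)"
  using nrm_minus[of "x - y"] by simp

lemma nrm_le_iff: "nrm x \<le> real q powi (- a) \<longleftrightarrow> x = 0 \<or> v x \<ge> a"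
proof (cases "x = 0")
  case False
  have "real q powi (- v x) \<le> real q powi (- a) \<longleftrightarrow> - v x \<le> - a"
    using power_int_increasing[of "- v x" "- a" "real q"]
      power_int_strict_increasing[of "- a" "- v x" "real q"] q_pos by linarith
  then show ?thesis using False by (simp add: vabs_def del: power_int_minus)
qed (use q_pos in simp)

lemma nrm_le_1_iff: "nrm x \<le> 1 \<longleftrightarrow> x \<in> valuation_integers v"
  using nrm_le_iff[of x 0] by (simp add: valuation_integers_def)

lemma nrm_add_le: "nrm (x + y) \<le> max (nrm x) (nrm y)"
proof (cases "x = 0 \<or> y = 0 \<or> x + y = 0")
  case True
  then show ?thesis by (auto simp: max_def)
next
  case False
  then have "v (x + y) \<ge> min (v x) (v y)" using v_add by blast
  then have "- v (x + y) \<le> - v x \<or> - v (x + y) \<le> - v y" by linarith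
  then have "real q powi (- v (x + y)) \<le> real q powi (- v x) \<or> real q powi (- v (x + y)) \<le> real q powi (- v y)"
    using q_pos by (meson power_int_increasing less_imp_le)
  then show ?thesis using False by (auto simp: vabs_def)
qed

lemma nrm_add_less: "nrm x < d \<Longrightarrow> nrm y < d \<Longrightarrow> nrm (x + y) < d"
  using nrm_add_le[of x y] by linarith

lemma nrm_diff_less: "nrm x < d \<Longrightarrow> nrm y < d \<Longrightarrow> nrm (x - y) < d"
  using nrm_add_less[of x d "- y"] by simp

lemma nrm_sum_less:
  assumes "0 < d" "\<And>i. i \<in> I \<Longrightarrow> nrm (f i) < d"
  shows "nrm (sum f I) < d"
  using assms(2) by (induction I rule: infinite_finite_induct) (auto simp: assms(1) nrm_add_less)

sublocale V: Metric_space UNIV "vdist q v"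
proof
  fix x y z :: 'k
  have "nrm (x - z) \<le> max (nrm (x - y)) (nrm (y - z))" using nrm_add_le[of "x - y" "y - z"] by simp
  then show "vdist q v x z \<le> vdist q v x y + vdist q v y z"
    unfolding vdist_def using nrm_nonneg[of "x - y"] nrm_nonneg[of "y - z"] by linarith
  show "vdist q v x y = vdist q v y x" unfolding vdist_def by (rule nrm_diff_commute)
qed (simp_all add: vdist_def)

section \<open>Unconditional sums in a complete ultrametric field\<close>

definition null_family :: "('i \<Rightarrow> real) \<Rightarrow> bool" where
  "null_family f \<longleftrightarrow> (\<forall>d>0. finite {i. d \<le> f i})"

text \<open>Unconditional summability in the nonarchimedean sense; unlike \<^const>\<open>vsum\<close> it is available for every index
  type, so double sums can be interchanged (\<open>vsums_iterated\<close>).\<close>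

definition vsums :: "('i \<Rightarrow> 'k) \<Rightarrow> 'k \<Rightarrow> bool" where
  "vsums f s \<longleftrightarrow> null_family (\<lambda>i. nrm (f i)) \<and>
     (\<forall>d>0. \<exists>F. finite F \<and> (\<forall>G. finite G \<longrightarrow> F \<subseteq> G \<longrightarrow> nrm (sum f G - s) < d))"

lemma vsums_null: "vsums f s \<Longrightarrow> null_family (\<lambda>i. nrm (f i))"
  by (simp add: vsums_def)

text \<open>By the ultrametric inequality, terms below \<open>d\<close> outside \<open>G\<close>
  cannot add up to \<open>d\<close>: the truncation error is controlled term by term.\<close>

lemma vsums_tail:
  assumes "vsums f s" "finite G" "0 < d" "\<And>i. i \<notin> G \<Longrightarrow> nrm (f i) < d"
  shows "nrm (sum f G - s) < d"
proof -
  obtain F where F: "finite F" "\<And>G. finite G \<Longrightarrow> F \<subseteq> G \<Longrightarrow> nrm (sum f G - s) < d"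
    using assms(1,3) unfolding vsums_def by blast
  have "nrm (sum f (F \<union> G) - s) < d" using F assms(2) by auto
  moreover have "nrm (sum f (F - G)) < d" by (rule nrm_sum_less) (use assms in auto)
  moreover have "sum f (F \<union> G) = sum f G + sum f (F - G)"
    using F(1) assms(2) by (metis Un_Diff_cancel Un_commute sum.union_disjoint Diff_disjoint finite_Diff)
  then have "sum f G - s = (sum f (F \<union> G) - s) - sum f (F - G)" by simp
  ultimately show ?thesis using nrm_diff_less by metis
qed

text \<open>Otherwise truncation to the empty set, with \<open>nrm s\<close> as tolerance, would
  give \<open>nrm s < nrm s\<close>.\<close>

lemma vsums_le:
  assumes "vsums f s" "0 \<le> d" "\<And>i. nrm (f i) \<le> d"
  shows "nrm s \<le> d"
proof (rule ccontr)
  assume n: "\<not> nrm s \<le> d"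
  then have "nrm (sum f {} - s) < nrm s"
  proof (intro vsums_tail[OF assms(1)])
    show "nrm (f i) < nrm s" for i using n assms(3)[of i] by linarith
  qed (use n assms(2) in auto)
  then show False by simp
qed

lemma vsums_unique:
  assumes "vsums f s" "vsums f t" shows "s = t"
proof (rule ccontr)
  assume "s \<noteq> t"
  then have "nrm (s - t) \<noteq> 0" by simp
  then have d: "0 < nrm (s - t)" using nrm_nonneg[of "s - t"] by linarith
  have fin: "finite {i. nrm (s - t) \<le> nrm (f i)}" using vsums_null[OF assms(1)] d by (simp add: null_family_def)
  let ?G = "{i. nrm (s - t) \<le> nrm (f i)}"
  have "nrm (sum f ?G - s) < nrm (s - t)" by (rule vsums_tail[OF assms(1) fin d]) auto
  moreover have "nrm (sum f ?G - t) < nrm (s - t)" by (rule vsums_tail[OF assms(2) fin d]) auto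
  ultimately have "nrm ((sum f ?G - t) - (sum f ?G - s)) < nrm (s - t)" by (metis nrm_diff_less)
  then show False by simp
qed

text \<open>The sums over the finite sets of terms of norm at least 1/(n+1) form a Cauchy sequence,
  since enlarging such a set only adds terms below 1/(n+1). Completeness yields the limit, and the
  same estimate makes it the unconditional sum.\<close>

lemma vsums_exists:
  assumes "null_family (\<lambda>i. nrm (f i))" shows "\<exists>s. vsums f s"
proof -
  define F where "F = (\<lambda>n::nat. {i. inverse (real (Suc n)) \<le> nrm (f i)})"
  have F: "finite (F n)" for n using assms unfolding null_family_def F_def by simp
  have close: "nrm (sum f G - sum f (F n)) < inverse (real (Suc n))" if "finite G" "F n \<subseteq> G" for G n
  proof -
    have "sum f G - sum f (F n) = sum f (G - F n)" using that by (simp add: sum_diff)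
    moreover have "nrm (sum f (G - F n)) < inverse (real (Suc n))"
      by (rule nrm_sum_less) (auto simp: F_def)
    ultimately show ?thesis by simp
  qed
  have mono: "F n \<subseteq> F m" if "n \<le> m" for n m
  proof -
    have "inverse (real (Suc m)) \<le> inverse (real (Suc n))" using that by simp
    then show ?thesis unfolding F_def using order_trans by blast
  qed
  have "V.MCauchy (\<lambda>n. sum f (F n))"
    unfolding V.MCauchy_def
  proof (intro conjI allI impI)
    fix d :: real assume "d > 0"
    then obtain N where N: "inverse (real (Suc N)) < d" using reals_Archimedean by blast
    show "\<exists>N. \<forall>n n'. N \<le> n \<longrightarrow> N \<le> n' \<longrightarrow> vdist q v (sum f (F n)) (sum f (F n')) < d"
    proof (intro exI allI impI)
      fix n n' assume "N \<le> n" "N \<le> n'"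
      then have "nrm (sum f (F n) - sum f (F N)) < inverse (real (Suc N))"
        "nrm (sum f (F n') - sum f (F N)) < inverse (real (Suc N))" using close F mono by blast+
      then have "nrm ((sum f (F n) - sum f (F N)) - (sum f (F n') - sum f (F N))) < inverse (real (Suc N))"
        by (rule nrm_diff_less)
      then show "vdist q v (sum f (F n)) (sum f (F n')) < d" using N by (simp add: vdist_def)
    qed
  qed simp
  then obtain s where "limitin V.mtopology (\<lambda>n. sum f (F n)) s sequentially"
    using complete unfolding valuation_complete_def V.mcomplete_def by blast
  then have s: "\<forall>\<^sub>F n in sequentially. nrm (sum f (F n) - s) < d" if "d > 0" for d
    using that by (simp add: V.limitin_metric vdist_def)
  have "vsums f s"
    unfolding vsums_def
  proof (intro conjI allI impI assms)
    fix d :: real assume d: "d > 0"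
    then obtain N where N: "inverse (real (Suc N)) < d" using reals_Archimedean by blast
    from s[OF d] obtain M where M: "\<And>n. n \<ge> M \<Longrightarrow> nrm (sum f (F n) - s) < d"
      by (auto simp: eventually_sequentially)
    let ?m = "max M N"
    show "\<exists>F. finite F \<and> (\<forall>G. finite G \<longrightarrow> F \<subseteq> G \<longrightarrow> nrm (sum f G - s) < d)"
    proof (intro exI[of _ "F ?m"] conjI allI impI F)
      fix G assume G: "finite G" "F ?m \<subseteq> G"
      have "inverse (real (Suc ?m)) \<le> inverse (real (Suc N))" by simp
      then have "nrm (sum f G - sum f (F ?m)) < d" using close[OF G] N by linarith
      moreover have "nrm (sum f (F ?m) - s) < d" using M by simp
      ultimately have "nrm ((sum f G - sum f (F ?m)) + (sum f (F ?m) - s)) < d" by (rule nrm_add_less)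
      then show "nrm (sum f G - s) < d" by simp
    qed
  qed
  then show ?thesis ..
qed

lemma vsum_eq:
  assumes "vsums f s" shows "vsum q v f = s"
proof -
  have "limitin V.mtopology (sum f) s (finite_subsets_at_top UNIV)"
    unfolding V.limitin_metric
  proof (intro conjI allI impI)
    fix d :: real assume "d > 0"
    then obtain F where "finite F" "\<And>G. finite G \<Longrightarrow> F \<subseteq> G \<Longrightarrow> nrm (sum f G - s) < d"
      using assms unfolding vsums_def by blast
    then show "\<forall>\<^sub>F x in finite_subsets_at_top UNIV. sum f x \<in> UNIV \<and> vdist q v (sum f x) s < d"
      unfolding eventually_finite_subsets_at_top vdist_def by (intro exI[of _ F]) auto
  qed simp
  then show ?thesis
    unfolding vsum_def
  proof (rule the_equality)
    fix t assume "limitin V.mtopology (sum f) t (finite_subsets_at_top UNIV)"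
    then show "t = s"
      by (rule V.limitin_metric_unique) (fact, rule finite_subsets_at_top_neq_bot)
  qed
qed

lemma vsums_vsum: "null_family (\<lambda>i. nrm (f i)) \<Longrightarrow> vsums f (vsum q v f)"
  using vsums_exists vsum_eq by metis

lemma null_family_subset:
  assumes "null_family f" "\<And>i. g i \<le> f i" shows "null_family g"
  unfolding null_family_def
proof (intro allI impI)
  fix d :: real assume "d > 0"
  then have "finite {i. d \<le> f i}" using assms(1) by (simp add: null_family_def)
  then show "finite {i. d \<le> g i}" by (rule rev_finite_subset) (use assms(2) in \<open>auto intro: order_trans\<close>)
qed

lemma vsums_add:
  assumes "vsums f s" "vsums g t" shows "vsums (\<lambda>i. f i + g i) (s + t)"
  unfolding vsums_def
proof (intro conjI allI impI)
  show "null_family (\<lambda>i. nrm (f i + g i))"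
    unfolding null_family_def
  proof (intro allI impI)
    fix d :: real assume "d > 0"
    then have "finite ({i. d \<le> nrm (f i)} \<union> {i. d \<le> nrm (g i)})"
      using assms by (simp add: vsums_def null_family_def)
    then show "finite {i. d \<le> nrm (f i + g i)}"
      by (rule rev_finite_subset) (use nrm_add_less in \<open>force simp: not_less[symmetric]\<close>)
  qed
  fix d :: real assume d: "d > 0"
  obtain F where F: "finite F" "\<And>G. finite G \<Longrightarrow> F \<subseteq> G \<Longrightarrow> nrm (sum f G - s) < d"
    using assms(1) d unfolding vsums_def by blast
  obtain F' where F': "finite F'" "\<And>G. finite G \<Longrightarrow> F' \<subseteq> G \<Longrightarrow> nrm (sum g G - t) < d"
    using assms(2) d unfolding vsums_def by blast
  show "\<exists>F. finite F \<and> (\<forall>G. finite G \<longrightarrow> F \<subseteq> G \<longrightarrow> nrm ((\<Sum>i\<in>G. f i + g i) - (s + t)) < d)"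
  proof (intro exI[of _ "F \<union> F'"] conjI allI impI)
    fix G assume "finite G" "F \<union> F' \<subseteq> G"
    then have "nrm ((sum f G - s) + (sum g G - t)) < d" by (intro nrm_add_less F F') auto
    then show "nrm ((\<Sum>i\<in>G. f i + g i) - (s + t)) < d" by (simp add: sum.distrib algebra_simps)
  qed (use F F' in simp)
qed

lemma vsums_finite:
  assumes "finite I" "\<And>i. i \<notin> I \<Longrightarrow> f i = 0"
  shows "vsums f (sum f I)"
  unfolding vsums_def
proof (intro conjI allI impI)
  show "null_family (\<lambda>i. nrm (f i))"
    unfolding null_family_def
  proof (intro allI impI)
    fix d :: real assume "d > 0"
    show "finite {i. d \<le> nrm (f i)}"
      by (rule finite_subset[OF _ assms(1)]) (use assms(2) \<open>d > 0\<close> in \<open>fastforce\<close>)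
  qed
  fix d :: real assume "d > 0"
  show "\<exists>F. finite F \<and> (\<forall>G. finite G \<longrightarrow> F \<subseteq> G \<longrightarrow> nrm (sum f G - sum f I) < d)"
  proof (intro exI[of _ I] conjI allI impI assms(1))
    fix G assume "finite G" "I \<subseteq> G"
    then have "sum f G = sum f I" using assms(2) by (intro sum.mono_neutral_right) auto
    then show "nrm (sum f G - sum f I) < d" using \<open>d > 0\<close> by simp
  qed
qed

lemma vsums_reindex:
  assumes "vsums f s" "bij h" shows "vsums (\<lambda>i. f (h i)) s"
  unfolding vsums_def
proof (intro conjI allI impI)
  show "null_family (\<lambda>i. nrm (f (h i)))"
    unfolding null_family_def
  proof (intro allI impI)
    fix d :: real assume "d > 0"
    then have "finite (h -` {i. d \<le> nrm (f i)})"
      using assms by (intro finite_vimageI) (auto simp: vsums_def null_family_def bij_def)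
    then show "finite {i. d \<le> nrm (f (h i))}" by (simp add: vimage_def)
  qed
  fix d :: real assume "d > 0"
  then obtain F where F: "finite F" "\<And>G. finite G \<Longrightarrow> F \<subseteq> G \<Longrightarrow> nrm (sum f G - s) < d"
    using assms(1) unfolding vsums_def by blast
  show "\<exists>F. finite F \<and> (\<forall>G. finite G \<longrightarrow> F \<subseteq> G \<longrightarrow> nrm ((\<Sum>i\<in>G. f (h i)) - s) < d)"
  proof (intro exI[of _ "h -` F"] conjI allI impI)
    show "finite (h -` F)" using F(1) assms(2) by (intro finite_vimageI) (auto simp: bij_def)
    fix G assume G: "finite G" "h -` F \<subseteq> G"
    have "F \<subseteq> h ` G"
    proof
      fix x assume "x \<in> F"
      obtain y where "x = h y" using assms(2) by (meson bij_pointE)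
      then show "x \<in> h ` G" using G(2) \<open>x \<in> F\<close> by blast
    qed
    then have "nrm (sum f (h ` G) - s) < d" using F(2) G(1) by simp
    moreover have "sum f (h ` G) = (\<Sum>i\<in>G. f (h i))"
      using assms(2) by (subst sum.reindex) (auto simp: bij_def intro: inj_on_subset)
    ultimately show "nrm ((\<Sum>i\<in>G. f (h i)) - s) < d" by simp
  qed
qed

text \<open>The finite set of index pairs with norm at least \<open>d\<close> is sliced along its
  first coordinate. The sum over it differs by less than \<open>d\<close> both from \<open>s\<close>
  and from every finite sum of \<open>g\<close> over a set containing the projection.\<close>

lemma vsums_iterated:
  assumes "vsums f s" "\<And>i. vsums (\<lambda>j. f (i, j)) (g i)"
  shows "vsums g s"
proof -
  let ?P = "\<lambda>d. {p. d \<le> nrm (f p)}"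
  have P: "finite (?P d)" if "d > 0" for d using vsums_null[OF assms(1)] that by (simp add: null_family_def)
  have null: "null_family (\<lambda>i. nrm (g i))"
    unfolding null_family_def
  proof (intro allI impI)
    fix d :: real assume d: "d > 0"
    have "{i. d \<le> nrm (g i)} \<subseteq> fst ` ?P d"
    proof
      fix i assume i: "i \<in> {i. d \<le> nrm (g i)}"
      show "i \<in> fst ` ?P d"
      proof (rule ccontr)
        assume n: "i \<notin> fst ` ?P d"
        have "nrm (sum (\<lambda>j. f (i, j)) {} - g i) < d"
          by (rule vsums_tail[OF assms(2)]) (use n d in \<open>force simp: not_le[symmetric] image_iff\<close>)+
        then show False using i by simp
      qed
    qed
    then show "finite {i. d \<le> nrm (g i)}" using P[OF d] finite_surj by blast
  qed
  show ?thesis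
    unfolding vsums_def
  proof (intro conjI allI impI null)
    fix d :: real assume d: "d > 0"
    show "\<exists>F. finite F \<and> (\<forall>G. finite G \<longrightarrow> F \<subseteq> G \<longrightarrow> nrm (sum g G - s) < d)"
    proof (intro exI[of _ "fst ` ?P d"] conjI allI impI)
      fix G assume G: "finite G" "fst ` ?P d \<subseteq> G"
      have slice: "finite {j. d \<le> nrm (f (i, j))}" for i
        using vsums_null[OF assms(2)[of i]] d by (simp add: null_family_def)
      have "?P d = (SIGMA i:G. {j. d \<le> nrm (f (i, j))})" using G(2) by force
      then have "sum f (?P d) = (\<Sum>i\<in>G. \<Sum>j\<in>{j. d \<le> nrm (f (i, j))}. f (i, j))"
        using G(1) slice by (simp add: sum.Sigma)
      then have "sum f (?P d) - sum g G = (\<Sum>i\<in>G. (\<Sum>j\<in>{j. d \<le> nrm (f (i, j))}. f (i, j)) - g i)"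
        by (simp add: sum_subtractf)
      also have "nrm \<dots> < d"
        by (intro nrm_sum_less[OF d] vsums_tail[OF assms(2) slice d]) auto
      finally have "nrm (sum f (?P d) - sum g G) < d" .
      moreover have "nrm (sum f (?P d) - s) < d"
        by (rule vsums_tail[OF assms(1) P[OF d] d]) auto
      ultimately have "nrm ((sum f (?P d) - s) - (sum f (?P d) - sum g G)) < d" by (metis nrm_diff_less)
      then show "nrm (sum g G - s) < d" by simp
    qed (use P[OF d] in simp)
  qed
qed

lemma power_q_sum: "(\<Sum>i\<in>I. f i :: 'k) ^ q = (\<Sum>i\<in>I. f i ^ q)"
  using q_pos by (induction I rule: infinite_finite_induct) (simp_all add: power_q_add)

lemma power_q_diff: "(x - y :: 'k) ^ q = x ^ q - y ^ q"
  using power_q_add[of "x - y" y] by simp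

lemma root_exists: "d > 0 \<Longrightarrow> \<exists>e>0. e ^ q = (d::real)"
  using q_pos by (intro exI[of _ "root q d"]) simp

text \<open>Additivity of the q-th power turns the error of the new sum into the q-th power of the
  old error; \<open>e\<close> is the q-th root of the tolerance.\<close>

lemma vsums_power_q:
  assumes "vsums f s" shows "vsums (\<lambda>i. f i ^ q) (s ^ q)"
  unfolding vsums_def
proof (intro conjI allI impI)
  show "null_family (\<lambda>i. nrm (f i ^ q))"
    unfolding null_family_def
  proof (intro allI impI)
    fix d :: real assume "d > 0"
    then obtain e where e: "e > 0" "e ^ q = d" using root_exists by blast
    have "d \<le> nrm (f i ^ q) \<longleftrightarrow> e \<le> nrm (f i)" for i
      unfolding e(2)[symmetric] nrm_power using e(1) q_pos by (intro power_mono_iff) auto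
    then show "finite {i. d \<le> nrm (f i ^ q)}" using vsums_null[OF assms] e(1) by (simp add: null_family_def)
  qed
  fix d :: real assume "d > 0"
  then obtain e where e: "e > 0" "e ^ q = d" using root_exists by blast
  obtain F where F: "finite F" "\<And>G. finite G \<Longrightarrow> F \<subseteq> G \<Longrightarrow> nrm (sum f G - s) < e"
    using assms e(1) unfolding vsums_def by blast
  have "nrm ((\<Sum>i\<in>G. f i ^ q) - s ^ q) < d" if "finite G" "F \<subseteq> G" for G
  proof -
    have "(\<Sum>i\<in>G. f i ^ q) - s ^ q = (sum f G - s) ^ q" by (simp add: power_q_sum power_q_diff)
    then show ?thesis using F(2)[OF that] e q_pos by (simp add: nrm_power power_strict_mono flip: e(2))
  qed
  then show "\<exists>F. finite F \<and> (\<forall>G. finite G \<longrightarrow> F \<subseteq> G \<longrightarrow> nrm ((\<Sum>i\<in>G. f i ^ q) - s ^ q) < d)"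
    using F(1) by blast
qed

section \<open>The commutative ring structure of C_K and its Frobenius\<close>

abbreviation CK :: "(int \<Rightarrow> 'k) ring" where "CK \<equiv> disc_ring q v"

abbreviation CK_mult (infixl "\<star>" 70) where "\<alpha> \<star> \<beta> \<equiv> \<alpha> \<otimes>\<^bsub>CK\<^esub> \<beta>"

text \<open>Translates the two limits in \<open>disc_ring\<close> into a notion that also applies to
  families of pairs and triples, namely convergence to 0 along cofinite sets.\<close>

lemma null_family_int_iff:
  fixes f :: "int \<Rightarrow> real"
  assumes "\<And>n. f n \<ge> 0"
  shows "null_family f \<longleftrightarrow> (f \<longlongrightarrow> 0) at_top \<and> (f \<longlongrightarrow> 0) at_bot"
proof
  assume n: "null_family f"
  have "\<exists>N. \<forall>n. N < \<bar>n\<bar> \<longrightarrow> f n < d" if "d > 0" for d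
  proof -
    have fin: "finite {n. d \<le> f n}" using n that by (simp add: null_family_def)
    \<comment> \<open>A finite set of integers is bounded by the sum of the absolute values of its
      members.\<close>
    have "\<bar>n\<bar> \<le> (\<Sum>n\<in>{n. d \<le> f n}. \<bar>n\<bar>)" if "d \<le> f n" for n
      using that by (intro member_le_sum[OF _ _ fin, of n "\<lambda>n. \<bar>n\<bar>"]) auto
    then show ?thesis by (meson not_le)
  qed note * = this
  show "(f \<longlongrightarrow> 0) at_top \<and> (f \<longlongrightarrow> 0) at_bot"
  proof (intro conjI tendstoI)
    fix d :: real assume "d > 0"
    then obtain N where N: "\<forall>n. N < \<bar>n\<bar> \<longrightarrow> f n < d" using * by blast
    then have "\<forall>n\<ge>\<bar>N\<bar> + 1. dist (f n) 0 < d" using assms by (auto simp: dist_real_def)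
    then show "\<forall>\<^sub>F n in at_top. dist (f n) 0 < d" unfolding eventually_at_top_linorder by blast
    have "\<forall>n\<le>- \<bar>N\<bar> - 1. dist (f n) 0 < d" using N assms by (auto simp: dist_real_def)
    then show "\<forall>\<^sub>F n in at_bot. dist (f n) 0 < d" unfolding eventually_at_bot_linorder by blast
  qed
next
  assume l: "(f \<longlongrightarrow> 0) at_top \<and> (f \<longlongrightarrow> 0) at_bot"
  show "null_family f"
    unfolding null_family_def
  proof (intro allI impI)
    fix d :: real assume "d > 0"
    then have "\<forall>\<^sub>F n in at_top. dist (f n) 0 < d" "\<forall>\<^sub>F n in at_bot. dist (f n) 0 < d"
      using l tendstoD by blast+
    then obtain N M where "\<forall>n\<ge>N. dist (f n) 0 < d" "\<forall>n\<le>M. dist (f n) 0 < d"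
      unfolding eventually_at_top_linorder eventually_at_bot_linorder by blast
    then have "n \<le> N \<and> M \<le> n" if "d \<le> f n" for n
      using that assms[of n] by (cases "n \<ge> N"; cases "n \<le> M") (fastforce simp: dist_real_def)+
    then have "{n. d \<le> f n} \<subseteq> {M..N}" by auto
    then show "finite {n. d \<le> f n}" using finite_subset by blast
  qed
qed

lemma CK_iff: "\<alpha> \<in> carrier CK \<longleftrightarrow> (\<forall>\<epsilon>. 0 < \<epsilon> \<and> \<epsilon> < 1 \<longrightarrow> null_family (\<lambda>n. nrm (\<alpha> n) * \<epsilon> powi n))"
proof -
  have "null_family (\<lambda>n. nrm (\<alpha> n) * \<epsilon> powi n) \<longleftrightarrow>
    ((\<lambda>n. nrm (\<alpha> n) * \<epsilon> powi n) \<longlongrightarrow> 0) at_top \<and> ((\<lambda>n. nrm (\<alpha> n) * \<epsilon> powi n) \<longlongrightarrow> 0) at_bot" if "0 < \<epsilon>" for \<epsilon> :: real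
    using that by (intro null_family_int_iff) simp
  then show ?thesis unfolding disc_ring_def by simp
qed

lemma null_familyD: "null_family f \<Longrightarrow> 0 < d \<Longrightarrow> finite {i. d \<le> f i}"
  by (simp add: null_family_def)

lemma null_familyI: "(\<And>d. 0 < d \<Longrightarrow> finite {i. d \<le> f i}) \<Longrightarrow> null_family f"
  by (simp add: null_family_def)

lemma null_family_bounded:
  assumes "null_family f" shows "\<exists>c>0. \<forall>i. f i \<le> c"
proof (intro exI conjI allI)
  have fin: "finite {i. 1 \<le> f i}" using assms by (simp add: null_family_def)
  show "0 < 1 + (\<Sum>i\<in>{i. 1 \<le> f i}. \<bar>f i\<bar>)" by (intro add_pos_nonneg sum_nonneg) auto
  fix i
  show "f i \<le> 1 + (\<Sum>i\<in>{i. 1 \<le> f i}. \<bar>f i\<bar>)"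
  proof (cases "1 \<le> f i")
    case True
    then have "\<bar>f i\<bar> \<le> (\<Sum>i\<in>{i. 1 \<le> f i}. \<bar>f i\<bar>)"
      by (intro member_le_sum[OF _ _ fin, of i "\<lambda>i. \<bar>f i\<bar>"]) auto
    then show ?thesis by linarith
  next
    case False
    have "0 \<le> (\<Sum>i\<in>{i. 1 \<le> f i}. \<bar>f i\<bar>)" by (intro sum_nonneg) auto
    then show ?thesis using False by linarith
  qed
qed

text \<open>Both factors are bounded, by \<open>b\<close> and \<open>c\<close>, so a product of size
  at least \<open>d\<close> forces \<open>f i >= d / c\<close> and \<open>g j >= d / b\<close>:
  finitely many pairs.\<close>

lemma null_family_mult:
  assumes f: "null_family f" "\<And>i. 0 \<le> f i" and g: "null_family g" "\<And>i. 0 \<le> g i"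
  shows "null_family (\<lambda>(i, j). f i * g j)"
proof (rule null_familyI)
  fix d :: real assume d: "d > 0"
  obtain b where b: "b > 0" "\<And>i. f i \<le> b" using null_family_bounded[OF f(1)] by blast
  obtain c where c: "c > 0" "\<And>i. g i \<le> c" using null_family_bounded[OF g(1)] by blast
  have "d / c \<le> f i \<and> d / b \<le> g j" if "d \<le> f i * g j" for i j
  proof -
    have "f i * g j \<le> f i * c" "f i * g j \<le> b * g j"
      using b c f(2) g(2) by (simp_all add: mult_left_mono mult_right_mono)
    then show ?thesis using that b(1) c(1) by (simp add: field_simps)
  qed
  then have "{p. d \<le> (case p of (i, j) \<Rightarrow> f i * g j)} \<subseteq> {i. d / c \<le> f i} \<times> {j. d / b \<le> g j}" by auto
  then show "finite {p. d \<le> (case p of (i, j) \<Rightarrow> f i * g j)}"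
    using null_familyD[OF f(1), of "d / c"] null_familyD[OF g(1), of "d / b"] b(1) c(1) d
    by (meson divide_pos_pos finite_SigmaI finite_subset)
qed

lemma null_family_inj:
  assumes "null_family f" "inj h" shows "null_family (\<lambda>i. f (h i))"
proof (rule null_familyI)
  fix d :: real assume "d > 0"
  then have "finite (h -` {i. d \<le> f i})" using assms by (intro finite_vimageI null_familyD)
  then show "finite {i. d \<le> f (h i)}" by (simp add: vimage_def)
qed

lemma null_family_cmult:
  assumes "null_family f" "0 < c" shows "null_family (\<lambda>i. c * f i)"
proof (rule null_familyI)
  fix d :: real assume "d > 0"
  have "d \<le> c * f i \<longleftrightarrow> d / c \<le> f i" for i using assms(2) by (simp add: field_simps)
  then show "finite {i. d \<le> c * f i}" using null_familyD[OF assms(1), of "d / c"] \<open>d > 0\<close> assms(2) by simp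
qed

lemma vsums_cmult:
  assumes "vsums f s" shows "vsums (\<lambda>i. c * f i) (c * s)"
proof (cases "c = 0")
  case True
  then show ?thesis using vsums_finite[of "{}" "\<lambda>i. c * f i"] by simp
next
  case False
  then have c: "0 < nrm c" using nrm_nonneg[of c] nrm_eq_0[of c] by (metis less_eq_real_def)
  show ?thesis
    unfolding vsums_def
  proof (intro conjI allI impI)
    show "null_family (\<lambda>i. nrm (c * f i))"
      unfolding nrm_mult using null_family_cmult[OF vsums_null[OF assms] c] .
    fix d :: real assume "d > 0"
    then have "d / nrm c > 0" using c by simp
    then obtain F where F: "finite F" "\<And>G. finite G \<Longrightarrow> F \<subseteq> G \<Longrightarrow> nrm (sum f G - s) < d / nrm c"
      using assms unfolding vsums_def by blast
    have "nrm ((\<Sum>i\<in>G. c * f i) - c * s) < d" if "finite G" "F \<subseteq> G" for G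
    proof -
      have eq: "(\<Sum>i\<in>G. c * f i) - c * s = c * (sum f G - s)" by (simp add: sum_distrib_left right_diff_distrib)
      have "nrm c * nrm (sum f G - s) < d" using F(2)[OF that] c by (simp add: field_simps)
      then show ?thesis unfolding eq nrm_mult .
    qed
    then show "\<exists>F. finite F \<and> (\<forall>G. finite G \<longrightarrow> F \<subseteq> G \<longrightarrow> nrm ((\<Sum>i\<in>G. c * f i) - c * s) < d)"
      using F(1) by blast
  qed
qed

text \<open>The size of the n-th term on the circle of radius \<open>\<epsilon>\<close>: the bare
  coefficients need not tend to 0, the weighted ones do, and weights still multiply under
  convolution (\<open>nrm_conv_term\<close>).\<close>

definition wt :: "real \<Rightarrow> (int \<Rightarrow> 'k) \<Rightarrow> int \<Rightarrow> real" where
  "wt \<epsilon> \<alpha> n = nrm (\<alpha> n) * \<epsilon> powi n"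

lemma wt_nonneg: "0 < \<epsilon> \<Longrightarrow> 0 \<le> wt \<epsilon> \<alpha> n"
  by (simp add: wt_def)

lemma CK_wt: "\<alpha> \<in> carrier CK \<Longrightarrow> 0 < \<epsilon> \<Longrightarrow> \<epsilon> < 1 \<Longrightarrow> null_family (wt \<epsilon> \<alpha>)"
  unfolding CK_iff wt_def[abs_def] by blast

lemma CK_I: "(\<And>\<epsilon>. 0 < \<epsilon> \<Longrightarrow> \<epsilon> < 1 \<Longrightarrow> null_family (wt \<epsilon> \<alpha>)) \<Longrightarrow> \<alpha> \<in> carrier CK"
  unfolding CK_iff wt_def[abs_def] by blast

lemma nrm_conv_term:
  assumes "0 < \<epsilon>"
  shows "nrm (\<alpha> i * \<beta> (n - i)) * \<epsilon> powi n = wt \<epsilon> \<alpha> i * wt \<epsilon> \<beta> (n - i)"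
proof -
  have "\<epsilon> powi n = \<epsilon> powi i * \<epsilon> powi (n - i)"
    using power_int_add[of \<epsilon> i "n - i"] assms by simp
  then show ?thesis by (simp add: wt_def nrm_mult)
qed

text \<open>The null family of products is restricted to the antidiagonal i + j = n, where the
  weight \<epsilon>^n is constant and can be divided out. The radius 1/2 is an arbitrary choice in
  (0, 1).\<close>

lemma conv_vsums:
  assumes "\<alpha> \<in> carrier CK" "\<beta> \<in> carrier CK"
  shows "vsums (\<lambda>i. \<alpha> i * \<beta> (n - i)) ((\<alpha> \<star> \<beta>) n)"
proof -
  let ?e = "1/2 :: real"
  have "null_family (\<lambda>(i, j). wt ?e \<alpha> i * wt ?e \<beta> j)"
    by (intro null_family_mult CK_wt wt_nonneg assms) auto
  then have "null_family (\<lambda>i. case (i, n - i) of (i, j) \<Rightarrow> wt ?e \<alpha> i * wt ?e \<beta> j)"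
    by (rule null_family_inj) (simp add: inj_def)
  then have "null_family (\<lambda>i. (?e powi (- n)) * (wt ?e \<alpha> i * wt ?e \<beta> (n - i)))"
    by (intro null_family_cmult) auto
  also have "(\<lambda>i. (?e powi (- n)) * (wt ?e \<alpha> i * wt ?e \<beta> (n - i))) = (\<lambda>i. nrm (\<alpha> i * \<beta> (n - i)))"
  proof
    fix i
    have "?e powi (- n) * ?e powi n = 1" by (simp add: power_int_minus)
    then show "(?e powi (- n)) * (wt ?e \<alpha> i * wt ?e \<beta> (n - i)) = nrm (\<alpha> i * \<beta> (n - i))"
      unfolding nrm_conv_term[of ?e \<alpha> i \<beta> n, simplified, symmetric]
      by (metis (no_types, lifting) mult.commute mult.left_commute mult.right_neutral)
  qed
  finally show ?thesis unfolding disc_ring_def by (simp add: vsums_vsum)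
qed

text \<open>If every term of the n-th convolution sum has weight below \<open>d\<close>, so has the
  sum; thus the exceptional \<open>n\<close> are sums i + j over the finitely many pairs of weight
  at least \<open>d\<close>.\<close>

lemma CK_mult_closed:
  assumes "\<alpha> \<in> carrier CK" "\<beta> \<in> carrier CK"
  shows "\<alpha> \<star> \<beta> \<in> carrier CK"
proof (rule CK_I, rule null_familyI)
  fix \<epsilon> d :: real assume e: "0 < \<epsilon>" "\<epsilon> < 1" and d: "0 < d"
  have "null_family (\<lambda>(i, j). wt \<epsilon> \<alpha> i * wt \<epsilon> \<beta> j)"
    by (intro null_family_mult CK_wt wt_nonneg assms e)
  then have fin: "finite {p. d \<le> (case p of (i, j) \<Rightarrow> wt \<epsilon> \<alpha> i * wt \<epsilon> \<beta> j)}" (is "finite ?P") using d by (rule null_familyD)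
  have "{n. d \<le> wt \<epsilon> (\<alpha> \<star> \<beta>) n} \<subseteq> (\<lambda>(i, j). i + j) ` ?P"
  proof
    fix n assume n: "n \<in> {n. d \<le> wt \<epsilon> (\<alpha> \<star> \<beta>) n}"
    have en: "\<epsilon> powi n > 0" using e by simp
    show "n \<in> (\<lambda>(i, j). i + j) ` ?P"
    proof (rule ccontr)
      assume "n \<notin> (\<lambda>(i, j). i + j) ` ?P"
      then have "(i, n - i) \<notin> ?P" for i by (force simp: image_iff)
      then have "nrm (\<alpha> i * \<beta> (n - i)) < d / \<epsilon> powi n" for i
        using nrm_conv_term[OF e(1), of \<alpha> i \<beta> n] en by (simp add: field_simps not_le)
      then have "nrm (sum (\<lambda>i. \<alpha> i * \<beta> (n - i)) {} - (\<alpha> \<star> \<beta>) n) < d / \<epsilon> powi n"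
        by (intro vsums_tail[OF conv_vsums[OF assms]]) (use d en in auto)
      then have "wt \<epsilon> (\<alpha> \<star> \<beta>) n < d" using en by (simp add: wt_def field_simps)
      then show False using n by simp
    qed
  qed
  then show "finite {n. d \<le> wt \<epsilon> (\<alpha> \<star> \<beta>) n}" using fin finite_surj by blast
qed

lemma CK_add [simp]: "\<alpha> \<oplus>\<^bsub>CK\<^esub> \<beta> = (\<lambda>n. \<alpha> n + \<beta> n)"
  and CK_zero [simp]: "\<zero>\<^bsub>CK\<^esub> = (\<lambda>n. 0)"
  and CK_one [simp]: "\<one>\<^bsub>CK\<^esub> = (\<lambda>n. if n = 0 then 1 else 0)"
  by (simp_all add: disc_ring_def)

lemma CK_add_closed:
  assumes "\<alpha> \<in> carrier CK" "\<beta> \<in> carrier CK"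
  shows "(\<lambda>n. \<alpha> n + \<beta> n) \<in> carrier CK"
proof (rule CK_I, rule null_familyI)
  fix \<epsilon> d :: real assume e: "0 < \<epsilon>" "\<epsilon> < 1" and d: "0 < d"
  have "d \<le> wt \<epsilon> \<alpha> n \<or> d \<le> wt \<epsilon> \<beta> n" if "d \<le> wt \<epsilon> (\<lambda>n. \<alpha> n + \<beta> n) n" for n
  proof -
    have "\<epsilon> powi n > 0" using e by simp
    moreover have "nrm (\<alpha> n + \<beta> n) \<le> nrm (\<alpha> n) \<or> nrm (\<alpha> n + \<beta> n) \<le> nrm (\<beta> n)"
      using nrm_add_le[of "\<alpha> n" "\<beta> n"] by linarith
    ultimately have "wt \<epsilon> (\<lambda>n. \<alpha> n + \<beta> n) n \<le> wt \<epsilon> \<alpha> n \<or> wt \<epsilon> (\<lambda>n. \<alpha> n + \<beta> n) n \<le> wt \<epsilon> \<beta> n"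
      unfolding wt_def by (auto intro: mult_right_mono)
    then show ?thesis using that by linarith
  qed
  then have "{n. d \<le> wt \<epsilon> (\<lambda>n. \<alpha> n + \<beta> n) n} \<subseteq> {n. d \<le> wt \<epsilon> \<alpha> n} \<union> {n. d \<le> wt \<epsilon> \<beta> n}" by blast
  moreover have "finite \<dots>"
    using null_familyD[OF CK_wt[OF assms(1) e] d] null_familyD[OF CK_wt[OF assms(2) e] d] by simp
  ultimately show "finite {n. d \<le> wt \<epsilon> (\<lambda>n. \<alpha> n + \<beta> n) n}" by (rule finite_subset)
qed

lemma CK_finite_support:
  assumes "finite {n. \<alpha> n \<noteq> 0}" shows "\<alpha> \<in> carrier CK"
proof (rule CK_I, rule null_familyI)
  fix \<epsilon> d :: real assume "0 < d"
  then have "{n. d \<le> wt \<epsilon> \<alpha> n} \<subseteq> {n. \<alpha> n \<noteq> 0}" by (auto simp: wt_def)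
  then show "finite {n. d \<le> wt \<epsilon> \<alpha> n}" using assms by (rule finite_subset)
qed

lemma CK_mult_comm:
  assumes "\<alpha> \<in> carrier CK" "\<beta> \<in> carrier CK"
  shows "\<alpha> \<star> \<beta> = \<beta> \<star> \<alpha>"
proof
  fix n
  have "bij (\<lambda>i. n - i :: int)" by (rule o_bij[of "\<lambda>i. n - i"]) auto
  from vsums_reindex[OF conv_vsums[OF assms, of n] this]
  have "vsums (\<lambda>i. \<beta> i * \<alpha> (n - i)) ((\<alpha> \<star> \<beta>) n)" by (simp add: mult.commute)
  then show "(\<alpha> \<star> \<beta>) n = (\<beta> \<star> \<alpha>) n"
    using conv_vsums[OF assms(2,1), of n] vsums_unique by blast
qed

text \<open>Both sides are iterated sums of one summable family over the triples with i + j + k = n,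
  indexed by (m, i) with m = i + j; its summability again comes from the weights at radius
  1/2.\<close>

lemma CK_mult_assoc:
  assumes a: "\<alpha> \<in> carrier CK" and b: "\<beta> \<in> carrier CK" and c: "\<gamma> \<in> carrier CK"
  shows "(\<alpha> \<star> \<beta>) \<star> \<gamma> = \<alpha> \<star> (\<beta> \<star> \<gamma>)"
proof
  fix n
  let ?f = "\<lambda>(m, i). \<alpha> i * \<beta> (m - i) * \<gamma> (n - m)"
  let ?e = "1/2 :: real"
  have ww: "nrm (\<alpha> i * \<beta> (m - i) * \<gamma> (n - m)) = ?e powi (- n) * (wt ?e \<alpha> i * wt ?e \<beta> (m - i) * wt ?e \<gamma> (n - m))" for m i
  proof -
    have "?e powi i * ?e powi (m - i) * ?e powi (n - m) = ?e powi n"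
      by (simp flip: power_int_add)
    moreover have "?e powi (- n) * ?e powi n = 1" by (simp add: power_int_minus)
    ultimately have "?e powi (- n) * (?e powi i * ?e powi (m - i) * ?e powi (n - m)) = 1" by simp
    then have "nrm (\<alpha> i * \<beta> (m - i) * \<gamma> (n - m)) = nrm (\<alpha> i) * nrm (\<beta> (m - i)) * nrm (\<gamma> (n - m))
        * (?e powi (- n) * (?e powi i * ?e powi (m - i) * ?e powi (n - m)))"
      by (simp only: nrm_mult mult_1_right)
    then show ?thesis unfolding wt_def by (simp only: mult_ac)
  qed
  have "null_family (\<lambda>(p, k). (case p of (i, j) \<Rightarrow> wt ?e \<alpha> i * wt ?e \<beta> j) * wt ?e \<gamma> k)"
    by (intro null_family_mult CK_wt wt_nonneg a b c) (auto simp: wt_nonneg)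
  then have "null_family (\<lambda>x. case (case x of (m, i) \<Rightarrow> ((i, m - i), n - m)) of (p, k) \<Rightarrow> (case p of (i, j) \<Rightarrow> wt ?e \<alpha> i * wt ?e \<beta> j) * wt ?e \<gamma> k)"
    by (rule null_family_inj) (auto simp: inj_def)
  then have "null_family (\<lambda>x. ?e powi (- n) * (case (case x of (m, i) \<Rightarrow> ((i, m - i), n - m)) of (p, k) \<Rightarrow> (case p of (i, j) \<Rightarrow> wt ?e \<alpha> i * wt ?e \<beta> j) * wt ?e \<gamma> k))"
    by (rule null_family_cmult) simp
  then have "null_family (\<lambda>x. nrm (?f x))"
    by (rule null_family_subset) (auto simp: ww)
  then obtain s where s: "vsums ?f s" using vsums_exists by blast
  have "vsums (\<lambda>m. (\<alpha> \<star> \<beta>) m * \<gamma> (n - m)) s"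
  proof (rule vsums_iterated[OF s])
    fix m
    show "vsums (\<lambda>i. ?f (m, i)) ((\<alpha> \<star> \<beta>) m * \<gamma> (n - m))"
      using vsums_cmult[OF conv_vsums[OF a b, of m], of "\<gamma> (n - m)"] by (simp add: mult.commute)
  qed
  then have 1: "((\<alpha> \<star> \<beta>) \<star> \<gamma>) n = s"
    using conv_vsums[OF CK_mult_closed[OF a b] c, of n] vsums_unique by blast
  have "vsums (\<lambda>x. ?f (prod.swap x)) s" using s by (rule vsums_reindex) simp
  then have "vsums (\<lambda>i. \<alpha> i * (\<beta> \<star> \<gamma>) (n - i)) s"
  proof (rule vsums_iterated)
    fix i
    have "bij (\<lambda>m. m - i :: int)" by (rule o_bij[of "\<lambda>m. m + i"]) auto
    from vsums_reindex[OF conv_vsums[OF b c, of "n - i"] this]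
    have "vsums (\<lambda>m. \<beta> (m - i) * \<gamma> (n - m)) ((\<beta> \<star> \<gamma>) (n - i))" by simp
    from vsums_cmult[OF this, of "\<alpha> i"]
    show "vsums (\<lambda>m. ?f (prod.swap (i, m))) (\<alpha> i * (\<beta> \<star> \<gamma>) (n - i))"
      by (simp add: mult.assoc)
  qed
  then have 2: "(\<alpha> \<star> (\<beta> \<star> \<gamma>)) n = s"
    using conv_vsums[OF a CK_mult_closed[OF b c], of n] vsums_unique by blast
  show "((\<alpha> \<star> \<beta>) \<star> \<gamma>) n = (\<alpha> \<star> (\<beta> \<star> \<gamma>)) n"
    using 1 2 by simp
qed

lemma CK_mult_left_finite:
  assumes "\<alpha> \<in> carrier CK" "\<beta> \<in> carrier CK" "finite I" "\<And>i. i \<notin> I \<Longrightarrow> \<alpha> i * \<beta> (n - i) = 0"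
  shows "(\<alpha> \<star> \<beta>) n = (\<Sum>i\<in>I. \<alpha> i * \<beta> (n - i))"
  using vsums_unique[OF conv_vsums[OF assms(1,2)] vsums_finite[OF assms(3,4)]] .

lemma CK_l_one:
  assumes "\<alpha> \<in> carrier CK" shows "\<one>\<^bsub>CK\<^esub> \<star> \<alpha> = \<alpha>"
proof
  fix n
  have "(\<one>\<^bsub>CK\<^esub> \<star> \<alpha>) n = (\<Sum>i\<in>{0}. \<one>\<^bsub>CK\<^esub> i * \<alpha> (n - i))"
    by (rule CK_mult_left_finite) (auto simp: assms intro: CK_finite_support)
  then show "(\<one>\<^bsub>CK\<^esub> \<star> \<alpha>) n = \<alpha> n" by simp
qed

lemma CK_l_distr:
  assumes "\<alpha> \<in> carrier CK" "\<beta> \<in> carrier CK" "\<gamma> \<in> carrier CK"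
  shows "(\<alpha> \<oplus>\<^bsub>CK\<^esub> \<beta>) \<star> \<gamma> = (\<alpha> \<star> \<gamma>) \<oplus>\<^bsub>CK\<^esub> (\<beta> \<star> \<gamma>)"
proof
  fix n
  have "vsums (\<lambda>i. (\<alpha> i + \<beta> i) * \<gamma> (n - i)) ((\<alpha> \<star> \<gamma>) n + (\<beta> \<star> \<gamma>) n)"
    using vsums_add[OF conv_vsums[OF assms(1,3), of n] conv_vsums[OF assms(2,3), of n]]
    by (simp add: distrib_right)
  then show "((\<alpha> \<oplus>\<^bsub>CK\<^esub> \<beta>) \<star> \<gamma>) n = ((\<alpha> \<star> \<gamma>) \<oplus>\<^bsub>CK\<^esub> (\<beta> \<star> \<gamma>)) n"
    using conv_vsums[OF CK_add_closed[OF assms(1,2)] assms(3), of n] vsums_unique by simp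
qed

lemma CK_cring: "cring CK"
proof (rule cringI)
  show "abelian_group CK"
  proof (rule abelian_groupI)
    show "\<zero>\<^bsub>CK\<^esub> \<in> carrier CK" by (rule CK_finite_support) simp
    fix \<alpha> assume a: "\<alpha> \<in> carrier CK"
    have "wt \<epsilon> (\<lambda>n. - \<alpha> n) = wt \<epsilon> \<alpha>" for \<epsilon> by (simp add: wt_def fun_eq_iff)
    then have "(\<lambda>n. - \<alpha> n) \<in> carrier CK" using CK_wt[OF a] by (intro CK_I) simp
    then show "\<exists>\<beta>\<in>carrier CK. \<beta> \<oplus>\<^bsub>CK\<^esub> \<alpha> = \<zero>\<^bsub>CK\<^esub>" by (rule rev_bexI) simp
  qed (simp_all add: CK_add_closed add_ac)
  have one: "\<one>\<^bsub>CK\<^esub> \<in> carrier CK" by (rule CK_finite_support) simp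
  show "Group.comm_monoid CK"
    by (rule comm_monoidI) (fact CK_mult_closed one CK_mult_assoc CK_l_one CK_mult_comm)+
qed (fact CK_l_distr)

text \<open>The weight of \<sigma>(\<alpha>) at radius \<epsilon> is the q-th power of the weight of
  \<alpha> at radius \<delta>, the q-th root of \<epsilon>, which still lies in (0, 1).\<close>

lemma disc_frob_closed:
  assumes "\<alpha> \<in> carrier CK" shows "disc_frob q \<alpha> \<in> carrier CK"
proof (rule CK_I, rule null_familyI)
  fix \<epsilon> d :: real assume e: "0 < \<epsilon>" "\<epsilon> < 1" and d: "0 < d"
  define \<delta> where "\<delta> = root q \<epsilon>"
  have \<delta>: "0 < \<delta>" "\<delta> < 1" "\<delta> ^ q = \<epsilon>"
    using e q_pos unfolding \<delta>_def by (simp_all add: real_root_lt_1_iff)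
  obtain c where c: "c > 0" "c ^ q = d" using root_exists[OF d] by blast
  have "\<epsilon> powi n = (\<delta> powi n) ^ q" for n
    unfolding \<delta>(3)[symmetric] by (simp add: power_int_def power_mult[symmetric] power_inverse mult.commute)
  then have "wt \<epsilon> (disc_frob q \<alpha>) n = wt \<delta> \<alpha> n ^ q" for n
    by (simp add: wt_def disc_frob_def nrm_power power_mult_distrib)
  then have "d \<le> wt \<epsilon> (disc_frob q \<alpha>) n \<longleftrightarrow> c \<le> wt \<delta> \<alpha> n" for n
    unfolding c(2)[symmetric] using c(1) q_pos wt_nonneg[OF \<delta>(1)] by simp
  then show "finite {n. d \<le> wt \<epsilon> (disc_frob q \<alpha>) n}"
    using null_familyD[OF CK_wt[OF assms \<delta>(1,2)] c(1)] by simp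
qed

lemma disc_frob_hom: "disc_frob q \<in> ring_hom CK CK"
proof (rule ring_hom_memI)
  fix \<alpha> \<beta> assume ab: "\<alpha> \<in> carrier CK" "\<beta> \<in> carrier CK"
  show "disc_frob q (\<alpha> \<star> \<beta>) = disc_frob q \<alpha> \<star> disc_frob q \<beta>"
  proof
    fix n
    show "disc_frob q (\<alpha> \<star> \<beta>) n = (disc_frob q \<alpha> \<star> disc_frob q \<beta>) n"
      using vsums_unique[OF vsums_power_q[OF conv_vsums[OF ab, of n]],
        of "(disc_frob q \<alpha> \<star> disc_frob q \<beta>) n"]
        conv_vsums[OF disc_frob_closed[OF ab(1)] disc_frob_closed[OF ab(2)], of n]
      by (simp add: disc_frob_def power_mult_distrib)
  qed
qed (use q_pos in \<open>auto simp: disc_frob_closed[unfolded disc_frob_def] disc_frob_def power_q_add fun_eq_iff\<close>)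

section \<open>R((z)) and R[[z]], and the embedding into C_K\<close>

abbreviation BR :: "'k fls ring" where "BR \<equiv> laurent_ring v"
abbreviation AR :: "'k fls ring" where "AR \<equiv> power_series_ring v"

lemma BR_simps [simp]:
  "f \<otimes>\<^bsub>BR\<^esub> g = f * g" "f \<oplus>\<^bsub>BR\<^esub> g = f + g" "\<zero>\<^bsub>BR\<^esub> = 0" "\<one>\<^bsub>BR\<^esub> = 1"
  by (simp_all add: laurent_ring_def)

lemma AR_simps [simp]:
  "f \<otimes>\<^bsub>AR\<^esub> g = f * g" "f \<oplus>\<^bsub>AR\<^esub> g = f + g" "\<zero>\<^bsub>AR\<^esub> = 0" "\<one>\<^bsub>AR\<^esub> = 1"
  by (simp_all add: power_series_ring_def laurent_ring_def)

lemma BR_iff: "f \<in> carrier BR \<longleftrightarrow> (\<forall>n. nrm (fls_nth f n) \<le> 1)"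
  by (simp add: laurent_ring_def nrm_le_1_iff)

lemma AR_iff: "f \<in> carrier AR \<longleftrightarrow> (\<forall>n. nrm (fls_nth f n) \<le> 1) \<and> (\<forall>n<0. fls_nth f n = 0)"
  by (simp add: power_series_ring_def laurent_ring_def nrm_le_1_iff)

lemma AR_subset_BR: "f \<in> carrier AR \<Longrightarrow> f \<in> carrier BR"
  by (simp add: AR_iff BR_iff)

text \<open>On the left there are finitely many terms; on the right integrality bounds the
  coefficients while the weights \<epsilon>^n tend to 0.\<close>

lemma fls_nth_closed:
  assumes "f \<in> carrier BR" shows "fls_nth f \<in> carrier CK"
proof (rule CK_I, rule null_familyI)
  fix \<epsilon> d :: real assume e: "0 < \<epsilon>" "\<epsilon> < 1" and d: "0 < d"
  obtain N :: nat where N: "\<epsilon> ^ N < d" using e d real_arch_pow_inv by blast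
  have "{n. d \<le> wt \<epsilon> (fls_nth f) n} \<subseteq> {fls_subdegree f..int N}"
  proof
    fix n assume "n \<in> {n. d \<le> wt \<epsilon> (fls_nth f) n}"
    then have n: "d \<le> nrm (fls_nth f n) * \<epsilon> powi n" by (simp add: wt_def)
    have "n \<ge> fls_subdegree f"
      using n d by (metis fls_eq0_below_subdegree mult_zero_left not_less nrm_zero)
    moreover have "n \<le> int N"
    proof (rule ccontr)
      assume "\<not> n \<le> int N"
      then have "\<epsilon> powi n = \<epsilon> ^ nat n" "nat n \<ge> N" by (auto simp: power_int_def)
      moreover have "\<epsilon> ^ nat n \<le> \<epsilon> ^ N" using e calculation(2) by (intro power_decreasing) auto
      moreover have "nrm (fls_nth f n) * \<epsilon> powi n \<le> 1 * \<epsilon> powi n"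
        using assms e by (intro mult_right_mono) (auto simp: BR_iff)
      ultimately show False using n N by linarith
    qed
    ultimately show "n \<in> {fls_subdegree f..int N}" by simp
  qed
  then show "finite {n. d \<le> wt \<epsilon> (fls_nth f) n}" by (rule finite_subset) simp
qed

text \<open>Outside a finite range of indices one factor vanishes, so the infinite convolution of
  C_K becomes the finite one of Laurent series.\<close>

lemma fls_nth_hom: "fls_nth \<in> ring_hom BR CK"
proof (rule ring_hom_memI)
  fix f g assume fg: "f \<in> carrier BR" "g \<in> carrier BR"
  show "fls_nth (f \<otimes>\<^bsub>BR\<^esub> g) = fls_nth f \<star> fls_nth g"
  proof
    fix n
    have "(fls_nth f \<star> fls_nth g) n =
        (\<Sum>i=fls_subdegree f..n - fls_subdegree g. fls_nth f i * fls_nth g (n - i))"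
      by (rule CK_mult_left_finite) (auto simp: fls_nth_closed fg not_le intro: fls_eq0_below_subdegree)
    then show "fls_nth (f \<otimes>\<^bsub>BR\<^esub> g) n = (fls_nth f \<star> fls_nth g) n"
      by (simp add: fls_times_nth(2))
  qed
qed (auto simp: fls_nth_closed)

lemma fls_nth_inj: "inj_on fls_nth S"
  by (simp add: inj_on_def fls_nth_inject)

lemma laurent_frob_nth [simp]: "fls_nth (laurent_frob q f) n = fls_nth f n ^ q"
  unfolding laurent_frob_def
  by (rule nth_Abs_fls_lower_bound[of "fls_subdegree f"]) (use q_pos in simp)

lemma fls_nth_laurent_frob: "fls_nth (laurent_frob q f) = disc_frob q (fls_nth f)"
  by (simp add: disc_frob_def fun_eq_iff)

end


section \<open>Modules with a semilinear operator and their base change\<close>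

lemma linearization_universal:
  fixes M :: "('b, 'm, 'y) tau_module_scheme"
  assumes "module B M" "\<sigma> \<in> ring_hom B B" "semilin B \<sigma> M M (tau M)"
  shows "tensor_universal B B \<sigma> M M (\<lambda>(b, m). b \<odot>\<^bsub>M\<^esub> tau M m)"
proof -
  interpret M: module B M by fact
  interpret tensor_base B B \<sigma> M by unfold_locales (fact assms(2))
  note s = semilinD[OF assms(3)] ring_hom_closed[OF assms(2)]
  show ?thesis
    by unfold_locales (simp_all add: s M.smult_l_distr M.smult_r_distr M.smult_assoc1)
qed

lemma linearization_semilin:
  assumes "module B M" "\<sigma> \<in> ring_hom B B" "semilin B \<sigma> M M (tau M)"
  shows "semilin B (\<lambda>b. b) (base_change B B \<sigma> M) M (linearization M)"
proof -
  interpret M: module B M by fact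
  show ?thesis
    unfolding linearization_def
    by (rule lift_semilin[OF linearization_universal[OF assms] assms(1)])
      (simp_all add: semilinD[OF assms(3)] M.smult_assoc1)
qed

lemma linearization_unit:
  assumes "module B M" "\<sigma> \<in> ring_hom B B" "semilin B \<sigma> M M (tau M)" "m \<in> carrier M"
  shows "linearization M (pure_tensor B B \<sigma> M \<one>\<^bsub>B\<^esub> m) = tau M m"
proof -
  interpret M: module B M by fact
  interpret tensor_universal B B \<sigma> M M "\<lambda>(b, m). b \<odot>\<^bsub>M\<^esub> tau M m"
    by (rule linearization_universal[OF assms(1-3)])
  show ?thesis
    using lift_pt[of "\<one>\<^bsub>B\<^esub>" m] assms(4) semilinD(1)[OF assms(3,4)] by (simp add: linearization_def)
qed

text \<open>The Frobenius pullback of \<open>M\<close> has basis 1 tensor e_i, and the linearization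
  isomorphism sends it to tau(e_i).\<close>

lemma etale_tau_basis:
  assumes et: "etale_tau_module B \<sigma> M" and sig: "\<sigma> \<in> ring_hom B B" and b: "is_basis B M n e"
  shows "is_basis B M n (\<lambda>i. tau M (e i))"
proof -
  have M: "module B M" and s: "semilin B \<sigma> M M (tau M)"
    and bij: "bij_betw (linearization M) (carrier (base_change B B \<sigma> M)) (carrier M)"
    using et unfolding etale_tau_module_def locally_free_finite_type_def semilinear_iff by blast+
  interpret M: module B M by fact
  interpret tensor_base B B \<sigma> M by unfold_locales (fact sig)
  have "is_basis B M n (\<lambda>i. linearization M (pure_tensor B B \<sigma> M \<one>\<^bsub>B\<^esub> (e i)))"
    by (rule is_basis_image[OF T.module_axioms M linearization_semilin[OF M sig s] bij basis_base_change[OF b]])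
  then show ?thesis
    by (rule is_basis_cong[THEN iffD1, rotated])
      (simp add: linearization_unit[OF M sig s] is_basisD(1)[OF b])
qed

lemma etale_tau_funpow_basis:
  assumes et: "etale_tau_module B \<sigma> M" and sig: "\<sigma> \<in> ring_hom B B" and b: "is_basis B M n e"
  shows "is_basis B M n (\<lambda>i. (tau M ^^ r) (e i))"
  by (induction r) (use b etale_tau_basis[OF et sig] in auto)

text \<open>A converse to \<open>etale_tau_basis\<close> that tests a single basis: the
  linearization is bijective because it matches two bases. It makes the base change a
  sigma-bundle.\<close>

lemma etale_of_basis:
  assumes M: "module B M" and s: "semilin B \<sigma> M M (tau M)" and sig: "\<sigma> \<in> ring_hom B B"
    and b: "is_basis B M n e" and b': "is_basis B M n (\<lambda>i. tau M (e i))"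
  shows "etale_tau_module B \<sigma> M"
proof -
  interpret M: module B M by fact
  interpret tensor_base B B \<sigma> M by unfold_locales (fact sig)
  have "locally_free_finite_type B M"
    by (rule M.R.locally_free_of_free[OF M]) (use b M.free_finite_rank_iff in blast)
  moreover have "is_basis B M n (\<lambda>i. linearization M (pure_tensor B B \<sigma> M \<one>\<^bsub>B\<^esub> (e i)))"
    by (rule is_basis_cong[THEN iffD1, OF _ b'])
      (simp add: linearization_unit[OF M sig s] is_basisD(1)[OF b])
  then have "bij_betw (linearization M) (carrier (base_change B B \<sigma> M)) (carrier M)"
    by (rule bij_betw_of_basis[OF T.module_axioms M linearization_semilin[OF M sig s] basis_base_change[OF b]])
  ultimately show ?thesis
    unfolding etale_tau_module_def semilinear_iff linear_maps_iff
    using s linearization_semilin[OF M sig s] by blast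
qed

locale tau_tensor = tensor_base B C \<phi> M
  for B :: "('b, 'x) ring_scheme" and C :: "('c, 'y) ring_scheme" and \<phi> :: "'b \<Rightarrow> 'c"
    and M :: "('b, 'm, 'z) tau_module_scheme" +
  fixes \<sigma>\<^sub>B :: "'b \<Rightarrow> 'b" and \<sigma>\<^sub>C :: "'c \<Rightarrow> 'c"
  assumes sigma_C: "\<sigma>\<^sub>C \<in> ring_hom C C"
    and sigma_B: "\<sigma>\<^sub>B \<in> ring_hom B B"
    and phi_sigma: "\<And>b. b \<in> carrier B \<Longrightarrow> \<phi> (\<sigma>\<^sub>B b) = \<sigma>\<^sub>C (\<phi> b)"
    and tau_semilin: "semilin B \<sigma>\<^sub>B M M (tau M)"
begin

abbreviation E where "E \<equiv> tau_base_change B C \<phi> \<sigma>\<^sub>C M"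

lemma E_simps [simp]:
  "carrier E = carrier T" "\<zero>\<^bsub>E\<^esub> = \<zero>\<^bsub>T\<^esub>" "x \<oplus>\<^bsub>E\<^esub> y = x \<oplus>\<^bsub>T\<^esub> y" "c \<odot>\<^bsub>E\<^esub> x = c \<odot>\<^bsub>T\<^esub> x"
  by (simp_all add: tau_base_change_def module.defs)

lemma module_E: "module C E"
proof -
  have "abelian_group E"
  proof (rule abelian_groupI, unfold E_simps)
    fix x assume "x \<in> carrier T"
    then show "\<exists>y\<in>carrier T. y \<oplus>\<^bsub>T\<^esub> x = \<zero>\<^bsub>T\<^esub>" using T.l_neg by blast
  qed (simp_all add: T.a_ac)
  then show ?thesis
    by (intro moduleI C.is_cring) (simp_all add: T.smult_l_distr T.smult_r_distr T.smult_assoc1)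
qed

lemma lincomb_E: "lincomb E n c e = lincomb T n c e"
  by (induction n) simp_all

lemma is_basis_E: "is_basis C E n e \<longleftrightarrow> is_basis C T n e"
  by (simp add: is_basis_def lincomb_E)

lemma tau_closed [simp]: "m \<in> carrier M \<Longrightarrow> tau M m \<in> carrier M"
  by (rule semilinD(1)[OF tau_semilin])

text \<open>Balancedness rests on \<open>phi_sigma\<close>: the two Frobenius maps agree under
  \<open>\<phi>\<close>, so sigma(c phi(b)) tensor tau(m) equals sigma(c) tensor tau(b m).\<close>

lemma tau_universal: "tensor_universal B C \<phi> M T (\<lambda>(c, m). pt (\<sigma>\<^sub>C c) (tau M m))"
  by unfold_locales
    (simp_all add: ring_hom_closed[OF sigma_C] ring_hom_add[OF sigma_C] ring_hom_mult[OF sigma_C]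
      pt_add_left pt_add_right semilinD[OF tau_semilin] pt_balanced ring_hom_closed[OF sigma_B] phi_sigma)

lemma tau_E: "tau E = tensor_lift T (\<lambda>(c, m). pt (\<sigma>\<^sub>C c) (tau M m))"
  by (simp add: tau_base_change_def module.defs tau_module.defs)

lemma tau_E_pt [simp]: "c \<in> carrier C \<Longrightarrow> m \<in> carrier M \<Longrightarrow> tau E (pt c m) = pt (\<sigma>\<^sub>C c) (tau M m)"
  using tensor_universal.lift_pt[OF tau_universal, of c m] by (simp add: tau_E)

lemma tau_E_semilin_T: "semilin C \<sigma>\<^sub>C T T (tau E)"
  unfolding tau_E
  by (rule lift_semilin[OF tau_universal T.module_axioms])
    (auto simp: ring_hom_mult[OF sigma_C] ring_hom_closed[OF sigma_C])

lemma tau_E_semilin: "semilin C \<sigma>\<^sub>C E E (tau E)"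
  using tau_E_semilin_T by (simp add: semilin_def)

lemma tau_E_funpow_unit:
  "m \<in> carrier M \<Longrightarrow> (tau E ^^ k) (pt \<one>\<^bsub>C\<^esub> m) = pt \<one>\<^bsub>C\<^esub> ((tau M ^^ k) m) \<and> (tau M ^^ k) m \<in> carrier M"
  by (induction k) (simp_all add: ring_hom_one[OF sigma_C])

lemma etale_E:
  assumes b: "is_basis B M n e" and b': "is_basis B M n (\<lambda>i. tau M (e i))"
  shows "etale_tau_module C \<sigma>\<^sub>C E"
proof (rule etale_of_basis[OF module_E tau_E_semilin sigma_C])
  show "is_basis C E n (\<lambda>i. pt \<one>\<^bsub>C\<^esub> (e i))"
    unfolding is_basis_E by (rule basis_base_change[OF b])
  have "is_basis C T n (\<lambda>i. pt \<one>\<^bsub>C\<^esub> (tau M (e i)))" by (rule basis_base_change[OF b'])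
  then show "is_basis C E n (\<lambda>i. tau E (pt \<one>\<^bsub>C\<^esub> (e i)))"
    unfolding is_basis_E
    by (rule is_basis_cong[THEN iffD1, rotated]) (simp add: is_basisD(1)[OF b] ring_hom_one[OF sigma_C])
qed

end

section \<open>Functoriality of base change and descent of morphisms\<close>

locale base_change_pair = M: tensor_base B C \<phi> M + N: tensor_base B C \<phi> N
  for B :: "('b, 'x) ring_scheme" and C :: "('c, 'y) ring_scheme" and \<phi> :: "'b \<Rightarrow> 'c"
    and M :: "('b, 'm, 'z) module_scheme" and N :: "('b, 'n, 'w) module_scheme"
begin

lemma map_universal:
  assumes "f \<in> linear_maps B M N"
  shows "tensor_universal B C \<phi> M N.T (\<lambda>(c, m). N.pt c (f m))"
proof -
  note s = semilinD[OF assms[unfolded linear_maps_iff]]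
  show ?thesis
    by unfold_locales (simp_all add: s N.pt_add_left N.pt_add_right N.pt_balanced)
qed

lemma map_pt:
  assumes "f \<in> linear_maps B M N" "c \<in> carrier C" "m \<in> carrier M"
  shows "base_change_map B C \<phi> M N f (M.pt c m) = N.pt c (f m)"
  using tensor_universal.lift_pt[OF map_universal[OF assms(1)], of c m] assms(2,3)
  by (simp add: base_change_map_def M.pt_closed)

lemma map_semilin:
  assumes "f \<in> linear_maps B M N"
  shows "semilin C (\<lambda>c. c) M.T N.T (base_change_map B C \<phi> M N f)"
proof -
  note s = semilinD[OF assms[unfolded linear_maps_iff]]
  have "semilin C (\<lambda>c. c) M.T N.T (tensor_lift N.T (\<lambda>(c, m). N.pt c (f m)))"
    by (rule lift_semilin[OF map_universal[OF assms] N.T.module_axioms]) (auto simp: s)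
  then show ?thesis unfolding semilin_def base_change_map_def by (simp add: Pi_iff)
qed

lemma map_extensional: "base_change_map B C \<phi> M N f \<in> extensional (carrier M.T)"
  by (simp add: base_change_map_def)

lemma map_inj:
  assumes "is_basis B N n e" "inj_on \<phi> (carrier B)"
    and f: "f \<in> linear_maps B M N" "f \<in> extensional (carrier M)"
    and g: "g \<in> linear_maps B M N" "g \<in> extensional (carrier M)"
    and eq: "base_change_map B C \<phi> M N f = base_change_map B C \<phi> M N g"
  shows "f = g"
proof (rule extensionalityI[OF f(2) g(2)])
  fix m assume m: "m \<in> carrier M"
  have "N.pt \<one>\<^bsub>C\<^esub> (f m) = N.pt \<one>\<^bsub>C\<^esub> (g m)"
    using map_pt[OF f(1) _ m, of "\<one>\<^bsub>C\<^esub>"] map_pt[OF g(1) _ m, of "\<one>\<^bsub>C\<^esub>"] eq by simp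
  then show "f m = g m"
    using inj_onD[OF N.unit_inj[OF assms(1,2)]] semilinD(1)[OF f(1)[unfolded linear_maps_iff] m]
      semilinD(1)[OF g(1)[unfolded linear_maps_iff] m] by blast
qed

text \<open>Injectivity of x |-> 1 tensor x makes the preimage chosen for F(1 tensor m) unique,
  hence B-linear in \<open>m\<close>. Since the elements 1 tensor m generate over \<open>C\<close>,
  the base change of the resulting map is \<open>F\<close>.\<close>

lemma map_onto:
  assumes b: "is_basis B N n e" and inj: "inj_on \<phi> (carrier B)"
    and F: "semilin C (\<lambda>c. c) M.T N.T F" "F \<in> extensional (carrier M.T)"
    and im: "\<And>m. m \<in> carrier M \<Longrightarrow> \<exists>x\<in>carrier N. F (M.pt \<one>\<^bsub>C\<^esub> m) = N.pt \<one>\<^bsub>C\<^esub> x"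
  obtains f where "f \<in> linear_maps B M N" "f \<in> extensional (carrier M)"
    "base_change_map B C \<phi> M N f = F"
    "\<And>m. m \<in> carrier M \<Longrightarrow> F (M.pt \<one>\<^bsub>C\<^esub> m) = N.pt \<one>\<^bsub>C\<^esub> (f m)"
proof -
  define f where "f = restrict (\<lambda>m. SOME x. x \<in> carrier N \<and> F (M.pt \<one>\<^bsub>C\<^esub> m) = N.pt \<one>\<^bsub>C\<^esub> x) (carrier M)"
  have f: "f m \<in> carrier N \<and> F (M.pt \<one>\<^bsub>C\<^esub> m) = N.pt \<one>\<^bsub>C\<^esub> (f m)" if "m \<in> carrier M" for m
    unfolding f_def restrict_apply' [OF that] by (rule someI_ex[OF im[OF that, unfolded Bex_def]])
  have eqI: "x = y" if "x \<in> carrier N" "y \<in> carrier N" "N.pt \<one>\<^bsub>C\<^esub> x = N.pt \<one>\<^bsub>C\<^esub> y" for x y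
    using inj_onD[OF N.unit_inj[OF b inj] that(3,1,2)] .
  note uM = semilinD[OF M.unit_semilin] and uN = semilinD[OF N.unit_semilin]
  have lin: "f \<in> linear_maps B M N"
    unfolding linear_maps_def
  proof (intro CollectI conjI ballI)
    fix x y assume xy: "x \<in> carrier M" "y \<in> carrier M"
    show "f (x \<oplus>\<^bsub>M\<^esub> y) = f x \<oplus>\<^bsub>N\<^esub> f y"
    proof (rule eqI)
      have "F (M.pt \<one>\<^bsub>C\<^esub> (x \<oplus>\<^bsub>M\<^esub> y)) = F (M.pt \<one>\<^bsub>C\<^esub> x) \<oplus>\<^bsub>N.T\<^esub> F (M.pt \<one>\<^bsub>C\<^esub> y)"
        unfolding uM(2)[OF xy] by (rule semilinD(2)[OF F(1)]) (use xy in auto)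
      then show "N.pt \<one>\<^bsub>C\<^esub> (f (x \<oplus>\<^bsub>M\<^esub> y)) = N.pt \<one>\<^bsub>C\<^esub> (f x \<oplus>\<^bsub>N\<^esub> f y)"
        using f[OF xy(1)] f[OF xy(2)] f[of "x \<oplus>\<^bsub>M\<^esub> y"] xy uN(2)[of "f x" "f y"] by simp
    qed (use f[of x] f[of y] f[of "x \<oplus>\<^bsub>M\<^esub> y"] xy in simp_all)
  next
    fix b x assume bx: "b \<in> carrier B" "x \<in> carrier M"
    show "f (b \<odot>\<^bsub>M\<^esub> x) = b \<odot>\<^bsub>N\<^esub> f x"
    proof (rule eqI)
      have "F (M.pt \<one>\<^bsub>C\<^esub> (b \<odot>\<^bsub>M\<^esub> x)) = \<phi> b \<odot>\<^bsub>N.T\<^esub> F (M.pt \<one>\<^bsub>C\<^esub> x)"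
        unfolding uM(3)[OF bx] by (rule semilinD(3)[OF F(1)]) (use bx in auto)
      then show "N.pt \<one>\<^bsub>C\<^esub> (f (b \<odot>\<^bsub>M\<^esub> x)) = N.pt \<one>\<^bsub>C\<^esub> (b \<odot>\<^bsub>N\<^esub> f x)"
        using f[OF bx(2)] f[of "b \<odot>\<^bsub>M\<^esub> x"] bx uN(3)[of b "f x"] by simp
    qed (use f[of x] f[of "b \<odot>\<^bsub>M\<^esub> x"] bx in simp_all)
  next
    show "f \<in> carrier M \<rightarrow> carrier N" using f by blast
  qed
  have "base_change_map B C \<phi> M N f = F"
  proof (rule extensionalityI[OF map_extensional F(2)])
    fix X assume "X \<in> carrier M.T"
    then show "base_change_map B C \<phi> M N f X = F X"
    proof (induction rule: M.T_induct)
      case (pure c m)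
      have "F (M.pt c m) = F (c \<odot>\<^bsub>M.T\<^esub> M.pt \<one>\<^bsub>C\<^esub> m)" using pure by simp
      also have "\<dots> = c \<odot>\<^bsub>N.T\<^esub> F (M.pt \<one>\<^bsub>C\<^esub> m)" by (rule semilinD(3)[OF F(1)]) (use pure in auto)
      also have "\<dots> = N.pt c (f m)" using f[OF pure(2)] pure by simp
      finally show ?case using map_pt[OF lin pure] by simp
    next
      case (add X Y)
      then show ?case
        using semilinD(2)[OF F(1) add(1,2)] semilinD(2)[OF map_semilin[OF lin] add(1,2)] by simp
    qed
  qed
  moreover have "f \<in> extensional (carrier M)" unfolding f_def by (rule restrict_extensional)
  ultimately show thesis using that lin f by blast
qed

end

lemma base_change_map_id:
  assumes "tensor_base B C \<phi> M"
  shows "base_change_map B C \<phi> M M (restrict id (carrier M)) = restrict id (carrier (base_change B C \<phi> M))"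
proof -
  interpret M: tensor_base B C \<phi> M by fact
  interpret base_change_pair B C \<phi> M M by unfold_locales
  have lin: "restrict id (carrier M) \<in> linear_maps B M M"
    by (auto simp: linear_maps_def)
  show ?thesis
  proof (rule extensionalityI[OF map_extensional])
    fix X assume X: "X \<in> carrier M.T"
    then have "base_change_map B C \<phi> M M (restrict id (carrier M)) X = X"
    proof (induction rule: M.T_induct)
      case (add X Y)
      then show ?case using semilinD(2)[OF map_semilin[OF lin] add(1,2)] by metis
    next
      case (pure c m)
      then show ?case using map_pt[OF lin pure] by (metis restrict_apply' id_apply)
    qed
    then show "base_change_map B C \<phi> M M (restrict id (carrier M)) X = restrict id (carrier M.T) X" using X by simp
  qed simp
qed

lemma base_change_map_compose:
  assumes "tensor_base B C \<phi> M" "tensor_base B C \<phi> N" "tensor_base B C \<phi> P"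
    and f: "f \<in> linear_maps B M N" and g: "g \<in> linear_maps B N P"
  shows "base_change_map B C \<phi> M P (compose (carrier M) g f) =
    compose (carrier (base_change B C \<phi> M)) (base_change_map B C \<phi> N P g) (base_change_map B C \<phi> M N f)"
proof -
  interpret M: tensor_base B C \<phi> M by fact
  interpret N: tensor_base B C \<phi> N by fact
  interpret P: tensor_base B C \<phi> P by fact
  interpret MN: base_change_pair B C \<phi> M N by unfold_locales
  interpret NP: base_change_pair B C \<phi> N P by unfold_locales
  interpret MP: base_change_pair B C \<phi> M P by unfold_locales
  note sf = semilinD[OF f[unfolded linear_maps_iff]] and sg = semilinD[OF g[unfolded linear_maps_iff]]
  have lin: "compose (carrier M) g f \<in> linear_maps B M P"
    by (auto simp: linear_maps_def compose_def sf sg)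
  show ?thesis
  proof (rule extensionalityI[OF MP.map_extensional])
    fix X assume X: "X \<in> carrier M.T"
    then have "base_change_map B C \<phi> M P (compose (carrier M) g f) X =
       base_change_map B C \<phi> N P g (base_change_map B C \<phi> M N f X)"
    proof (induction rule: M.T_induct)
      case (pure c m)
      then show ?case
        by (simp add: MP.map_pt[OF lin] MN.map_pt[OF f] NP.map_pt[OF g] sf compose_eq)
    next
      case (add X Y)
      then show ?case
        using semilinD(2)[OF MP.map_semilin[OF lin] add(1,2)] semilinD(2)[OF MN.map_semilin[OF f] add(1,2)]
          semilinD(2)[OF NP.map_semilin[OF g] semilinD(1)[OF MN.map_semilin[OF f] add(1)]
             semilinD(1)[OF MN.map_semilin[OF f] add(2)]] by simp
    qed
    then show "base_change_map B C \<phi> M P (compose (carrier M) g f) X =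
      compose (carrier M.T) (base_change_map B C \<phi> N P g) (base_change_map B C \<phi> M N f) X"
      using X by (simp add: compose_def)
  qed (simp add: compose_def)
qed

locale tau_tensor_pair = M: tau_tensor B C \<phi> M \<sigma>\<^sub>B \<sigma>\<^sub>C + N: tau_tensor B C \<phi> N \<sigma>\<^sub>B \<sigma>\<^sub>C
  for B :: "('b, 'x) ring_scheme" and C :: "('c, 'y) ring_scheme" and \<phi> :: "'b \<Rightarrow> 'c"
    and M :: "('b, 'm, 'z) tau_module_scheme" and N :: "('b, 'n, 'w) tau_module_scheme"
    and \<sigma>\<^sub>B \<sigma>\<^sub>C
begin

sublocale base_change_pair B C \<phi> M N ..

lemma linear_maps_E: "linear_maps C M.E N.E = {F. semilin C (\<lambda>c. c) M.T N.T F}"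
  by (auto simp: linear_maps_def semilin_def)

lemma map_tau_hom:
  assumes "f \<in> tau_hom B M N"
  shows "base_change_map B C \<phi> M N f \<in> tau_hom C M.E N.E"
proof -
  have lin: "f \<in> linear_maps B M N" and tau: "\<And>m. m \<in> carrier M \<Longrightarrow> f (tau M m) = tau N (f m)"
    using assms by (auto simp: tau_hom_def)
  note s = semilinD[OF lin[unfolded linear_maps_iff]]
  note ms = semilinD[OF map_semilin[OF lin]]
  have "base_change_map B C \<phi> M N f (tau M.E X) = tau N.E (base_change_map B C \<phi> M N f X)"
    if "X \<in> carrier M.T" for X
    using that
  proof (induction rule: M.T_induct)
    case (pure c m)
    then show ?case by (simp add: map_pt[OF lin] s tau ring_hom_closed[OF M.sigma_C])
  next
    case (add X Y)
    then show ?case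
      using semilinD(1,2)[OF M.tau_E_semilin_T] semilinD(1,2)[OF N.tau_E_semilin_T] ms(1,2) by simp
  qed
  then show ?thesis
    using map_semilin[OF lin] map_extensional by (simp add: tau_hom_def linear_maps_E)
qed

text \<open>Full faithfulness reduces to \<open>im\<close>: a morphism after base change must carry
  1 tensor M into 1 tensor N. Compatibility with tau then descends by the same injectivity that
  gives uniqueness.\<close>

lemma map_bij_betw:
  assumes b: "is_basis B N n e" and inj: "inj_on \<phi> (carrier B)"
    and im: "\<And>F m. F \<in> tau_hom C M.E N.E \<Longrightarrow> m \<in> carrier M \<Longrightarrow>
         \<exists>x\<in>carrier N. F (M.pt \<one>\<^bsub>C\<^esub> m) = N.pt \<one>\<^bsub>C\<^esub> x"
  shows "bij_betw (base_change_map B C \<phi> M N) (tau_hom B M N) (tau_hom C M.E N.E)"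
proof (rule bij_betw_imageI)
  show "inj_on (base_change_map B C \<phi> M N) (tau_hom B M N)"
    by (rule inj_onI, rule map_inj[OF b inj]) (auto simp: tau_hom_def)
  have "F \<in> base_change_map B C \<phi> M N ` tau_hom B M N" if F: "F \<in> tau_hom C M.E N.E" for F
  proof -
    have Fs: "semilin C (\<lambda>c. c) M.T N.T F" "F \<in> extensional (carrier M.T)"
      and Ft: "\<And>X. X \<in> carrier M.T \<Longrightarrow> F (tau M.E X) = tau N.E (F X)"
      using F by (auto simp: tau_hom_def linear_maps_E)
    obtain f where f: "f \<in> linear_maps B M N" "f \<in> extensional (carrier M)"
      "base_change_map B C \<phi> M N f = F"
      "\<And>m. m \<in> carrier M \<Longrightarrow> F (M.pt \<one>\<^bsub>C\<^esub> m) = N.pt \<one>\<^bsub>C\<^esub> (f m)"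
      using map_onto[OF b inj Fs im[OF F]] by blast
    note s = semilinD[OF f(1)[unfolded linear_maps_iff]]
    have "f (tau M m) = tau N (f m)" if m: "m \<in> carrier M" for m
    proof (rule inj_onD[OF N.unit_inj[OF b inj]])
      have "F (tau M.E (M.pt \<one>\<^bsub>C\<^esub> m)) = tau N.E (F (M.pt \<one>\<^bsub>C\<^esub> m))" by (rule Ft) (use m in auto)
      then show "N.pt \<one>\<^bsub>C\<^esub> (f (tau M m)) = N.pt \<one>\<^bsub>C\<^esub> (tau N (f m))"
        using m f(4)[of m] f(4)[of "tau M m"] s(1) by (simp add: ring_hom_one[OF M.sigma_C])
    qed (use m s(1) in auto)
    then have "f \<in> tau_hom B M N" using f by (simp add: tau_hom_def)
    then show ?thesis using f(3) by blast
  qed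
  then show "base_change_map B C \<phi> M N ` tau_hom B M N = tau_hom C M.E N.E"
    using map_tau_hom by blast
qed

end


section \<open>Bases of lattices in pure isocrystals\<close>

text \<open>The order of a finite field is a power of its characteristic p: for a prime r dividing
  it, Sylow's theorem gives an additive subgroup of order r, whose nonzero elements are killed by r,
  so r = p. The target field has characteristic p too, and the additivity of x |-> x^p is
  iterated.\<close>

lemma finite_field_power_add:
  fixes \<iota> :: "'f::{field,finite} \<Rightarrow> 'k::field"
  assumes one: "\<iota> 1 = 1" and add: "\<And>a b. \<iota> (a + b) = \<iota> a + \<iota> b"
  shows "(x + y :: 'k) ^ CARD('f) = x ^ CARD('f) + y ^ CARD('f)"
proof -
  let ?p = "CHAR('f)"
  have zero: "\<iota> 0 = 0" using add[of 0 0] by (metis add.right_neutral add_left_cancel)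
  have of_nat: "\<iota> (of_nat n) = of_nat n" for n by (induction n) (simp_all add: zero one add)
  have p: "prime ?p" by (rule prime_CHAR_semidom) (rule finite_imp_CHAR_pos, simp)
  have "(of_nat ?p :: 'k) = 0" using of_nat[of ?p] zero by simp
  then have "CHAR('k) dvd ?p" by (simp add: of_nat_eq_0_iff_char_dvd)
  moreover have "CHAR('k) \<noteq> 1" by simp
  ultimately have char: "CHAR('k) = ?p" using p by (auto simp: prime_nat_iff)
  \<comment> \<open>The additive group of the field, in multiplicative notation for Sylow's
    theorem.\<close>
  define G :: "'f monoid" where "G = \<lparr>carrier = UNIV, monoid.mult = (+), one = 0\<rparr>"
  interpret G: group G
    by (rule groupI) (auto simp: G_def add_ac intro: exI[of _ "- x" for x])
  have pow: "x [^]\<^bsub>G\<^esub> (n::nat) = of_nat n * x" for x n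
    by (induction n) (simp_all add: G_def distrib_right nat_pow_def add.commute)
  have eq: "r = ?p" if r: "prime r" "r dvd CARD('f)" for r
  proof -
    obtain m where "CARD('f) = r ^ 1 * m" using r(2) by (auto elim: dvdE)
    then have "order G = r ^ 1 * m" by (simp add: order_def G_def)
    from sylow_thm[OF r(1) G.group_axioms this]
    obtain H where H: "subgroup H G" "card H = r" by (auto simp: G_def)
    have "\<not> H \<subseteq> {0}"
    proof
      assume "H \<subseteq> {0}"
      then have "card H \<le> 1" using card_mono[of "{0}" H] by simp
      then show False using H(2) prime_gt_1_nat[OF r(1)] by simp
    qed
    then obtain x where x: "x \<in> H" "x \<noteq> 0" by blast
    interpret GH: group "G\<lparr>carrier := H\<rparr>" by (rule subgroup.subgroup_is_group[OF H(1) G.group_axioms])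
    have "x [^]\<^bsub>G\<lparr>carrier := H\<rparr>\<^esub> order (G\<lparr>carrier := H\<rparr>) = \<one>\<^bsub>G\<lparr>carrier := H\<rparr>\<^esub>"
      by (rule GH.pow_order_eq_1) (simp add: x)
    then have "of_nat r * x = 0"
      using pow[of x r] H(2) by (simp add: order_def nat_pow_def G_def)
    then have "(of_nat r :: 'f) = 0" using x(2) by simp
    then have "?p dvd r" by (simp add: of_nat_eq_0_iff_char_dvd)
    then show ?thesis using p r(1) primes_dvd_imp_eq by blast
  qed
  have "CARD('f) = ?p ^ multiplicity ?p CARD('f)"
  proof -
    have "prime_factors CARD('f) \<subseteq> {?p}" using eq by (auto simp: prime_factors_dvd)
    moreover have "CARD('f) = (\<Prod>r\<in>prime_factors CARD('f). r ^ multiplicity r CARD('f))"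
      by (subst prime_factorization_nat) simp_all
    moreover have "(\<Prod>r\<in>prime_factors CARD('f). r ^ multiplicity r CARD('f)) = (\<Prod>r\<in>{?p}. r ^ multiplicity r CARD('f))"
      using calculation(1) by (intro prod.mono_neutral_left) (auto simp: prime_factors_multiplicity p)
    ultimately show ?thesis by simp
  qed
  then show ?thesis
    using freshmans_dream'[of "CARD('f)" "multiplicity ?p CARD('f)" x y] char p by metis
qed

section \<open>Monomials and Frobenius on R((z)), and the local ring R[[z]]\<close>

context complete_valued_field
begin

abbreviation zpow :: "int \<Rightarrow> 'k fls" where "zpow s \<equiv> fls_X_intpow s"

lemma zpow_BR [simp]: "zpow s \<in> carrier BR"
  by (simp add: BR_iff)

lemma zpow_mult: "zpow a * zpow b = zpow (a + b)"
  by (rule fls_X_intpow_times_fls_X_intpow)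

lemma zpow_nth: "fls_nth (zpow s * f) n = fls_nth f (n - s)"
  by (simp add: fls_X_intpow_times_conv_shift)

lemma laurent_frob_hom: "laurent_frob q \<in> ring_hom BR BR"
proof (rule ring_hom_memI)
  fix f g assume fg: "f \<in> carrier BR" "g \<in> carrier BR"
  then have s: "laurent_frob q f \<in> carrier BR" "laurent_frob q g \<in> carrier BR"
    by (simp_all add: BR_iff nrm_power power_le_one)
  then show "laurent_frob q f \<in> carrier BR" by simp
  have "fls_nth (laurent_frob q (f \<otimes>\<^bsub>BR\<^esub> g)) = disc_frob q (fls_nth f \<star> fls_nth g)"
    unfolding fls_nth_laurent_frob ring_hom_mult[OF fls_nth_hom fg] ..
  also have "\<dots> = fls_nth (laurent_frob q f \<otimes>\<^bsub>BR\<^esub> laurent_frob q g)"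
    unfolding ring_hom_mult[OF fls_nth_hom s] fls_nth_laurent_frob
    by (rule ring_hom_mult[OF disc_frob_hom]) (simp_all add: fls_nth_closed fg)
  finally show "laurent_frob q (f \<otimes>\<^bsub>BR\<^esub> g) = laurent_frob q f \<otimes>\<^bsub>BR\<^esub> laurent_frob q g"
    by (simp add: fls_nth_inject)
qed (auto intro!: fls_eqI simp: power_q_add q_pos zero_power)

lemma frob_funpow_nth: "fls_nth ((laurent_frob q ^^ r) f) n = fls_nth f n ^ (q ^ r)"
  by (induction r) (simp_all add: power_mult[symmetric] mult.commute)

lemma disc_frob_funpow: "(disc_frob q ^^ r) c n = c n ^ (q ^ r)"
  by (induction r) (simp_all add: disc_frob_def power_mult[symmetric] mult.commute)

lemma frob_funpow_AR: "f \<in> carrier AR \<Longrightarrow> (laurent_frob q ^^ r) f \<in> carrier AR"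
  using q_pos by (simp add: AR_iff frob_funpow_nth nrm_power power_le_one)

lemma frob_funpow_zpow: "(laurent_frob q ^^ r) (zpow s) = zpow s"
  using q_pos by (intro fls_eqI) (simp add: frob_funpow_nth)

lemma nrm_sum_le: "0 \<le> d \<Longrightarrow> (\<And>i. i \<in> I \<Longrightarrow> nrm (f i) \<le> d) \<Longrightarrow> nrm (sum f I) \<le> d"
proof (induction I rule: infinite_finite_induct)
  case (insert i I)
  then show ?case using nrm_add_le[of "f i" "sum f I"] by (simp add: max_def split: if_splits) force+
qed simp_all

lemma AR_nth_0_mult:
  assumes "f \<in> carrier AR" "g \<in> carrier AR"
  shows "fls_nth (f * g) 0 = fls_nth f 0 * fls_nth g 0"
proof -
  have "fls_nth (f * g) 0 = (fls_nth f \<star> fls_nth g) 0"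
    using ring_hom_mult[OF fls_nth_hom AR_subset_BR[OF assms(1)] AR_subset_BR[OF assms(2)]] by simp
  also have "\<dots> = (\<Sum>i\<in>{0}. fls_nth f i * fls_nth g (0 - i))"
  proof (rule CK_mult_left_finite)
    fix i :: int assume "i \<notin> {0}"
    then have "i < 0 \<or> 0 - i < 0" by auto
    then show "fls_nth f i * fls_nth g (0 - i) = 0" using assms by (auto simp: AR_iff)
  qed (use assms in \<open>simp_all add: fls_nth_closed AR_subset_BR\<close>)
  finally show ?thesis by simp
qed

text \<open>The inverse g exists among Laurent series over \<open>K\<close>. Comparing coefficients
  expresses f_0 g_n through g_0, ..., g_(n-1), and |f_0| = 1, so integrality propagates by strong
  induction.\<close>

lemma AR_unitI:
  assumes f: "f \<in> carrier AR" "nrm (fls_nth f 0) = 1"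
  shows "f \<in> Units AR"
proof -
  have f0: "fls_nth f 0 \<noteq> 0" using f(2) by auto
  then have fn0: "f \<noteq> 0" by auto
  have sd: "fls_subdegree f = 0"
    using f f0 by (intro fls_subdegree_eqI) (auto simp: AR_iff)
  define g where "g = inverse f"
  have fg: "f * g = 1" using fn0 by (simp add: g_def)
  have sg: "fls_subdegree g = 0" by (simp add: g_def fls_inverse_subdegree sd)
  have g_neg: "fls_nth g n = 0" if "n < 0" for n using sg that by simp
  have "nrm (fls_nth g (int n)) \<le> 1" for n
  proof (induction n rule: less_induct)
    case (less n)
    have "fls_nth (f * g) (int n) = (\<Sum>i=0..int n. fls_nth f i * fls_nth g (int n - i))"
      using fls_times_nth(2)[of f g "int n"] sd sg by simp
    also have "{0..int n} = insert 0 {1..int n}" by auto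
    also have "(\<Sum>i\<in>insert 0 {1..int n}. fls_nth f i * fls_nth g (int n - i)) =
        fls_nth f 0 * fls_nth g (int n) + (\<Sum>i=1..int n. fls_nth f i * fls_nth g (int n - i))" by simp
    finally have eq: "fls_nth f 0 * fls_nth g (int n) =
        fls_nth 1 (int n) + - (\<Sum>i=1..int n. fls_nth f i * fls_nth g (int n - i))"
      unfolding fg by simp
    have "nrm (\<Sum>i=1..int n. fls_nth f i * fls_nth g (int n - i)) \<le> 1"
    proof (rule nrm_sum_le)
      fix i assume i: "i \<in> {1..int n}"
      then have "int n - i = int (nat (int n - i))" "nat (int n - i) < n" by auto
      then have "nrm (fls_nth g (int n - i)) \<le> 1" using less by metis
      then show "nrm (fls_nth f i * fls_nth g (int n - i)) \<le> 1"
        using f(1) by (simp add: nrm_mult AR_iff mult_le_one)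
    qed simp
    moreover have "nrm (fls_nth 1 (int n)) \<le> 1" by simp
    ultimately have "nrm (fls_nth f 0 * fls_nth g (int n)) \<le> 1"
      unfolding eq using nrm_add_le[of "fls_nth 1 (int n)" "- (\<Sum>i=1..int n. fls_nth f i * fls_nth g (int n - i))"]
      by simp
    then show ?case using f(2) by (simp add: nrm_mult)
  qed
  then have "nrm (fls_nth g n) \<le> 1" for n
    using g_neg[of n] by (cases "n < 0") (auto, metis int_nat_eq not_less)
  then have "g \<in> carrier AR" using g_neg by (simp add: AR_iff)
  then show ?thesis unfolding Units_def using f(1) fg by (auto simp: mult.commute)
qed

text \<open>Series with constant term in the maximal ideal of R form an ideal that contains all
  nonunits but not 1, so nonunits cannot generate the unit ideal.\<close>

lemma AR_local:
  assumes "cring AR" "S \<subseteq> carrier AR" "Idl\<^bsub>AR\<^esub> S = carrier AR"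
  shows "S \<inter> Units AR \<noteq> {}"
proof
  interpret A: cring AR by fact
  assume S: "S \<inter> Units AR = {}"
  let ?I = "{f \<in> carrier AR. nrm (fls_nth f 0) < 1}"
  have neg: "\<ominus>\<^bsub>AR\<^esub> f = - f" if "f \<in> carrier AR" for f
    using that by (intro A.minus_equality) (auto simp: AR_iff)
  have "ideal ?I AR"
  proof (rule idealI[OF A.ring_axioms])
    show "subgroup ?I (add_monoid AR)"
    proof (rule A.add.subgroupI)
      show "?I \<noteq> {}" using A.zero_closed by (auto intro!: exI[of _ 0])
      show "\<ominus>\<^bsub>AR\<^esub> f \<in> ?I" if "f \<in> ?I" for f
        using that neg[of f] A.a_inv_closed[of f] by simp
      show "f \<oplus>\<^bsub>AR\<^esub> g \<in> ?I" if "f \<in> ?I" "g \<in> ?I" for f g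
        using that A.a_closed[of f g] by (simp add: nrm_add_less)
    qed auto
    fix f g assume f: "f \<in> ?I" and g: "g \<in> carrier AR"
    then have "nrm (fls_nth f 0) < 1" "nrm (fls_nth g 0) \<le> 1" by (auto simp: AR_iff)
    then have "nrm (fls_nth f 0) * nrm (fls_nth g 0) < 1"
      using mult_left_le[of "nrm (fls_nth g 0)" "nrm (fls_nth f 0)"] by simp
    then show "g \<otimes>\<^bsub>AR\<^esub> f \<in> ?I" "f \<otimes>\<^bsub>AR\<^esub> g \<in> ?I"
      using f g A.m_closed[of f g] A.m_closed[of g f] by (simp_all add: AR_nth_0_mult nrm_mult mult.commute)
  qed
  moreover have "S \<subseteq> ?I"
  proof
    fix f assume f: "f \<in> S"
    then have c: "f \<in> carrier AR" "f \<notin> Units AR" using S assms(2) by blast+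
    then have "nrm (fls_nth f 0) \<noteq> 1" "nrm (fls_nth f 0) \<le> 1" "f \<in> carrier AR"
      using AR_unitI[of f] by (blast, simp_all add: AR_iff)
    then show "f \<in> ?I" by simp
  qed
  ultimately have "Idl\<^bsub>AR\<^esub> S \<subseteq> ?I" by (rule A.genideal_minimal)
  then have "\<one>\<^bsub>AR\<^esub> \<in> ?I" using assms(3) A.one_closed by blast
  then show False by simp
qed

section \<open>From lattices to bases\<close>

lemma module_AR:
  assumes "module BR M" "cring AR" shows "module AR M"
proof -
  interpret M: module BR M by fact
  show ?thesis
    using M.smult_l_distr M.smult_r_distr M.smult_assoc1 M.smult_one
    by (intro moduleI assms(2) M.abelian_group_axioms) (simp_all add: AR_subset_BR)
qed

text \<open>The sum of the absolute values of the subdegrees bounds each pole order, so one power of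
  z clears all denominators.\<close>

lemma zpow_clear:
  fixes n :: nat
  assumes "\<And>i. i < n \<Longrightarrow> c i \<in> carrier BR"
  shows "\<exists>k. \<forall>i<n. zpow k * c i \<in> carrier AR"
proof -
  have "fls_nth (zpow k * c i) j = 0"
    if "i < n" "j < 0" "k = (\<Sum>i<n. \<bar>fls_subdegree (c i)\<bar>)" for i j k
  proof -
    have "\<bar>fls_subdegree (c i)\<bar> \<le> k"
      unfolding that(3) using that(1) by (intro member_le_sum[of i "{..<n}" "\<lambda>i. \<bar>fls_subdegree (c i)\<bar>"]) auto
    then show ?thesis unfolding zpow_nth using that(2) by simp
  qed
  then show ?thesis
    using assms by (intro exI[of _ "\<Sum>i<n. \<bar>fls_subdegree (c i)\<bar>"]) (simp add: AR_iff BR_iff zpow_nth)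
qed

text \<open>The lattice \<open>T\<close> has basis \<open>e\<close> and the \<open>R[[z]]\<close>-span of \<open>\<tau>\<^sup>r T\<close> is \<open>z\<^sup>s T\<close>.\<close>

definition frame :: "('k fls, 'm) tau_module \<Rightarrow> 'm set \<Rightarrow> nat \<Rightarrow> (nat \<Rightarrow> 'm) \<Rightarrow> nat \<Rightarrow> int \<Rightarrow> bool" where
  "frame M T n e r s \<longleftrightarrow> module AR M \<and> is_basis AR (M\<lparr>carrier := T\<rparr>) n e \<and> is_basis BR M n e \<and> T \<subseteq> carrier M \<and>
     (\<forall>t\<in>T. \<exists>t'\<in>T. (tau M ^^ r) t = zpow s \<odot>\<^bsub>M\<^esub> t') \<and>
     (\<forall>H. submodule H AR M \<longrightarrow> (tau M ^^ r) ` T \<subseteq> H \<longrightarrow> (\<forall>t\<in>T. zpow s \<odot>\<^bsub>M\<^esub> t \<in> H))"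

lemma frameD:
  assumes "frame M T n e r s"
  shows "module AR M" "is_basis AR (M\<lparr>carrier := T\<rparr>) n e" "is_basis BR M n e" "T \<subseteq> carrier M"
    "t \<in> T \<Longrightarrow> \<exists>t'\<in>T. (tau M ^^ r) t = zpow s \<odot>\<^bsub>M\<^esub> t'"
    "submodule H AR M \<Longrightarrow> (\<And>t. t \<in> T \<Longrightarrow> (tau M ^^ r) t \<in> H) \<Longrightarrow> t \<in> T \<Longrightarrow> zpow s \<odot>\<^bsub>M\<^esub> t \<in> H"
  using assms unfolding frame_def image_subset_iff by blast+

lemma frame_basis_expand:
  assumes "frame M T n e r s" "t \<in> T"
  shows "\<exists>c. (\<forall>i<n. c i \<in> carrier AR) \<and> t = lincomb M n c e"
  using is_basisD(2)[OF frameD(2)[OF assms(1)], of t] assms(2) by (simp add: lincomb_update_carrier)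

text \<open>Locality of R[[z]] makes \<open>T\<close> free. Its basis spans \<open>M\<close> over
  R((z)) because inverting z turns \<open>T\<close> into \<open>M\<close>, and it stays independent
  because a power of z clears the denominators of a relation.\<close>

lemma frame_exists:
  assumes "pure_isocrystal q v M"
  shows "\<exists>T n e r s. r > 0 \<and> frame M T n e r s"
proof -
  have M: "module BR M"
    using assms unfolding pure_isocrystal_def isocrystal_def etale_tau_module_def locally_free_finite_type_def by blast
  interpret M: module BR M by fact
  obtain s r T where r: "r > 0" and lat: "lattice_in v M T" and
    span: "power_series_span v M ((tau M ^^ r) ` T) = (\<lambda>t. zpow s \<odot>\<^bsub>M\<^esub> t) ` T"
    using assms unfolding pure_isocrystal_def by blast
  have sub: "submodule T AR M" and lf: "locally_free_finite_type AR (M\<lparr>carrier := T\<rparr>)"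
    and gen: "{zpow (- int n) \<odot>\<^bsub>M\<^esub> t | n t. t \<in> T} = carrier M"
    using lat unfolding lattice_in_def by blast+
  have MT: "module AR (M\<lparr>carrier := T\<rparr>)" using lf unfolding locally_free_finite_type_def by blast
  then interpret T: module AR "M\<lparr>carrier := T\<rparr>" .
  \<comment> \<open>\<open>locally_free_finite_type\<close> includes the module axioms over
    \<open>AR\<close>, and with them that \<open>AR\<close> is a commutative ring.\<close>
  have A: "cring AR" by (rule T.is_cring)
  interpret MA: module AR M by (rule module_AR[OF M A])
  have TM: "T \<subseteq> carrier M" by (rule MA.submoduleE(1)[OF sub])
  have "free_finite_rank AR (M\<lparr>carrier := T\<rparr>)"
    by (rule T.R.free_of_locally_free[OF lf]) (rule AR_local[OF A])
  then obtain n e where b: "is_basis AR (M\<lparr>carrier := T\<rparr>) n e" using T.free_finite_rank_iff by blast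
  have eT: "e i \<in> T" if "i < n" for i using is_basisD(1)[OF b that] by simp
  have e: "e i \<in> carrier M" if "i < n" for i using eT[OF that] TM by blast
  have "is_basis BR M n e"
    unfolding is_basis_def
  proof (intro conjI allI impI ballI)
    fix x assume "x \<in> carrier M"
    then obtain k t where t: "t \<in> T" "x = zpow (- int k) \<odot>\<^bsub>M\<^esub> t" using gen by blast
    obtain c where c: "\<forall>i<n. c i \<in> carrier AR" "t = lincomb M n c e"
      using is_basisD(2)[OF b, of t, unfolded lincomb_update_carrier] t(1) by (simp, blast)
    then have cB: "c i \<in> carrier BR" if "i < n" for i using that AR_subset_BR by blast
    have "x = lincomb M n (\<lambda>i. zpow (- int k) \<otimes>\<^bsub>BR\<^esub> c i) e"
      unfolding t(2) c(2) by (rule M.lincomb_smult[OF zpow_BR cB e])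
    moreover have "zpow (- int k) \<otimes>\<^bsub>BR\<^esub> c i \<in> carrier BR" if "i < n" for i
      by (rule M.R.m_closed[OF zpow_BR cB[OF that]])
    ultimately show "\<exists>c. (\<forall>i<n. c i \<in> carrier BR) \<and> x = lincomb M n c e"
      by (intro exI[of _ "\<lambda>i. zpow (- int k) \<otimes>\<^bsub>BR\<^esub> c i"]) blast
  next
    fix c i assume c: "\<forall>i<n. c i \<in> carrier BR" "lincomb M n c e = \<zero>\<^bsub>M\<^esub>" and i: "i < n"
    obtain k where k: "\<forall>i<n. zpow k * c i \<in> carrier AR" using zpow_clear[of n c] c(1) by blast
    have "lincomb M n (\<lambda>i. zpow k \<otimes>\<^bsub>BR\<^esub> c i) e = zpow k \<odot>\<^bsub>M\<^esub> lincomb M n c e"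
      by (rule M.lincomb_smult[OF zpow_BR _ e, symmetric]) (use c(1) in blast)
    then have "lincomb M n (\<lambda>i. zpow k * c i) e = \<zero>\<^bsub>M\<^esub>" using c(2) by simp
    then have "zpow k * c i = \<zero>\<^bsub>AR\<^esub>"
      using is_basisD(3)[OF b, of "\<lambda>i. zpow k * c i" i] k i by (simp add: lincomb_update_carrier)
    then show "c i = \<zero>\<^bsub>BR\<^esub>" by simp
  qed (rule e)
  \<comment> \<open>The equality of the span with z^s T is split into its two inclusions: tau^r T
    lies in z^s T, and z^s T lies in every R[[z]]-submodule containing tau^r T.\<close>
  moreover have "\<exists>t'\<in>T. (tau M ^^ r) t = zpow s \<odot>\<^bsub>M\<^esub> t'" if "t \<in> T" for t
  proof -
    have "(tau M ^^ r) t \<in> power_series_span v M ((tau M ^^ r) ` T)"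
      unfolding power_series_span_def using that by blast
    then show ?thesis unfolding span by blast
  qed
  moreover have "zpow s \<odot>\<^bsub>M\<^esub> t \<in> H" if "submodule H AR M" "(tau M ^^ r) ` T \<subseteq> H" "t \<in> T" for H t
  proof -
    have "zpow s \<odot>\<^bsub>M\<^esub> t \<in> power_series_span v M ((tau M ^^ r) ` T)" unfolding span using that by blast
    then show ?thesis unfolding power_series_span_def using that by blast
  qed
  ultimately have "frame M T n e r s"
    unfolding frame_def using b TM MA.module_axioms by (intro conjI ballI allI impI) simp_all
  then show ?thesis using r by blast
qed

text \<open>Serves to pull a test submodule of a frame back along tau^r or along multiplication by a
  power of z.\<close>

lemma submodule_vimage:
  assumes "module AR M" "submodule H AR M" "semilin AR \<sigma> M M f" "\<sigma> \<in> carrier AR \<rightarrow> carrier AR"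
  shows "submodule {x \<in> carrier M. f x \<in> H} AR M"
proof -
  interpret M: module AR M by fact
  note H = M.submoduleE[OF assms(2)] and f = semilinD[OF assms(3)]
  have f0: "f \<zero>\<^bsub>M\<^esub> = \<zero>\<^bsub>M\<^esub>" by (rule semilin_zero[OF M.abelian_group_axioms M.abelian_group_axioms assms(3)])
  obtain h where "h \<in> H" using H(2) by blast
  then have "h \<oplus>\<^bsub>M\<^esub> \<ominus>\<^bsub>M\<^esub> h \<in> H" "h \<in> carrier M" using H(1,3,5) by blast+
  then have H0: "\<zero>\<^bsub>M\<^esub> \<in> H" by (simp add: M.r_neg)
  show ?thesis
  proof (rule M.submoduleI)
    fix x assume x: "x \<in> {x \<in> carrier M. f x \<in> H}"
    have "f (\<ominus>\<^bsub>M\<^esub> x) \<oplus>\<^bsub>M\<^esub> f x = \<zero>\<^bsub>M\<^esub>"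
      using x f(2)[of "\<ominus>\<^bsub>M\<^esub> x" x] f0 by (simp add: M.l_neg)
    then have "\<ominus>\<^bsub>M\<^esub> f x = f (\<ominus>\<^bsub>M\<^esub> x)" using x by (intro M.minus_equality f(1)) auto
    then show "\<ominus>\<^bsub>M\<^esub> x \<in> {x \<in> carrier M. f x \<in> H}" using x H(3)[of "f x"] by simp
  next
    fix a x assume a: "a \<in> carrier AR" and x: "x \<in> {x \<in> carrier M. f x \<in> H}"
    then have "\<sigma> a \<odot>\<^bsub>M\<^esub> f x \<in> H" using H(4) assms(4) by blast
    then show "a \<odot>\<^bsub>M\<^esub> x \<in> {x \<in> carrier M. f x \<in> H}" using a x f(3)[of a x] by simp
  next
    fix x y assume "x \<in> {x \<in> carrier M. f x \<in> H}" "y \<in> {x \<in> carrier M. f x \<in> H}"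
    then show "x \<oplus>\<^bsub>M\<^esub> y \<in> {x \<in> carrier M. f x \<in> H}" using f(2)[of x y] H(5) by simp
  qed (auto simp: f0 H0)
qed

end

section \<open>Powers of tau on lattices\<close>

locale isocrystal_frob = complete_valued_field q v
    + tau_tensor "laurent_ring v" "disc_ring q v" fls_nth M "laurent_frob q" "disc_frob q"
  for q :: nat and v :: "'k::field \<Rightarrow> int" and M :: "('k fls, 'm) tau_module"
begin

lemma tau_funpow_semilin: "semilin BR (laurent_frob q ^^ r) M M (tau M ^^ r)"
  by (rule semilin_funpow[OF tau_semilin]) (use ring_hom_closed[OF laurent_frob_hom] in blast)

lemma tau_funpow_semilin_AR: "semilin AR (laurent_frob q ^^ r) M M (tau M ^^ r)"
  using tau_funpow_semilin[of r] AR_subset_BR unfolding semilin_def by blast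

lemma tau_funpow_zpow:
  "x \<in> carrier M \<Longrightarrow> (tau M ^^ r) (zpow s \<odot>\<^bsub>M\<^esub> x) = zpow s \<odot>\<^bsub>M\<^esub> (tau M ^^ r) x"
  using semilinD(3)[OF tau_funpow_semilin zpow_BR] by (simp add: frob_funpow_zpow)

lemma zpow_smult_zpow:
  "x \<in> carrier M \<Longrightarrow> zpow a \<odot>\<^bsub>M\<^esub> (zpow b \<odot>\<^bsub>M\<^esub> x) = zpow (a + b) \<odot>\<^bsub>M\<^esub> x"
  using M.smult_assoc1[OF zpow_BR zpow_BR, of x a b] by (simp add: zpow_mult)

lemma zpow_semilin_AR: "semilin AR (\<lambda>b. b) M M (\<lambda>x. zpow s \<odot>\<^bsub>M\<^esub> x)"
  unfolding semilin_def
proof (intro conjI ballI)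
  fix b x assume b: "b \<in> carrier AR" and x: "x \<in> carrier M"
  then show "zpow s \<odot>\<^bsub>M\<^esub> (b \<odot>\<^bsub>M\<^esub> x) = b \<odot>\<^bsub>M\<^esub> (zpow s \<odot>\<^bsub>M\<^esub> x)"
    using M.smult_assoc1[of "zpow s" b x] M.smult_assoc1[of b "zpow s" x] AR_subset_BR
    by (simp add: mult.commute)
qed (auto simp: M.smult_r_distr)

text \<open>Lets two pure isocrystals share the exponent of tau, so that their slopes have a common
  denominator. The induction works because Frobenius fixes z, hence tau^r commutes with powers of
  z.\<close>

lemma frame_power:
  assumes "frame M L n e r s"
  shows "frame M L n e (r * k) (s * int k)"
proof -
  note fr = frameD[OF assms]
  interpret MA: module AR M by (rule fr(1))
  have frobA: "laurent_frob q ^^ r \<in> carrier AR \<rightarrow> carrier AR" using frob_funpow_AR by blast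
  have TM: "t \<in> carrier M" if "t \<in> L" for t using fr(4) that by blast
  have "(\<forall>t\<in>L. \<exists>t'\<in>L. (tau M ^^ (r * k)) t = zpow (s * int k) \<odot>\<^bsub>M\<^esub> t') \<and>
     (\<forall>H. submodule H AR M \<longrightarrow> (tau M ^^ (r * k)) ` L \<subseteq> H \<longrightarrow> (\<forall>t\<in>L. zpow (s * int k) \<odot>\<^bsub>M\<^esub> t \<in> H))"
  proof (induction k)
    case 0
    have "1 \<odot>\<^bsub>M\<^esub> t = t" if "t \<in> L" for t using M.smult_one[OF TM[OF that]] by simp
    then show ?case by (auto simp: image_subset_iff)
  next
    case (Suc k)
    have tk: "(tau M ^^ (r * Suc k)) x = (tau M ^^ r) ((tau M ^^ (r * k)) x)" for x
      by (simp add: funpow_add)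
    have sk: "s * int (Suc k) = s * int k + s" by (simp add: algebra_simps)
    show ?case
    proof (intro conjI ballI allI impI)
      fix t assume "t \<in> L"
      then obtain t' where t': "t' \<in> L" "(tau M ^^ (r * k)) t = zpow (s * int k) \<odot>\<^bsub>M\<^esub> t'" using Suc by blast
      obtain t'' where t'': "t'' \<in> L" "(tau M ^^ r) t' = zpow s \<odot>\<^bsub>M\<^esub> t''" using fr(5) t'(1) by blast
      have "(tau M ^^ (r * Suc k)) t = zpow (s * int (Suc k)) \<odot>\<^bsub>M\<^esub> t''"
        unfolding tk t'(2) sk using t' t'' TM by (simp add: tau_funpow_zpow zpow_smult_zpow)
      then show "\<exists>t'\<in>L. (tau M ^^ (r * Suc k)) t = zpow (s * int (Suc k)) \<odot>\<^bsub>M\<^esub> t'" using t''(1) by blast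
    next
      fix H t assume H: "submodule H AR M" "(tau M ^^ (r * Suc k)) ` L \<subseteq> H" and t: "t \<in> L"
      have "submodule {x \<in> carrier M. (tau M ^^ r) x \<in> H} AR M"
        by (rule submodule_vimage[OF fr(1) H(1) tau_funpow_semilin_AR frobA])
      moreover have "(tau M ^^ (r * k)) ` L \<subseteq> {x \<in> carrier M. (tau M ^^ r) x \<in> H}"
        using H(2) semilinD(1)[OF tau_funpow_semilin] TM unfolding image_subset_iff tk by blast
      ultimately have 1: "zpow (s * int k) \<odot>\<^bsub>M\<^esub> x \<in> {x \<in> carrier M. (tau M ^^ r) x \<in> H}" if "x \<in> L" for x
        using Suc that by blast
      \<comment> \<open>The first pullback gave that z^(s k) tau^r x lies in \<open>H\<close> for x
        in \<open>L\<close>; hence this second one contains tau^r L, and minimality puts z^s L into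
        it.\<close>
      have "submodule {x \<in> carrier M. zpow (s * int k) \<odot>\<^bsub>M\<^esub> x \<in> H} AR M"
        by (rule submodule_vimage[OF fr(1) H(1) zpow_semilin_AR]) simp
      then have "zpow s \<odot>\<^bsub>M\<^esub> t \<in> {x \<in> carrier M. zpow (s * int k) \<odot>\<^bsub>M\<^esub> x \<in> H}"
      proof (rule fr(6)[OF _ _ t])
        fix x assume x: "x \<in> L"
        show "(tau M ^^ r) x \<in> {x \<in> carrier M. zpow (s * int k) \<odot>\<^bsub>M\<^esub> x \<in> H}"
          using 1[OF x] TM[OF x] semilinD(1)[OF tau_funpow_semilin] by (simp add: tau_funpow_zpow)
      qed
      then show "zpow (s * int (Suc k)) \<odot>\<^bsub>M\<^esub> t \<in> H"
        unfolding sk using TM[OF t] by (simp add: zpow_smult_zpow)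
    qed
  qed
  then show ?thesis using fr(1-4) unfolding frame_def by blast
qed

end

lemma (in complete_valued_field) isocrystal_frobI:
  assumes "isocrystal q v M" shows "isocrystal_frob q v M"
proof -
  have et: "etale_tau_module BR (laurent_frob q) M" using assms by (simp add: isocrystal_def)
  then have M: "module BR M" and s: "semilin BR (laurent_frob q) M M (tau M)"
    unfolding etale_tau_module_def locally_free_finite_type_def semilinear_iff by blast+
  interpret M: module BR M by fact
  interpret C: cring CK by (rule CK_cring)
  show ?thesis
    by unfold_locales (simp_all add: fls_nth_hom disc_frob_hom laurent_frob_hom fls_nth_laurent_frob s)
qed


section \<open>Full faithfulness\<close>

text \<open>If \<open>s \<noteq> 0\<close>, the hypotheses in fact force \<open>P n a\<close> for all \<open>n\<close> and \<open>a\<close>.\<close>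

lemma valuation_bound_rigidity:
  fixes P :: "int \<Rightarrow> int \<Rightarrow> bool" and Q s :: int
  assumes Q: "Q \<ge> 2"
    and anti: "\<And>n a n' a'. P n a \<Longrightarrow> n' \<le> n \<Longrightarrow> a' \<le> a \<Longrightarrow> P n' a'"
    and small: "\<exists>n. P n 1" and bounded: "\<And>n. \<exists>a. P n a"
    and up: "\<And>n a. P n a \<Longrightarrow> P (n + s) (Q * a)"
    and down: "\<And>n b b'. P n b \<Longrightarrow> (\<And>w. Q * w \<ge> b \<Longrightarrow> w \<ge> b') \<Longrightarrow> P (n - s) b'"
  shows "(\<forall>n. P n 0) \<and> (\<exists>n. \<forall>a. P n a)"
proof -
  \<comment> \<open>As Q >= 2, every use of \<open>up\<close> raises a positive bound by at least 1,
    so unboundedly many uses exceed every bound.\<close>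
  have Q_step: "Q * (1 + int k) \<ge> 1 + int (Suc k)" for k
    using mult_right_mono[OF Q, of "1 + int k"] by simp
  have all: "\<forall>a. P n a" if "\<And>k. P n (1 + int k)" for n
  proof
    fix a show "P n a" by (rule anti[OF that[of "nat a"]]) auto
  qed
  obtain n0 where n0: "P n0 1" using small by blast
  consider "s = 0" | "s > 0" | "s < 0" by linarith
  then show ?thesis
  proof cases
    \<comment> \<open>The cut-off stays put. \<open>up\<close> makes the bound 1 at
      \<open>n0\<close> grow without limit, and \<open>down\<close> improves a negative bound by one
      at a time, since an integer w <= -(k+1) has Q w <= -2(k+1).\<close>
    case 1
    have "P n0 (1 + int k)" for k
    proof (induction k)
      case (Suc k)
      then show ?case using up[of n0 "1 + int k"] anti[OF _ order_refl Q_step[of k]] 1 by simp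
    qed (use n0 in simp)
    moreover have "P n 0" for n
    proof -
      have "P n (- int k) \<Longrightarrow> P n 0" for k
      proof (induction k)
        case (Suc k)
        have "w \<ge> - int k" if "Q * w \<ge> - int (Suc k)" for w
        proof (rule ccontr)
          assume "\<not> w \<ge> - int k"
          then have "w \<le> - int (Suc k)" by simp
          then have "Q * w \<le> 2 * w" using Q by (intro mult_right_mono_neg) auto
          then show False using that \<open>w \<le> - int (Suc k)\<close> by linarith
        qed
        then have "P n (- int k)" using down[OF Suc.prems, of "- int k"] 1 by simp
        then show ?case by (rule Suc.IH)
      qed simp
      moreover obtain a where "P n a" using bounded by blast
      then have "P n (- int (nat (- a)))" by (rule anti) auto
      ultimately show ?thesis by blast
    qed
    ultimately show ?thesis using all by blast
  next
    \<comment> \<open>By monotonicity the bound 1 also holds \<open>k\<close> steps to the left of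
      \<open>n0\<close>; \<open>k\<close> uses of \<open>up\<close> lead back with a bound of at
      least 1 + k. Once all bounds hold at \<open>n0\<close>, \<open>up\<close> carries them to the
      right.\<close>
    case 2
    have *: "P n (1 + int k)" if "P (n - s * int k) 1" for n k
      using that
    proof (induction k arbitrary: n)
      case (Suc k)
      have "P (n - s) (1 + int k)" by (rule Suc.IH) (use Suc.prems in \<open>simp add: algebra_simps\<close>)
      then show ?case using up[of "n - s" "1 + int k"] anti[OF _ order_refl Q_step[of k]] by simp
    qed simp
    have "P n0 (1 + int k)" for k
      by (rule *, rule anti[OF n0]) (use 2 in auto)
    then have inf0: "\<forall>a. P n0 a" by (rule all)
    have "\<forall>a. P (n0 + s * int k) a" for k
    proof (induction k)
      case (Suc k)
      have "P (n0 + s * int (Suc k)) (1 + int j)" for j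
      proof -
        have "P (n0 + s * int k + s) (Q * (1 + int j))" using Suc up by blast
        moreover have "n0 + s * int (Suc k) \<le> n0 + s * int k + s" by (simp add: algebra_simps)
        moreover have "1 + int j \<le> Q * (1 + int j)" using Q_step[of j] by linarith
        ultimately show ?thesis by (rule anti)
      qed
      then show ?case by (rule all)
    qed (use inf0 in simp)
    moreover have "n \<le> n0 + s * int (nat (n - n0))" for n
    proof -
      have "int (nat (n - n0)) \<le> s * int (nat (n - n0))"
        using mult_right_mono[of 1 s "int (nat (n - n0))"] 2 by linarith
      then show ?thesis by linarith
    qed
    ultimately show ?thesis using anti order_refl by blast
  next
    \<comment> \<open>Now \<open>down\<close> moves the cut-off to the right and keeps the bound 1,
      as an integer w with Q w >= 1 is positive. With the bound 1 available at every cut-off,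
      \<open>up\<close> raises it everywhere.\<close>
    case 3
    have step: "P (n - s) 1" if "P n 1" for n
    proof (rule down[OF that])
      fix w assume "Q * w \<ge> 1"
      then have "0 < Q * w" by linarith
      then show "w \<ge> 1" using Q by (simp add: zero_less_mult_iff)
    qed
    have "P (n0 - s * int k) 1" for k
    proof (induction k)
      case (Suc k)
      then show ?case using step[of "n0 - s * int k"] by (simp add: algebra_simps)
    qed (use n0 in simp)
    moreover have "n \<le> n0 - s * int (nat (n - n0))" for n
    proof -
      have "int (nat (n - n0)) \<le> (- s) * int (nat (n - n0))" using mult_right_mono[of 1 "- s" "int (nat (n - n0))"] 3 by linarith
      moreover have "n - n0 \<le> int (nat (n - n0))" by simp
      ultimately show ?thesis unfolding mult_minus_left by linarith
    qed
    ultimately have one: "P n 1" for n using anti order_refl by blast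
    have "P n (1 + int k)" for n k
    proof (induction k arbitrary: n)
      case (Suc k)
      then show ?case using up[of "n - s" "1 + int k"] anti[OF _ order_refl Q_step[of k]] by simp
    qed (use one in simp)
    then have "\<forall>a. P n a" for n by (rule all)
    then show ?thesis by blast
  qed
qed

lemma uniform_bound:
  fixes Q :: "nat \<Rightarrow> int \<Rightarrow> bool"
  assumes "\<And>i. i < n \<Longrightarrow> \<exists>k. Q i k" "\<And>i k k'. Q i k \<Longrightarrow> k' \<le> k \<Longrightarrow> Q i k'"
  shows "\<exists>k. \<forall>i<n. Q i k"
  using assms(1)
proof (induction n)
  case (Suc n)
  then obtain k k' where k: "\<forall>i<n. Q i k" "Q n k'" by force
  have "Q i (min k k')" if "i < Suc n" for i
    using k that by (auto simp: less_Suc_eq intro: assms(2) min.cobounded1 min.cobounded2)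
  then show ?case by blast
qed simp

lemma (in module) submodule_of_closed:
  assumes "H \<subseteq> carrier M" "\<zero>\<^bsub>M\<^esub> \<in> H" "\<And>x y. x \<in> H \<Longrightarrow> y \<in> H \<Longrightarrow> x \<oplus>\<^bsub>M\<^esub> y \<in> H"
    "\<And>a x. a \<in> carrier R \<Longrightarrow> x \<in> H \<Longrightarrow> a \<odot>\<^bsub>M\<^esub> x \<in> H"
  shows "submodule H R M"
proof (rule submoduleI)
  fix x assume x: "x \<in> H"
  then have "(\<ominus> \<one>) \<odot>\<^bsub>M\<^esub> x \<in> H" by (intro assms(4)) auto
  then show "\<ominus>\<^bsub>M\<^esub> x \<in> H" using x assms(1) by (simp add: smult_l_minus subset_iff)
qed (use assms in auto)

context module
begin

definition lspan :: "nat \<Rightarrow> (nat \<Rightarrow> 'c) \<Rightarrow> 'c set" where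
  "lspan n e = {lincomb M n d e | d. \<forall>i<n. d i \<in> carrier R}"

lemma lspanI: "(\<And>i. i < n \<Longrightarrow> d i \<in> carrier R) \<Longrightarrow> lincomb M n d e \<in> lspan n e"
  unfolding lspan_def by blast

lemma lspanE:
  assumes "x \<in> lspan n e"
  obtains d where "\<forall>i<n. d i \<in> carrier R" "x = lincomb M n d e"
  using assms unfolding lspan_def by blast

text \<open>Makes the R[[z]]-span of the vectors tau^r(e_i) available as a test submodule in the
  minimality clause of \<open>frame\<close>.\<close>

lemma lspan_submodule:
  assumes "\<forall>i<n. e i \<in> carrier M"
  shows "submodule (lspan n e) R M"
proof (rule submodule_of_closed)
  note e = assms[rule_format]
  show "lspan n e \<subseteq> carrier M"
    unfolding lspan_def using e by blast
  show "\<zero>\<^bsub>M\<^esub> \<in> lspan n e"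
    using lspanI[of n "\<lambda>i. \<zero>" e] lincomb_zero[OF e] by simp
  fix x assume "x \<in> lspan n e"
  then obtain c where c: "\<forall>i<n. c i \<in> carrier R" "x = lincomb M n c e" by (rule lspanE)
  show "x \<oplus>\<^bsub>M\<^esub> y \<in> lspan n e" if y: "y \<in> lspan n e" for y
  proof -
    obtain d where d: "\<forall>i<n. d i \<in> carrier R" "y = lincomb M n d e" by (rule lspanE[OF y])
    have "x \<oplus>\<^bsub>M\<^esub> y = lincomb M n (\<lambda>i. c i \<oplus> d i) e"
      unfolding c(2) d(2) by (rule lincomb_add) (use c d e in blast)+
    also have "\<dots> \<in> lspan n e" by (rule lspanI) (use c d in blast)
    finally show ?thesis .
  qed
  show "a \<odot>\<^bsub>M\<^esub> x \<in> lspan n e" if a: "a \<in> carrier R" for a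
  proof -
    have "a \<odot>\<^bsub>M\<^esub> x = lincomb M n (\<lambda>i. a \<otimes> c i) e"
      unfolding c(2) by (rule lincomb_smult) (use c a e in blast)+
    also have "\<dots> \<in> lspan n e" by (rule lspanI) (use c a in blast)
    finally show ?thesis .
  qed
qed

end

section \<open>Valuation bounds on initial segments of coefficients\<close>

context complete_valued_field
begin

text \<open>\<open>Lb n a\<close> consists of the series whose coefficients at \<open>z\<^sup>j\<close>, \<open>j \<le> n\<close>, have valuation at least \<open>a\<close>; \<open>Lam\<close> is
  the set of vectors with such coordinates.\<close>

definition Lb :: "int \<Rightarrow> int \<Rightarrow> (int \<Rightarrow> 'k) set" where
  "Lb n a = {c. \<forall>j\<le>n. nrm (c j) \<le> real q powi (- a)}"

lemma Lb_iff: "c \<in> Lb n a \<longleftrightarrow> (\<forall>j\<le>n. c j = 0 \<or> v (c j) \<ge> a)"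
  by (simp only: Lb_def mem_Collect_eq nrm_le_iff)

lemma Lb_mono: "c \<in> Lb n a \<Longrightarrow> n' \<le> n \<Longrightarrow> a' \<le> a \<Longrightarrow> c \<in> Lb n' a'"
  unfolding Lb_iff by (meson order_trans)

lemma Lb_zero: "(\<lambda>n. 0) \<in> Lb n a"
  by (simp add: Lb_iff)

lemma Lb_add: "c \<in> Lb n a \<Longrightarrow> d \<in> Lb n a \<Longrightarrow> (\<lambda>j. c j + d j) \<in> Lb n a"
  unfolding Lb_def using nrm_add_le[THEN order_trans] by simp

text \<open>In the coefficient at z^m only terms f_i c_(m-i) with i >= k survive, so m - i <= n, and
  |f_i| <= 1 does not worsen the bound. For R[[z]] one takes k = 0, for z^k the cut-off shifts by
  k.\<close>

lemma Lb_mult: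
  assumes f: "f \<in> carrier BR" "\<And>j. j < k \<Longrightarrow> fls_nth f j = 0" and c: "c \<in> carrier CK" "c \<in> Lb n a"
  shows "fls_nth f \<star> c \<in> Lb (n + k) a"
  unfolding Lb_def
proof (intro CollectI allI impI)
  fix m assume m: "m \<le> n + k"
  show "nrm ((fls_nth f \<star> c) m) \<le> real q powi (- a)"
  proof (rule vsums_le[OF conv_vsums[OF fls_nth_closed[OF f(1)] c(1), of m]])
    fix i
    show "nrm (fls_nth f i * c (m - i)) \<le> real q powi (- a)"
    proof (cases "i < k")
      case False
      then have "nrm (c (m - i)) \<le> real q powi (- a)" using c(2) m unfolding Lb_def by auto
      moreover have "nrm (fls_nth f i) \<le> 1" using f(1) by (simp only: BR_iff)
      ultimately show ?thesis
        unfolding nrm_mult using mult_mono[of "nrm (fls_nth f i)" 1 "nrm (c (m - i))" "real q powi (- a)"] by simp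
    qed (simp add: f(2))
  qed simp
qed

lemma Lb_mult_AR: "f \<in> carrier AR \<Longrightarrow> c \<in> carrier CK \<Longrightarrow> c \<in> Lb n a \<Longrightarrow> fls_nth f \<star> c \<in> Lb n a"
  using Lb_mult[of f 0 c n a] AR_subset_BR[of f] by (simp add: AR_iff)

lemma Lb_mult_zpow: "c \<in> carrier CK \<Longrightarrow> c \<in> Lb n a \<Longrightarrow> fls_nth (zpow k) \<star> c \<in> Lb (n + k) a"
  by (rule Lb_mult) auto

lemma v_power: "x \<noteq> 0 \<Longrightarrow> v (x ^ m) = int m * v x"
  by (induction m) (simp_all add: v_mult algebra_simps)

lemma Lb_frob:
  assumes "c \<in> Lb n a" shows "(disc_frob q ^^ r) c \<in> Lb n (int (q ^ r) * a)"
  unfolding Lb_iff disc_frob_funpow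
proof (intro allI impI)
  fix j assume "j \<le> n"
  then have "c j = 0 \<or> a \<le> v (c j)" using assms unfolding Lb_iff by blast
  then show "c j ^ q ^ r = 0 \<or> int (q ^ r) * a \<le> v (c j ^ q ^ r)"
    using mult_left_mono[of a "v (c j)" "int (q ^ r)"] v_power[of "c j" "q ^ r"] q_pos
    by (cases "c j = 0") simp_all
qed

text \<open>The second assumption says that \<open>b'\<close> is at most b / q^r rounded up to an
  integer; integrality of valuations enters here.\<close>

lemma Lb_frob_inv:
  assumes "(disc_frob q ^^ r) c \<in> Lb n b" "\<And>w. int (q ^ r) * w \<ge> b \<Longrightarrow> w \<ge> b'"
  shows "c \<in> Lb n b'"
  unfolding Lb_iff
proof (intro allI impI)
  fix j assume "j \<le> n"
  then have "c j ^ q ^ r = 0 \<or> b \<le> v (c j ^ q ^ r)" using assms(1) unfolding Lb_iff disc_frob_funpow by blast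
  then show "c j = 0 \<or> b' \<le> v (c j)"
    using assms(2)[of "v (c j)"] v_power[of "c j" "q ^ r"] by (cases "c j = 0") simp_all
qed

text \<open>For j <= 0 the weights (1/2)^j are at least 1, so smallness of the weighted coefficients
  at -infinity gives smallness of the coefficients themselves.\<close>

lemma CK_Lb_small:
  assumes "c \<in> carrier CK" shows "\<exists>n. c \<in> Lb n a"
proof -
  let ?e = "1/2 :: real"
  have fin: "finite {j. real q powi (- a) \<le> wt ?e c j}" (is "finite ?S")
    using q_pos by (intro null_familyD CK_wt assms) auto
  define n where "n = Min (insert 0 ?S) - 1"
  have n: "n < j" if "j \<in> ?S" for j
    using Min_le[OF finite.insertI[OF fin] insertI2[OF that], of 0] unfolding n_def by linarith
  have "c \<in> Lb (min n 0) a"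
    unfolding Lb_def
  proof (intro CollectI allI impI)
    fix j assume j: "j \<le> min n 0"
    then have "j \<notin> ?S" using n[of j] by auto
    then have "wt ?e c j < real q powi (- a)" by simp
    moreover have one: "1 \<le> ?e powi j"
      using j one_le_power[of "2::real" "nat (- j)"] by (auto simp: power_int_def power_inverse)
    moreover have "nrm (c j) * 1 \<le> wt ?e c j" unfolding wt_def by (rule mult_left_mono[OF one]) simp
    ultimately show "nrm (c j) \<le> real q powi (- a)" by linarith
  qed
  then show ?thesis by blast
qed

text \<open>Up to some \<open>n0\<close> the coefficients are integral by
  \<open>CK_Lb_small\<close>; only finitely many remain up to \<open>n\<close>.\<close>

lemma CK_Lb_bounded:
  assumes "c \<in> carrier CK" shows "\<exists>a. c \<in> Lb n a"
proof -
  obtain n0 where n0: "c \<in> Lb n0 0" using CK_Lb_small[OF assms] by blast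
  define a where "a = Min (insert 0 ((\<lambda>j. v (c j)) ` {n0..n}))"
  have a: "a \<le> 0" "j \<in> {n0..n} \<Longrightarrow> a \<le> v (c j)" for j unfolding a_def by (rule Min_le; auto)+
  have "c j = 0 \<or> v (c j) \<ge> a" if "j \<le> n" for j
  proof (cases "j \<le> n0")
    case True
    then show ?thesis using n0 a(1) unfolding Lb_iff by force
  qed (use that a(2)[of j] in auto)
  then show ?thesis unfolding Lb_iff by blast
qed

text \<open>A coefficient whose valuation exceeds every bound is 0, so the principal part is finite;
  the bounds 0 at all cut-offs make the series integral.\<close>

lemma CK_in_BR:
  assumes "\<And>n. c \<in> Lb n 0" "\<And>a. c \<in> Lb n0 a"
  shows "\<exists>f\<in>carrier BR. c = fls_nth f"
proof -
  have z: "c j = 0" if "j \<le> n0" for j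
  proof (rule ccontr)
    assume "c j \<noteq> 0"
    then have "v (c j) \<ge> v (c j) + 1" using assms(2)[of "v (c j) + 1"] that unfolding Lb_iff by blast
    then show False by simp
  qed
  have nth: "fls_nth (Abs_fls c) j = c j" for j
    by (rule nth_Abs_fls_lower_bound[of n0]) (use z in simp)
  have "nrm (c j) \<le> 1" for j using assms(1)[of j] unfolding Lb_def by simp
  then have "Abs_fls c \<in> carrier BR" by (simp add: BR_iff nth)
  then show ?thesis using nth by (intro bexI[of _ "Abs_fls c"]) auto
qed

definition Lam :: "(int \<Rightarrow> 'k, 'x) module \<Rightarrow> nat \<Rightarrow> (nat \<Rightarrow> 'x) \<Rightarrow> int \<Rightarrow> int \<Rightarrow> 'x set" where
  "Lam D n g k a = {lincomb D n x g | x. \<forall>i<n. x i \<in> carrier CK \<and> x i \<in> Lb k a}"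

lemma LamI: "(\<And>i. i < n \<Longrightarrow> x i \<in> carrier CK) \<Longrightarrow> (\<And>i. i < n \<Longrightarrow> x i \<in> Lb k a) \<Longrightarrow> lincomb D n x g \<in> Lam D n g k a"
  unfolding Lam_def by blast

lemma LamE:
  assumes "X \<in> Lam D n g k a"
  obtains x where "\<forall>i<n. x i \<in> carrier CK \<and> x i \<in> Lb k a" "X = lincomb D n x g"
  using assms unfolding Lam_def by blast

lemma zpow_cancel:
  assumes "module CK D" and X: "X \<in> carrier D"
  shows "fls_nth (zpow (- s)) \<odot>\<^bsub>D\<^esub> (fls_nth (zpow s) \<odot>\<^bsub>D\<^esub> X) = X"
proof -
  interpret D: module CK D by fact
  have "fls_nth (zpow (- s)) \<star> fls_nth (zpow s) = \<one>\<^bsub>CK\<^esub>"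
    using ring_hom_mult[OF fls_nth_hom zpow_BR zpow_BR, of "- s" s] ring_hom_one[OF fls_nth_hom]
    by (simp only: BR_simps zpow_mult) simp
  then show ?thesis
    using D.smult_assoc1[OF fls_nth_closed[OF zpow_BR] fls_nth_closed[OF zpow_BR] X, of "- s" s] D.smult_one[OF X] by simp
qed

context
  fixes D :: "(int \<Rightarrow> 'k, 'x) module" and n :: nat and g :: "nat \<Rightarrow> 'x"
  assumes D: "module CK D" and gD: "\<forall>i<n. g i \<in> carrier D"
begin

interpretation D: module CK D by (rule D)

lemma Lam_zero: "\<zero>\<^bsub>D\<^esub> \<in> Lam D n g k a"
proof -
  have "lincomb D n (\<lambda>i. \<zero>\<^bsub>CK\<^esub>) g \<in> Lam D n g k a"
    by (rule LamI) (rule D.R.zero_closed, simp add: Lb_zero)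
  then show ?thesis using D.lincomb_zero[OF gD[rule_format]] by (simp only:)
qed

lemma Lam_add:
  assumes "X \<in> Lam D n g k a" "Y \<in> Lam D n g k a"
  shows "X \<oplus>\<^bsub>D\<^esub> Y \<in> Lam D n g k a"
proof -
  obtain x where x: "\<And>i. i < n \<Longrightarrow> x i \<in> carrier CK" "\<And>i. i < n \<Longrightarrow> x i \<in> Lb k a" "X = lincomb D n x g"
    using assms(1) unfolding Lam_def by blast
  obtain y where y: "\<And>i. i < n \<Longrightarrow> y i \<in> carrier CK" "\<And>i. i < n \<Longrightarrow> y i \<in> Lb k a" "Y = lincomb D n y g"
    using assms(2) unfolding Lam_def by blast
  have "X \<oplus>\<^bsub>D\<^esub> Y = lincomb D n (\<lambda>i. x i \<oplus>\<^bsub>CK\<^esub> y i) g"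
    unfolding x(3) y(3) by (rule D.lincomb_add[OF x(1) y(1) gD[rule_format]])
  also have "\<dots> \<in> Lam D n g k a"
    by (rule LamI, rule D.R.a_closed[OF x(1) y(1)]) (simp_all add: Lb_add x y)
  finally show ?thesis .
qed

lemma Lam_smult:
  assumes "f \<in> carrier BR" "X \<in> Lam D n g k a"
    "\<And>c. c \<in> carrier CK \<Longrightarrow> c \<in> Lb k a \<Longrightarrow> fls_nth f \<star> c \<in> Lb k' a"
  shows "fls_nth f \<odot>\<^bsub>D\<^esub> X \<in> Lam D n g k' a"
proof -
  obtain x where x: "\<And>i. i < n \<Longrightarrow> x i \<in> carrier CK" "\<And>i. i < n \<Longrightarrow> x i \<in> Lb k a" "X = lincomb D n x g"
    using assms(2) unfolding Lam_def by blast
  have f: "fls_nth f \<in> carrier CK" by (rule fls_nth_closed[OF assms(1)])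
  have "fls_nth f \<odot>\<^bsub>D\<^esub> X = lincomb D n (\<lambda>i. fls_nth f \<star> x i) g"
    unfolding x(3) by (rule D.lincomb_smult[OF f x(1) gD[rule_format]])
  also have "\<dots> \<in> Lam D n g k' a"
    by (rule LamI) (use x f assms(3) D.R.m_closed in blast)+
  finally show ?thesis .
qed

lemma Lam_smult_AR: "f \<in> carrier AR \<Longrightarrow> X \<in> Lam D n g k a \<Longrightarrow> fls_nth f \<odot>\<^bsub>D\<^esub> X \<in> Lam D n g k a"
  by (rule Lam_smult) (auto simp: AR_subset_BR Lb_mult_AR)

lemma Lam_smult_zpow: "X \<in> Lam D n g k a \<Longrightarrow> fls_nth (zpow s) \<odot>\<^bsub>D\<^esub> X \<in> Lam D n g (k + s) a"
  by (rule Lam_smult[OF zpow_BR]) (auto intro: Lb_mult_zpow)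

text \<open>The roles in \<open>Lam_smult\<close> are exchanged: the vector has coordinates in
  R[[z]] and the scalar carries the bound.\<close>

lemma Lam_scale:
  assumes "y \<in> carrier CK" "y \<in> Lb k a" "\<And>i. i < n \<Longrightarrow> d i \<in> carrier AR"
  shows "y \<odot>\<^bsub>D\<^esub> lincomb D n (\<lambda>i. fls_nth (d i)) g \<in> Lam D n g k a"
proof -
  have d: "fls_nth (d i) \<in> carrier CK" if "i < n" for i
    by (intro fls_nth_closed AR_subset_BR assms(3) that)
  have "y \<odot>\<^bsub>D\<^esub> lincomb D n (\<lambda>i. fls_nth (d i)) g = lincomb D n (\<lambda>i. y \<star> fls_nth (d i)) g"
    by (rule D.lincomb_smult[OF assms(1) d gD[rule_format]])
  also have "\<dots> \<in> Lam D n g k a"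
  proof (rule LamI)
    fix i assume i: "i < n"
    show "y \<star> fls_nth (d i) \<in> carrier CK" by (rule D.R.m_closed[OF assms(1) d[OF i]])
    show "y \<star> fls_nth (d i) \<in> Lb k a"
      using Lb_mult_AR[OF assms(3)[OF i] assms(1,2)] D.R.m_comm[OF assms(1) d[OF i]] by metis
  qed
  finally show ?thesis .
qed

lemma Lam_coords:
  assumes "is_basis CK D n g" "lincomb D n x g \<in> Lam D n g k a" "\<And>i. i < n \<Longrightarrow> x i \<in> carrier CK" "i < n"
  shows "x i \<in> Lb k a"
proof -
  obtain y where y: "\<And>i. i < n \<Longrightarrow> y i \<in> carrier CK" "\<And>i. i < n \<Longrightarrow> y i \<in> Lb k a" "lincomb D n x g = lincomb D n y g"
    using assms(2) unfolding Lam_def by blast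
  have "x i = y i" by (rule D.is_basis_unique[OF assms(1,3) y(1,3) assms(4)])
  then show ?thesis using y(2)[OF assms(4)] by simp
qed

end

end

section \<open>Full faithfulness for pure isocrystals\<close>

locale isocrystal_pair = complete_valued_field q v + M: isocrystal_frob q v M + N: isocrystal_frob q v N
  for q :: nat and v :: "'k::field \<Rightarrow> int" and M :: "('k fls, 'm) tau_module" and N :: "('k fls, 'n) tau_module"
begin

sublocale tau_tensor_pair "laurent_ring v" "disc_ring q v" fls_nth M N "laurent_frob q" "disc_frob q" ..

text \<open>Establishes the hypothesis \<open>im\<close> of \<open>map_bij_betw\<close>. The
  inclusions recorded in the two frames yield \<open>up\<close> and \<open>down\<close> for the
  coefficient bound \<open>P\<close> of the matrix of \<open>F\<close>, and
  \<open>valuation_bound_rigidity\<close> puts its entries into R((z)).\<close>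

lemma fullness:
  assumes F: "F \<in> tau_hom CK M.E N.E"
    and frM: "frame M L m e r s\<^sub>M" and frN: "frame N L' n e' r s\<^sub>N" and r: "r > 0"
    and tau_basis: "is_basis BR N n (\<lambda>i. (tau N ^^ r) (e' i))"
    and x: "x \<in> carrier M"
  shows "\<exists>y\<in>carrier N. F (M.pt \<one>\<^bsub>CK\<^esub> x) = N.pt \<one>\<^bsub>CK\<^esub> y"
proof -
  define uM where "uM = (\<lambda>x. M.pt \<one>\<^bsub>CK\<^esub> x)"
  define uN where "uN = (\<lambda>x. N.pt \<one>\<^bsub>CK\<^esub> x)"
  note fM = frameD[OF frM] and fN = frameD[OF frN]
  interpret MA: module AR M by (rule fM(1))
  interpret NA: module AR N by (rule fN(1))
  have uM: "semilin BR fls_nth M M.T uM" unfolding uM_def by (rule M.unit_semilin)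
  have uN: "semilin BR fls_nth N N.T uN" unfolding uN_def by (rule N.unit_semilin)
  have LM: "t \<in> carrier M" if "t \<in> L" for t using fM(4) that by blast
  have LN: "t \<in> carrier N" if "t \<in> L'" for t using fN(4) that by blast
  have eL: "e i \<in> L" if "i < m" for i using is_basisD(1)[OF fM(2) that] by simp
  have eL': "e' i \<in> L'" if "i < n" for i using is_basisD(1)[OF fN(2) that] by simp
  have Fs: "semilin CK (\<lambda>c. c) M.T N.T F"
    and Ft: "\<And>X. X \<in> carrier M.T \<Longrightarrow> F (tau M.E X) = tau N.E (F X)"
    using F by (auto simp: tau_hom_def linear_maps_E)
  have dfC: "disc_frob q \<in> carrier CK \<rightarrow> carrier CK" using disc_frob_closed by blast
  define t\<^sub>M where "t\<^sub>M = tau M ^^ r"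
  define t\<^sub>N where "t\<^sub>N = tau N ^^ r"
  define T\<^sub>N where "T\<^sub>N = tau N.E ^^ r"
  have tM: "semilin BR (laurent_frob q ^^ r) M M t\<^sub>M" unfolding t\<^sub>M_def by (rule M.tau_funpow_semilin)
  have tN: "semilin BR (laurent_frob q ^^ r) N N t\<^sub>N" unfolding t\<^sub>N_def by (rule N.tau_funpow_semilin)
  have TN: "semilin CK (disc_frob q ^^ r) N.T N.T T\<^sub>N"
    unfolding T\<^sub>N_def by (rule semilin_funpow[OF N.tau_E_semilin_T dfC])
  have frob_CK: "(disc_frob q ^^ r) c \<in> carrier CK" if "c \<in> carrier CK" for c
    using that by (induction r) (auto intro: disc_frob_closed)
  have TuN: "T\<^sub>N (uN y) = uN (t\<^sub>N y)" if "y \<in> carrier N" for y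
    unfolding T\<^sub>N_def t\<^sub>N_def uN_def using N.tau_E_funpow_unit[OF that] by blast
  have FT: "F (uM (t\<^sub>M y)) = T\<^sub>N (F (uM y))" if y: "y \<in> carrier M" for y
  proof -
    have "(tau M.E ^^ k) (uM y) \<in> carrier M.T \<and> F ((tau M.E ^^ k) (uM y)) = (tau N.E ^^ k) (F (uM y))" for k
    proof (induction k)
      case (Suc k)
      then show ?case using Ft semilinD(1)[OF M.tau_E_semilin_T] by simp
    qed (use semilinD(1)[OF uM y] in simp)
    then show ?thesis unfolding T\<^sub>N_def t\<^sub>M_def uM_def using M.tau_E_funpow_unit[OF y] by metis
  qed
  \<comment> \<open>Two bases of the target: \<open>g\<close> from the lattice, and
    \<open>h\<close>, the image of \<open>g\<close> under \<open>T\<^sub>N\<close>. In the basis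
    \<open>h\<close> the coordinates of the image of a vector under \<open>T\<^sub>N\<close> are the
    Frobenius twists of its coordinates in \<open>g\<close>.\<close>
  define g where "g = (\<lambda>i. uN (e' i))"
  define h where "h = (\<lambda>i. uN (t\<^sub>N (e' i)))"
  have bg: "is_basis CK N.T n g" unfolding g_def uN_def by (rule N.basis_base_change[OF fN(3)])
  have bh: "is_basis CK N.T n h" unfolding h_def uN_def t\<^sub>N_def by (rule N.basis_base_change[OF tau_basis])
  have gc: "\<forall>i<n. g i \<in> carrier N.T" and hc: "\<forall>i<n. h i \<in> carrier N.T"
    using is_basisD(1)[OF bg] is_basisD(1)[OF bh] by blast+
  note DN = N.T.module_axioms
  have smult_comm: "a \<odot>\<^bsub>N.T\<^esub> (b \<odot>\<^bsub>N.T\<^esub> Y) = b \<odot>\<^bsub>N.T\<^esub> (a \<odot>\<^bsub>N.T\<^esub> Y)"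
    if "a \<in> carrier CK" "b \<in> carrier CK" "Y \<in> carrier N.T" for a b Y
  proof -
    have "a \<odot>\<^bsub>N.T\<^esub> (b \<odot>\<^bsub>N.T\<^esub> Y) = (a \<star> b) \<odot>\<^bsub>N.T\<^esub> Y"
      by (rule N.T.smult_assoc1[OF that, symmetric])
    also have "\<dots> = (b \<star> a) \<odot>\<^bsub>N.T\<^esub> Y"
      by (rule arg_cong[OF CK_mult_comm[OF that(1,2)]])
    also have "\<dots> = b \<odot>\<^bsub>N.T\<^esub> (a \<odot>\<^bsub>N.T\<^esub> Y)"
      by (rule N.T.smult_assoc1[OF that(2,1,3)])
    finally show ?thesis .
  qed
  have uM_zpow: "uM (zpow s \<odot>\<^bsub>M\<^esub> y) = fls_nth (zpow s) \<odot>\<^bsub>M.T\<^esub> uM y" if "y \<in> carrier M" for s y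
    by (rule semilinD(3)[OF uM zpow_BR that])
  have F_zpow: "F (uM (zpow s \<odot>\<^bsub>M\<^esub> y)) = fls_nth (zpow s) \<odot>\<^bsub>N.T\<^esub> F (uM y)" if "y \<in> carrier M" for s y
    unfolding uM_zpow[OF that]
    by (rule semilinD(3)[OF Fs fls_nth_closed[OF zpow_BR] semilinD(1)[OF uM that]])
  have uN_zpow: "uN (zpow s \<odot>\<^bsub>N\<^esub> y) = fls_nth (zpow s) \<odot>\<^bsub>N.T\<^esub> uN y" if "y \<in> carrier N" for s y
    by (rule semilinD(3)[OF uN zpow_BR that])
  have uM_lc: "F (uM (lincomb M m c e)) = lincomb N.T m (\<lambda>i. fls_nth (c i)) (\<lambda>i. F (uM (e i)))"
    if c: "\<And>i. i < m \<Longrightarrow> c i \<in> carrier BR" for c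
  proof -
    have ec: "e i \<in> carrier M" if "i < m" for i using eL[OF that] LM by blast
    have "uM (lincomb M m c e) = lincomb M.T m (\<lambda>i. fls_nth (c i)) (\<lambda>i. uM (e i))"
      by (rule semilin_lincomb[OF M.M.module_axioms M.T.module_axioms uM c ec])
    also have "F \<dots> = lincomb N.T m (\<lambda>i. fls_nth (c i)) (\<lambda>i. F (uM (e i)))"
      by (rule semilin_lincomb[OF M.T.module_axioms DN Fs fls_nth_closed[OF c] semilinD(1)[OF uM ec]])
    finally show ?thesis .
  qed
  have "\<exists>X. \<forall>j<m. (\<forall>i<n. X j i \<in> carrier CK) \<and> F (uM (e j)) = lincomb N.T n (X j) g"
  proof -
    have "\<exists>c. (\<forall>i<n. c i \<in> carrier CK) \<and> F (uM (e j)) = lincomb N.T n c g" if "j < m" for j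
      by (rule is_basisD(2)[OF bg semilinD(1)[OF Fs semilinD(1)[OF uM LM[OF eL[OF that]]]]])
    then show ?thesis by metis
  qed
  then obtain X where X: "\<And>j i. j < m \<Longrightarrow> i < n \<Longrightarrow> X j i \<in> carrier CK"
    and FX: "\<And>j. j < m \<Longrightarrow> F (uM (e j)) = lincomb N.T n (X j) g" by blast
  define P where "P = (\<lambda>k a. \<forall>j<m. \<forall>i<n. X j i \<in> Lb k a)"
  have P_Lam: "F (uM (e j)) \<in> Lam N.T n g k a" if "P k a" "j < m" for j k a
    unfolding FX[OF that(2)] by (rule LamI) (use X that in \<open>unfold P_def, blast+\<close>)
  \<comment> \<open>\<open>Lam\<close> is stable under R[[z]], so a bound on the images of the basis
    holds on the whole lattice.\<close>
  have L_Lam: "F (uM t) \<in> Lam N.T n g k a" if P: "P k a" and t: "t \<in> L" for t k a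
  proof -
    obtain c where c: "\<And>i. i < m \<Longrightarrow> c i \<in> carrier AR" "t = lincomb M m c e"
      using frame_basis_expand[OF frM t] by blast
    have "lincomb N.T m (\<lambda>i. fls_nth (c i)) (\<lambda>i. F (uM (e i))) \<in> Lam N.T n g k a"
      by (rule lincomb_mem[OF Lam_zero[OF DN gc] Lam_add[OF DN gc] Lam_smult_AR[OF DN gc c(1) P_Lam[OF P]]])
    then show ?thesis unfolding c(2) by (subst uM_lc) (use c(1) AR_subset_BR in auto)
  qed
  \<comment> \<open>On F(tau^r t), for t in \<open>L\<close>, the twist multiplies bounds by Q, and
    the inclusion of tau^r L' in z^(s_N) L' moves the cut-off by s_N. Minimality then passes the
    bound from tau^r L to z^(s_M) L, and division by z^(s_M) leaves the shift s_N - s_M.\<close>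
  have up: "P (k + (s\<^sub>N - s\<^sub>M)) (int (q ^ r) * a)" if P: "P k a" for k a
  proof -
    let ?\<kappa> = "k + s\<^sub>N" and ?\<alpha> = "int (q ^ r) * a"
    have T_Lam: "T\<^sub>N Y \<in> Lam N.T n g ?\<kappa> ?\<alpha>" if Y: "Y \<in> Lam N.T n g k a" for Y
    proof -
      obtain y where y': "\<forall>i<n. y i \<in> carrier CK \<and> y i \<in> Lb k a" and Y_eq: "Y = lincomb N.T n y g"
        by (rule LamE[OF Y])
      have y: "y i \<in> carrier CK" "y i \<in> Lb k a" if "i < n" for i using y' that by simp_all
      have "T\<^sub>N Y = lincomb N.T n (\<lambda>i. (disc_frob q ^^ r) (y i)) (\<lambda>i. T\<^sub>N (g i))"
        unfolding Y_eq by (rule semilin_lincomb[OF DN DN TN y(1) gc[rule_format]])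
      also have "\<dots> \<in> Lam N.T n g ?\<kappa> ?\<alpha>"
      proof (rule lincomb_mem[OF Lam_zero[OF DN gc] Lam_add[OF DN gc]])
        fix i assume i: "i < n"
        let ?y = "(disc_frob q ^^ r) (y i)"
        have yi: "?y \<in> carrier CK" "?y \<in> Lb k ?\<alpha>" using frob_CK[OF y(1)[OF i]] Lb_frob[OF y(2)[OF i]] .
        obtain t where t: "t \<in> L'" "t\<^sub>N (e' i) = zpow s\<^sub>N \<odot>\<^bsub>N\<^esub> t"
          using fN(5)[OF eL'[OF i]] unfolding t\<^sub>N_def by blast
        obtain d where d: "\<And>i. i < n \<Longrightarrow> d i \<in> carrier AR" "t = lincomb N n d e'"
          using frame_basis_expand[OF frN t(1)] by blast
        have "uN t = lincomb N.T n (\<lambda>i. fls_nth (d i)) g"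
          unfolding d(2) g_def
          by (rule semilin_lincomb[OF N.M.module_axioms DN uN AR_subset_BR[OF d(1)] LN[OF eL']])
        then have "?y \<odot>\<^bsub>N.T\<^esub> uN t \<in> Lam N.T n g k ?\<alpha>" using Lam_scale[OF DN gc yi d(1)] by (simp only:)
        then have "fls_nth (zpow s\<^sub>N) \<odot>\<^bsub>N.T\<^esub> (?y \<odot>\<^bsub>N.T\<^esub> uN t) \<in> Lam N.T n g ?\<kappa> ?\<alpha>"
          by (rule Lam_smult_zpow[OF DN gc])
        moreover have "T\<^sub>N (g i) = fls_nth (zpow s\<^sub>N) \<odot>\<^bsub>N.T\<^esub> uN t"
          unfolding g_def TuN[OF LN[OF eL'[OF i]]] t(2) by (rule uN_zpow[OF LN[OF t(1)]])
        moreover have "?y \<odot>\<^bsub>N.T\<^esub> (fls_nth (zpow s\<^sub>N) \<odot>\<^bsub>N.T\<^esub> uN t) = fls_nth (zpow s\<^sub>N) \<odot>\<^bsub>N.T\<^esub> (?y \<odot>\<^bsub>N.T\<^esub> uN t)"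
          by (rule smult_comm[OF yi(1) fls_nth_closed[OF zpow_BR] semilinD(1)[OF uN LN[OF t(1)]]])
        ultimately show "?y \<odot>\<^bsub>N.T\<^esub> T\<^sub>N (g i) \<in> Lam N.T n g ?\<kappa> ?\<alpha>" by (simp only:)
      qed
      finally show ?thesis .
    qed
    \<comment> \<open>The submodule to which the minimality clause for \<open>M\<close> is
      applied.\<close>
    let ?H = "{y \<in> carrier M. F (uM y) \<in> Lam N.T n g ?\<kappa> ?\<alpha>}"
    have sub: "submodule ?H AR M"
    proof (rule MA.submodule_of_closed)
      have "F (uM \<zero>\<^bsub>M\<^esub>) = \<zero>\<^bsub>N.T\<^esub>"
        using semilin_zero[OF M.M.abelian_group_axioms M.T.abelian_group_axioms uM]
          semilin_zero[OF M.T.abelian_group_axioms N.T.abelian_group_axioms Fs] by simp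
      then show "\<zero>\<^bsub>M\<^esub> \<in> ?H" using Lam_zero[OF DN gc] by simp
      fix y assume y: "y \<in> ?H"
      { fix z assume z: "z \<in> ?H"
        have "F (uM (y \<oplus>\<^bsub>M\<^esub> z)) = F (uM y) \<oplus>\<^bsub>N.T\<^esub> F (uM z)"
          using semilinD(2)[OF uM] semilinD(2)[OF Fs] semilinD(1)[OF uM] y z by simp
        then show "y \<oplus>\<^bsub>M\<^esub> z \<in> ?H" using Lam_add[OF DN gc] y z by simp }
      fix c assume c: "c \<in> carrier AR"
      have "F (uM (c \<odot>\<^bsub>M\<^esub> y)) = fls_nth c \<odot>\<^bsub>N.T\<^esub> F (uM y)"
        using semilinD(3)[OF uM AR_subset_BR[OF c]] semilinD(3)[OF Fs fls_nth_closed[OF AR_subset_BR[OF c]]]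
          semilinD(1)[OF uM] y by simp
      then show "c \<odot>\<^bsub>M\<^esub> y \<in> ?H" using Lam_smult_AR[OF DN gc c] c y by simp
    qed blast
    have mem: "(tau M ^^ r) t \<in> ?H" if t: "t \<in> L" for t
      using T_Lam[OF L_Lam[OF P t]] FT[OF LM[OF t]] semilinD(1)[OF tM LM[OF t]] unfolding t\<^sub>M_def by simp
    have H: "zpow s\<^sub>M \<odot>\<^bsub>M\<^esub> t \<in> ?H" if "t \<in> L" for t by (rule fM(6)[OF sub mem that])
    show ?thesis
      unfolding P_def
    proof (intro allI impI)
      fix j i assume j: "j < m" and i: "i < n"
      have ej: "e j \<in> carrier M" by (rule LM[OF eL[OF j]])
      have "fls_nth (zpow s\<^sub>M) \<odot>\<^bsub>N.T\<^esub> F (uM (e j)) \<in> Lam N.T n g ?\<kappa> ?\<alpha>"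
        using H[OF eL[OF j]] F_zpow[OF ej] by simp
      then have "fls_nth (zpow (- s\<^sub>M)) \<odot>\<^bsub>N.T\<^esub> (fls_nth (zpow s\<^sub>M) \<odot>\<^bsub>N.T\<^esub> F (uM (e j))) \<in> Lam N.T n g (?\<kappa> + - s\<^sub>M) ?\<alpha>"
        by (rule Lam_smult_zpow[OF DN gc])
      then have "lincomb N.T n (X j) g \<in> Lam N.T n g (?\<kappa> + - s\<^sub>M) ?\<alpha>"
        unfolding zpow_cancel[OF DN semilinD(1)[OF Fs semilinD(1)[OF uM ej]]] unfolding FX[OF j] .
      then have "X j i \<in> Lb (?\<kappa> + - s\<^sub>M) ?\<alpha>" by (rule Lam_coords[OF DN gc bg _ X[OF j] i])
      then show "X j i \<in> Lb (k + (s\<^sub>N - s\<^sub>M)) ?\<alpha>" by (simp add: algebra_simps)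
    qed
  qed
  \<comment> \<open>The opposite inclusions are used now: tau^r(e_j) in z^(s_M) L bounds the twist
    of F(e_j) in the basis \<open>g\<close>, and z^(s_N) e'_i in the span of the tau^r(e'_i)
    converts this into a bound in the basis \<open>h\<close>, where the twist can be undone
    coordinatewise.\<close>
  have down: "P (k - (s\<^sub>N - s\<^sub>M)) b'" if P: "P k b" and bb: "\<And>w. int (q ^ r) * w \<ge> b \<Longrightarrow> w \<ge> b'" for k b b'
    unfolding P_def
  proof (intro allI impI)
    fix j i assume j: "j < m" and i: "i < n"
    have ej: "e j \<in> carrier M" by (rule LM[OF eL[OF j]])
    obtain t where t: "t \<in> L" "t\<^sub>M (e j) = zpow s\<^sub>M \<odot>\<^bsub>M\<^esub> t"
      using fM(5)[OF eL[OF j]] unfolding t\<^sub>M_def by blast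
    have "T\<^sub>N (F (uM (e j))) = fls_nth (zpow s\<^sub>M) \<odot>\<^bsub>N.T\<^esub> F (uM t)"
      unfolding FT[OF ej, symmetric] t(2) by (rule F_zpow[OF LM[OF t(1)]])
    then have "T\<^sub>N (F (uM (e j))) \<in> Lam N.T n g (k + s\<^sub>M) b"
      using Lam_smult_zpow[OF DN gc L_Lam[OF P t(1)]] by simp
    then obtain y where y': "\<forall>i<n. y i \<in> carrier CK \<and> y i \<in> Lb (k + s\<^sub>M) b"
      and Y_eq: "T\<^sub>N (F (uM (e j))) = lincomb N.T n y g"
      by (rule LamE)
    have y: "y i \<in> carrier CK" "y i \<in> Lb (k + s\<^sub>M) b" if "i < n" for i using y' that by simp_all
    let ?H = "NA.lspan n (\<lambda>i. t\<^sub>N (e' i))"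
    have te: "t\<^sub>N (e' i) \<in> carrier N" if "i < n" for i by (rule semilinD(1)[OF tN LN[OF eL'[OF that]]])
    have sub: "submodule ?H AR N" by (rule NA.lspan_submodule) (use te in blast)
    have mem: "(tau N ^^ r) t \<in> ?H" if t: "t \<in> L'" for t
    proof -
      obtain c where c: "\<And>i. i < n \<Longrightarrow> c i \<in> carrier AR" "t = lincomb N n c e'"
        using frame_basis_expand[OF frN t] by blast
      have "t\<^sub>N t = lincomb N n (\<lambda>i. (laurent_frob q ^^ r) (c i)) (\<lambda>i. t\<^sub>N (e' i))"
        unfolding c(2)
        by (rule semilin_lincomb[OF N.M.module_axioms N.M.module_axioms tN AR_subset_BR[OF c(1)] LN[OF eL']])
      then have "t\<^sub>N t \<in> ?H" using NA.lspanI[OF frob_funpow_AR[OF c(1)]] by simp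
      then show ?thesis unfolding t\<^sub>N_def .
    qed
    have H: "zpow s\<^sub>N \<odot>\<^bsub>N\<^esub> t \<in> ?H" if "t \<in> L'" for t by (rule fN(6)[OF sub mem that])
    have "lincomb N.T n y g \<in> Lam N.T n h (k + s\<^sub>M + - s\<^sub>N) b"
    proof (rule lincomb_mem[OF Lam_zero[OF DN hc] Lam_add[OF DN hc]])
      fix i assume i: "i < n"
      have ei: "e' i \<in> carrier N" by (rule LN[OF eL'[OF i]])
      then have gi: "g i \<in> carrier N.T" using gc i by blast
      obtain d where d': "\<forall>i<n. d i \<in> carrier AR" and d_eq: "zpow s\<^sub>N \<odot>\<^bsub>N\<^esub> e' i = lincomb N n d (\<lambda>i. t\<^sub>N (e' i))"
        by (rule NA.lspanE[OF H[OF eL'[OF i]]])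
      have d: "d i \<in> carrier AR" if "i < n" for i using d' that by blast
      have "uN (zpow s\<^sub>N \<odot>\<^bsub>N\<^esub> e' i) = lincomb N.T n (\<lambda>i. fls_nth (d i)) h"
        unfolding d_eq h_def
        by (rule semilin_lincomb[OF N.M.module_axioms DN uN AR_subset_BR[OF d] te])
      then have "fls_nth (zpow s\<^sub>N) \<odot>\<^bsub>N.T\<^esub> g i = lincomb N.T n (\<lambda>i. fls_nth (d i)) h"
        unfolding uN_zpow[OF ei] g_def .
      then have "y i \<odot>\<^bsub>N.T\<^esub> (fls_nth (zpow s\<^sub>N) \<odot>\<^bsub>N.T\<^esub> g i) \<in> Lam N.T n h (k + s\<^sub>M) b"
        using Lam_scale[OF DN hc y(1)[OF i] y(2)[OF i] d] by (simp only:)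
      then have "fls_nth (zpow (- s\<^sub>N)) \<odot>\<^bsub>N.T\<^esub> (y i \<odot>\<^bsub>N.T\<^esub> (fls_nth (zpow s\<^sub>N) \<odot>\<^bsub>N.T\<^esub> g i)) \<in> Lam N.T n h (k + s\<^sub>M + - s\<^sub>N) b"
        by (rule Lam_smult_zpow[OF DN hc])
      moreover have "y i \<odot>\<^bsub>N.T\<^esub> (fls_nth (zpow s\<^sub>N) \<odot>\<^bsub>N.T\<^esub> g i) = fls_nth (zpow s\<^sub>N) \<odot>\<^bsub>N.T\<^esub> (y i \<odot>\<^bsub>N.T\<^esub> g i)"
        by (rule smult_comm[OF y(1)[OF i] fls_nth_closed[OF zpow_BR] gi])
      ultimately show "y i \<odot>\<^bsub>N.T\<^esub> g i \<in> Lam N.T n h (k + s\<^sub>M + - s\<^sub>N) b"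
        by (simp only: zpow_cancel[OF DN N.T.smult_closed[OF y(1)[OF i] gi]])
    qed
    moreover have "lincomb N.T n y g = lincomb N.T n (\<lambda>i. (disc_frob q ^^ r) (X j i)) h"
    proof -
      have "T\<^sub>N (F (uM (e j))) = lincomb N.T n (\<lambda>i. (disc_frob q ^^ r) (X j i)) (\<lambda>i. T\<^sub>N (g i))"
        unfolding FX[OF j] by (rule semilin_lincomb[OF DN DN TN X[OF j] gc[rule_format]])
      also have "\<dots> = lincomb N.T n (\<lambda>i. (disc_frob q ^^ r) (X j i)) h"
        by (rule lincomb_cong) (simp_all add: g_def h_def TuN LN eL')
      finally show ?thesis using Y_eq by simp
    qed
    ultimately have "lincomb N.T n (\<lambda>i. (disc_frob q ^^ r) (X j i)) h \<in> Lam N.T n h (k + s\<^sub>M + - s\<^sub>N) b" by simp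
    then have "(disc_frob q ^^ r) (X j i) \<in> Lb (k + s\<^sub>M + - s\<^sub>N) b"
      by (rule Lam_coords[OF DN hc bh _ frob_CK[OF X[OF j]] i])
    then have "X j i \<in> Lb (k + s\<^sub>M + - s\<^sub>N) b'" by (rule Lb_frob_inv) (rule bb)
    then show "X j i \<in> Lb (k - (s\<^sub>N - s\<^sub>M)) b'" by (simp add: algebra_simps)
  qed
  have Q: "2 \<le> int (q ^ r)"
  proof -
    have "q ^ 1 \<le> q ^ r" using r q_pos by (intro power_increasing) auto
    then have "2 \<le> q ^ r" using q_ge_2 by simp
    then have "int 2 \<le> int (q ^ r)" by (rule of_nat_mono)
    then show ?thesis by (simp only: of_nat_numeral)
  qed
  have "\<exists>k. P k 1"
    unfolding P_def
  proof (rule uniform_bound)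
    show "\<exists>k. \<forall>i<n. X j i \<in> Lb k 1" if "j < m" for j
      by (rule uniform_bound) (use CK_Lb_small X[OF that] Lb_mono in blast)+
  qed (use Lb_mono in blast)
  moreover have "\<exists>a. P k a" for k
    unfolding P_def
  proof (rule uniform_bound)
    show "\<exists>a. \<forall>i<n. X j i \<in> Lb k a" if "j < m" for j
      by (rule uniform_bound) (use CK_Lb_bounded X[OF that] Lb_mono in blast)+
  qed (use Lb_mono in blast)
  moreover have "P n' a'" if "P n a" "n' \<le> n" "a' \<le> a" for n a n' a'
    using that Lb_mono unfolding P_def by blast
  ultimately have "(\<forall>n. P n 0) \<and> (\<exists>n. \<forall>a. P n a)"
    using valuation_bound_rigidity[OF Q, of P "s\<^sub>N - s\<^sub>M"] up down by blast
  then obtain n0 where integral: "\<And>k. P k 0" and van: "\<And>a. P n0 a" by blast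
  \<comment> \<open>The image of \<open>N\<close> is stable under R((z)), so it is enough that
    \<open>F\<close> maps the basis of \<open>M\<close> into it.\<close>
  let ?S = "uN ` carrier N"
  have S_zero: "\<zero>\<^bsub>N.T\<^esub> \<in> ?S"
    by (rule image_eqI[of _ _ "\<zero>\<^bsub>N\<^esub>"])
      (rule semilin_zero[OF N.M.abelian_group_axioms N.T.abelian_group_axioms uN, symmetric], rule N.M.zero_closed)
  have S_add: "Y \<oplus>\<^bsub>N.T\<^esub> Z \<in> ?S" if Y: "Y \<in> ?S" and Z: "Z \<in> ?S" for Y Z
  proof -
    obtain y where y: "Y = uN y" "y \<in> carrier N" by (rule imageE[OF Y])
    obtain z where z: "Z = uN z" "z \<in> carrier N" by (rule imageE[OF Z])
    show ?thesis
      by (rule image_eqI[of _ _ "y \<oplus>\<^bsub>N\<^esub> z"])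
        (unfold y(1) z(1), rule semilinD(2)[OF uN y(2) z(2), symmetric], rule N.M.a_closed[OF y(2) z(2)])
  qed
  have S_smult: "fls_nth f \<odot>\<^bsub>N.T\<^esub> Y \<in> ?S" if f: "f \<in> carrier BR" and Y: "Y \<in> ?S" for f Y
  proof -
    obtain y where y: "Y = uN y" "y \<in> carrier N" by (rule imageE[OF Y])
    show ?thesis
      by (rule image_eqI[of _ _ "f \<odot>\<^bsub>N\<^esub> y"])
        (unfold y(1), rule semilinD(3)[OF uN f y(2), symmetric], rule N.M.smult_closed[OF f y(2)])
  qed
  have FS: "F (uM (e j)) \<in> ?S" if j: "j < m" for j
    unfolding FX[OF j]
  proof (rule lincomb_mem[OF S_zero S_add])
    fix i assume i: "i < n"
    have "X j i \<in> Lb k 0" "X j i \<in> Lb n0 a" for k a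
      using integral van i j by (simp_all add: P_def)
    then have "\<exists>f\<in>carrier BR. X j i = fls_nth f" by (rule CK_in_BR)
    then obtain f where f: "f \<in> carrier BR" "X j i = fls_nth f" by (rule bexE)
    have "g i \<in> ?S" unfolding g_def by (rule imageI[OF LN[OF eL'[OF i]]])
    then show "X j i \<odot>\<^bsub>N.T\<^esub> g i \<in> ?S" unfolding f(2) by (rule S_smult[OF f(1)])
  qed
  obtain c where c': "(\<forall>i<m. c i \<in> carrier BR) \<and> x = lincomb M m c e"
    using is_basisD(2)[OF fM(3) x] by (rule exE)
  then have c: "c i \<in> carrier BR" if "i < m" for i using that by blast
  have "lincomb N.T m (\<lambda>i. fls_nth (c i)) (\<lambda>i. F (uM (e i))) \<in> ?S"
    by (rule lincomb_mem[OF S_zero S_add S_smult[OF c FS]])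
  then have "F (uM x) \<in> ?S" using c' uM_lc[of c] c by simp
  then obtain y where "F (uM x) = uN y" "y \<in> carrier N" by (rule imageE)
  then show ?thesis unfolding uM_def uN_def by (intro bexI)
qed

end

text \<open>The map \<open>\<iota>\<close> makes K an extension of the field of q elements.
  Morphisms are extensional functions, which is why identities and composites appear as
  \<open>restrict id\<close> and \<open>compose\<close>; \<open>P\<close> serves the composition
  law.\<close>

theorem theorem8p39:
  fixes \<iota> :: "'f::{field,finite} \<Rightarrow> 'k::field"
    and v :: "'k \<Rightarrow> int"
    and q :: nat
    and M :: "('k fls, 'm) tau_module"
    and N :: "('k fls, 'n) tau_module"
    and P :: "('k fls, 'p) tau_module"
  assumes q: "q = CARD('f)"
    and \<iota>_one: "\<iota> 1 = 1"
    and \<iota>_add: "\<And>a b. \<iota> (a + b) = \<iota> a + \<iota> b"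
    and \<iota>_mult: "\<And>a b. \<iota> (a * b) = \<iota> a * \<iota> b"
    and valuation: "discrete_valuation v"
    and complete: "valuation_complete q v"
    and M: "pure_isocrystal q v M"
    and N: "pure_isocrystal q v N"
    and P: "pure_isocrystal q v P"
  shows
    \<comment> \<open>a functor to \<open>\<sigma>\<close>-bundles\<close>
    "sigma_bundle q v (bundle_of q v M) \<and>
     bundle_map q v M M (restrict id (carrier M)) = restrict id (carrier (bundle_of q v M)) \<and>
     (\<forall>f\<in>isocrystal_hom v M N. \<forall>g\<in>isocrystal_hom v N P.
        bundle_map q v M P (compose (carrier M) g f) =
        compose (carrier (bundle_of q v M)) (bundle_map q v N P g) (bundle_map q v M N f)) \<and>
     \<comment> \<open>which is fully faithful\<close>
     bij_betw (bundle_map q v M N)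
       (isocrystal_hom v M N)
       (sigma_bundle_hom q v (bundle_of q v M) (bundle_of q v N))"
proof -
  have "CARD('f) \<ge> 2"
    using card_mono[of UNIV "{0, 1 :: 'f}"] by simp
  then interpret complete_valued_field q v
    using valuation complete finite_field_power_add[of \<iota>, OF \<iota>_one \<iota>_add]
    by unfold_locales (simp_all add: q)
  have iso: "isocrystal q v M" "isocrystal q v N" "isocrystal q v P"
    using M N P unfolding pure_isocrystal_def by blast+
  interpret M: isocrystal_frob q v M by (rule isocrystal_frobI[OF iso(1)])
  interpret N: isocrystal_frob q v N by (rule isocrystal_frobI[OF iso(2)])
  interpret P: isocrystal_frob q v P by (rule isocrystal_frobI[OF iso(3)])
  interpret MN: isocrystal_pair q v M N ..
  have et: "etale_tau_module BR (laurent_frob q) M" "etale_tau_module BR (laurent_frob q) N"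
    using iso by (simp_all add: isocrystal_def)
  obtain L m e r\<^sub>M s\<^sub>M where r\<^sub>M: "r\<^sub>M > 0" and frM: "frame M L m e r\<^sub>M s\<^sub>M" using frame_exists[OF M] by blast
  obtain L' n e' r\<^sub>N s\<^sub>N where r\<^sub>N: "r\<^sub>N > 0" and frN: "frame N L' n e' r\<^sub>N s\<^sub>N" using frame_exists[OF N] by blast
  note bM = frameD(3)[OF frM] and bN = frameD(3)[OF frN]
  have 1: "sigma_bundle q v (bundle_of q v M)"
    unfolding sigma_bundle_def bundle_of_def
    by (rule M.etale_E[OF bM etale_tau_basis[OF et(1) laurent_frob_hom bM]])
  have 2: "bundle_map q v M M (restrict id (carrier M)) = restrict id (carrier (bundle_of q v M))"
    unfolding bundle_map_def bundle_of_def M.E_simps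
    by (rule base_change_map_id[OF M.tensor_base_axioms])
  have 3: "bundle_map q v M P (compose (carrier M) g f) =
        compose (carrier (bundle_of q v M)) (bundle_map q v N P g) (bundle_map q v M N f)"
    if "f \<in> isocrystal_hom v M N" "g \<in> isocrystal_hom v N P" for f g
    unfolding bundle_map_def bundle_of_def M.E_simps
    by (rule base_change_map_compose[OF M.tensor_base_axioms N.tensor_base_axioms P.tensor_base_axioms])
      (use that in \<open>auto simp: isocrystal_hom_def tau_hom_def\<close>)
  \<comment> \<open>Both slopes are written over the denominator r_M r_N: the numerators become s_M
    r_N and s_N r_M.\<close>
  have frN': "frame N L' n e' (r\<^sub>M * r\<^sub>N) (s\<^sub>N * int r\<^sub>M)"
    using N.frame_power[OF frN, of r\<^sub>M] by (simp add: mult.commute)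
  have 4: "bij_betw (bundle_map q v M N) (isocrystal_hom v M N)
       (sigma_bundle_hom q v (bundle_of q v M) (bundle_of q v N))"
    unfolding bundle_map_def[abs_def] bundle_of_def isocrystal_hom_def sigma_bundle_hom_def
  proof (rule MN.map_bij_betw[OF bN fls_nth_inj])
    fix F x assume F: "F \<in> tau_hom CK M.E N.E" and x: "x \<in> carrier M"
    have "r\<^sub>M * r\<^sub>N > 0" using r\<^sub>M r\<^sub>N by simp
    then show "\<exists>y\<in>carrier N. F (M.pt \<one>\<^bsub>CK\<^esub> x) = N.pt \<one>\<^bsub>CK\<^esub> y"
      by (rule MN.fullness[OF F M.frame_power[OF frM, of r\<^sub>N] frN' _
            etale_tau_funpow_basis[OF et(2) laurent_frob_hom bN] x])
  qed
  show ?thesis using 1 2 3 4 by blast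
qed

end
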